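(* The graphical category $\mathbf U$ admits an (orthogonal) factorization system whose left class is the class $\mathbf U_{act}$ of active maps and whose right class is the class $\mathbf U_{emb}$ of embeddings. That is, both classes contain all isomorphisms and are closed under composition, and every morphism of $\mathbf U$ factors as an active map followed by an embedding, uniquely up to unique isomorphism.
   Context: **Graphs.** A graph $G$ consists of finite sets $A$ (arcs), $V$ (vertices), a subset $D\subseteq A$, a fixed-point-free involution $i:A\to A$ and a function $t:D\to V$. Put $\mathrm{nb}(v)=t^{-1}(v)\subseteq D$ and $\eth(G)=A\setminus D$ (the boundary). An edge is an $i$-orbit $[a,ia]$; it is internal if $a,ia\in D$; $E_i$ is the set of internal edges. Graphs are viewed as diagrams of finite sets ($A$ with endomap $i$, $A\leftarrow D\to V$); let $\mathcal D$ be the category of all diagrams of finite sets of this shape, with natural transformations. A graph is connected if it is nonempty and is not a nontrivial coproduct in $\mathcal D$. A natural transformation $G\to G'$ is étale if the square formed by $t:D\to V$, $t':D'\to V'$ is a pullback. The exceptional edge $\updownarrow$ is the graph with $A=\{\natural,\natural^\dagger\}$, $D=V=\varnothing$. For a vertex $v$ of $G$, the star $\star_v$ has vertex set $\{v\}$, $D=\mathrm{nb}(v)$, $A=\mathrm{nb}(v)\amalg \mathrm{nb}(v)^\dagger$ with $i(a)=a^\dagger$. An embedding is an étale map between connected graphs that is injective on vertices. An embedding $f:H\to G$ is injective on $\eth(H)$; put $\eth(f)=f(\eth(H))\subseteq A(G)$. $\mathrm{Emb}(G)$ is the set of embeddings with target $G$ modulo $f\sim fz$ for $z$ an isomorphism;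 a class is called an edge if its domain is isomorphic to $\updownarrow$; $\eth$ is well defined on classes. The map $\iota_v:\star_v\to G$, with $a\mapsto a$, $a^\dagger\mapsto ia$, $v\mapsto v$, is an embedding. **Graphical maps.** For connected graphs $G,G'$ a graphical map $\varphi:G\to G'$ is a pair of functions $\varphi_0:A\to A'$ commuting with the involutions and $\varphi_1:V\to\mathrm{Emb}(G')$ such that, choosing representatives $\varphi_v:H_v\to G'$ of $\varphi_1(v)$: (i) each $w\in V'$ equals $\varphi_v(u)$ for at most one pair $(v,u)$ with $v\in V$, $u\in V(H_v)$; (ii) for each $v$, $a\mapsto \varphi_0(ia)$ is a bijection $\mathrm{nb}(v)\to\eth(\varphi_1(v))$; (iii) if $\eth(G)=\varnothing$ then some $\varphi_1(v)$ is not an edge. For an embedding $f:H\to G$ put $\varphi|_f=(\varphi_0 f,\varphi_1 f):H\to G'$. **Image and composition.** If $G=\updownarrow$, a graphical map $\varphi:G\to G'$ is an embedding and $\mathrm{im}(\varphi)=[\varphi]$. Otherwise let $m_v:i(\mathrm{nb}(v))\to\eth(H_v)$ be the bijection with $\varphi_v m_v=\varphi_0$; order each internal edge $e=[x_e^1,x_e^2]$ of $G$, and let $G\{H_v\}$ be the coequalizer in $\mathcal D$ of the two maps $\coprod_{e\in E_i}\updownarrow\ \rightrightarrows\ \coprod_v H_v$ which on the summand $e$ land in $H_{tx_e^1}$ with $\natural\mapsto m_{tx_e^1}(ix_e^1)$, respectively in $H_{tx_e^2}$ with $\natural^\dagger\mapsto m_{tx_e^2}(ix_e^2)$. The maps $\varphi_v$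 induce an embedding $G\{H_v\}\to G'$, whose class is $\mathrm{im}(\varphi)\in\mathrm{Emb}(G')$. The composite of $\varphi:G\to H$ and $\psi:H\to K$ is $(\psi\varphi)_0=\psi_0\varphi_0$, $(\psi\varphi)_1(v)=\mathrm{im}(\psi|_{\varphi_v})$. The graphical category $\mathbf U$ has connected graphs as objects and graphical maps as morphisms. **The two classes.** $\mathbf U_{emb}$ is the class of graphical maps of the form $(f|_A,\ v\mapsto[\iota_{f(v)}])$ for $f$ an embedding. A graphical map $\varphi:G\to G'$ is active (in $\mathbf U_{act}$) if $\varphi_0$ restricts to a bijection $\eth(G)\to\eth(G')$. *)

theory Defs
  imports Main "HOL-Library.FuncSet"
begin

text \<open>
  All maps between carrier sets are extensional functions (\<open>\<rightarrow>\<^sub>E\<close>, \<open>compose\<close>, \<open>restrict\<close>),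
  so that HOL equality is equality of maps.  Carriers are finite subsets of ambient types; auxiliary
  diagrams (coproducts, coequalizers, stars) live over other types than the graphs they
  are built from, hence the heterogeneous types of morphisms.
\<close>

section \<open>The category of diagrams \<open>A \<circlearrowleft>, A \<leftarrow> D \<rightarrow> V\<close> of finite sets\<close>

record ('a, 'd, 'v) diag =
  arcs :: "'a set"
  darts :: "'d set"
  verts :: "'v set"
  dag :: "'a \<Rightarrow> 'a"
  inc :: "'d \<Rightarrow> 'a"
  att :: "'d \<Rightarrow> 'v"

record ('a, 'd, 'v, 'b, 'e, 'w) dmap =
  on_arcs :: "'a \<Rightarrow> 'b"
  on_darts :: "'d \<Rightarrow> 'e"
  on_verts :: "'v \<Rightarrow> 'w"

definition diagram :: "('a, 'd, 'v) diag \<Rightarrow> bool" where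
  "diagram X \<longleftrightarrow>
     finite (arcs X) \<and> finite (darts X) \<and> finite (verts X) \<and>
     dag X \<in> arcs X \<rightarrow>\<^sub>E arcs X \<and> inc X \<in> darts X \<rightarrow>\<^sub>E arcs X \<and> att X \<in> darts X \<rightarrow>\<^sub>E verts X"

definition dhom :: "('a, 'd, 'v) diag \<Rightarrow> ('b, 'e, 'w) diag \<Rightarrow> ('a, 'd, 'v, 'b, 'e, 'w) dmap set" where
  "dhom X Y = {f.
     on_arcs f \<in> arcs X \<rightarrow>\<^sub>E arcs Y \<and>
     on_darts f \<in> darts X \<rightarrow>\<^sub>E darts Y \<and>
     on_verts f \<in> verts X \<rightarrow>\<^sub>E verts Y \<and>
     (\<forall>a\<in>arcs X. on_arcs f (dag X a) = dag Y (on_arcs f a)) \<and>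
     (\<forall>d\<in>darts X. on_arcs f (inc X d) = inc Y (on_darts f d)) \<and>
     (\<forall>d\<in>darts X. on_verts f (att X d) = att Y (on_darts f d))}"

definition did :: "('a, 'd, 'v) diag \<Rightarrow> ('a, 'd, 'v, 'a, 'd, 'v) dmap" where
  "did X = \<lparr>on_arcs = (\<lambda>a\<in>arcs X. a), on_darts = (\<lambda>d\<in>darts X. d), on_verts = (\<lambda>v\<in>verts X. v)\<rparr>"

definition dcomp ::
  "('a, 'd, 'v) diag \<Rightarrow> ('b, 'e, 'w, 'c, 'f, 'u) dmap \<Rightarrow> ('a, 'd, 'v, 'b, 'e, 'w) dmap
     \<Rightarrow> ('a, 'd, 'v, 'c, 'f, 'u) dmap" where
  "dcomp X g f =
     \<lparr>on_arcs = compose (arcs X) (on_arcs g) (on_arcs f),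
      on_darts = compose (darts X) (on_darts g) (on_darts f),
      on_verts = compose (verts X) (on_verts g) (on_verts f)\<rparr>"

definition diso ::
  "('a, 'd, 'v) diag \<Rightarrow> ('b, 'e, 'w) diag \<Rightarrow> ('a, 'd, 'v, 'b, 'e, 'w) dmap \<Rightarrow> bool" where
  "diso X Y f \<longleftrightarrow> f \<in> dhom X Y \<and> (\<exists>g\<in>dhom Y X. dcomp X g f = did X \<and> dcomp Y f g = did Y)"

definition isomorphic :: "('a, 'd, 'v) diag \<Rightarrow> ('b, 'e, 'w) diag \<Rightarrow> bool" where
  "isomorphic X Y \<longleftrightarrow> (\<exists>f. diso X Y f)"

definition dcoprod :: "'i set \<Rightarrow> ('i \<Rightarrow> ('a, 'd, 'v) diag) \<Rightarrow> ('i \<times> 'a, 'i \<times> 'd, 'i \<times> 'v) diag" where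
  "dcoprod I X =
     \<lparr>arcs = (SIGMA i:I. arcs (X i)),
      darts = (SIGMA i:I. darts (X i)),
      verts = (SIGMA i:I. verts (X i)),
      dag = (\<lambda>(i, a)\<in>(SIGMA i:I. arcs (X i)). (i, dag (X i) a)),
      inc = (\<lambda>(i, d)\<in>(SIGMA i:I. darts (X i)). (i, inc (X i) d)),
      att = (\<lambda>(i, d)\<in>(SIGMA i:I. darts (X i)). (i, att (X i) d))\<rparr>"

definition dcotuple ::
  "'i set \<Rightarrow> ('i \<Rightarrow> ('a, 'd, 'v) diag) \<Rightarrow> ('i \<Rightarrow> ('a, 'd, 'v, 'b, 'e, 'w) dmap)
     \<Rightarrow> ('i \<times> 'a, 'i \<times> 'd, 'i \<times> 'v, 'b, 'e, 'w) dmap" where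
  "dcotuple I X f =
     \<lparr>on_arcs = (\<lambda>(i, a)\<in>(SIGMA i:I. arcs (X i)). on_arcs (f i) a),
      on_darts = (\<lambda>(i, d)\<in>(SIGMA i:I. darts (X i)). on_darts (f i) d),
      on_verts = (\<lambda>(i, v)\<in>(SIGMA i:I. verts (X i)). on_verts (f i) v)\<rparr>"

definition generated_equiv :: "'x set \<Rightarrow> ('x \<times> 'x) set \<Rightarrow> ('x \<times> 'x) set" where
  "generated_equiv S r = \<Inter>{E. equiv S E \<and> r \<subseteq> E}"

definition coeq_arcs where
  "coeq_arcs X Y f g = generated_equiv (arcs Y) ((\<lambda>a. (on_arcs f a, on_arcs g a)) ` arcs X)"

definition coeq_darts where
  "coeq_darts X Y f g = generated_equiv (darts Y) ((\<lambda>d. (on_darts f d, on_darts g d)) ` darts X)"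

definition coeq_verts where
  "coeq_verts X Y f g = generated_equiv (verts Y) ((\<lambda>v. (on_verts f v, on_verts g v)) ` verts X)"

text \<open>
  Coequalizers are computed pointwise.  In the structure maps, the union over a class \<open>c\<close> is a union of equal
  sets, namely the class of the image of any element of \<open>c\<close>.
\<close>

definition dcoeq ::
  "('b, 'e, 'w) diag \<Rightarrow> ('a, 'd, 'v) diag \<Rightarrow> ('b, 'e, 'w, 'a, 'd, 'v) dmap
     \<Rightarrow> ('b, 'e, 'w, 'a, 'd, 'v) dmap \<Rightarrow> ('a set, 'd set, 'v set) diag" where
  "dcoeq X Y f g =
     \<lparr>arcs = arcs Y // coeq_arcs X Y f g,
      darts = darts Y // coeq_darts X Y f g,
      verts = verts Y // coeq_verts X Y f g,
      dag = (\<lambda>c\<in>arcs Y // coeq_arcs X Y f g. \<Union>a\<in>c. coeq_arcs X Y f g `` {dag Y a}),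
      inc = (\<lambda>c\<in>darts Y // coeq_darts X Y f g. \<Union>d\<in>c. coeq_arcs X Y f g `` {inc Y d}),
      att = (\<lambda>c\<in>darts Y // coeq_darts X Y f g. \<Union>d\<in>c. coeq_verts X Y f g `` {att Y d})\<rparr>"

definition dcoeq_proj ::
  "('b, 'e, 'w) diag \<Rightarrow> ('a, 'd, 'v) diag \<Rightarrow> ('b, 'e, 'w, 'a, 'd, 'v) dmap
     \<Rightarrow> ('b, 'e, 'w, 'a, 'd, 'v) dmap \<Rightarrow> ('a, 'd, 'v, 'a set, 'd set, 'v set) dmap" where
  "dcoeq_proj X Y f g =
     \<lparr>on_arcs = (\<lambda>a\<in>arcs Y. coeq_arcs X Y f g `` {a}),
      on_darts = (\<lambda>d\<in>darts Y. coeq_darts X Y f g `` {d}),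
      on_verts = (\<lambda>v\<in>verts Y. coeq_verts X Y f g `` {v})\<rparr>"

section \<open>Graphs, connectedness, embeddings\<close>

type_synonym ('a, 'v) graph = "('a, 'a, 'v) diag"

definition is_graph :: "('a, 'v) graph \<Rightarrow> bool" where
  "is_graph G \<longleftrightarrow> diagram G \<and> darts G \<subseteq> arcs G \<and> inc G = (\<lambda>d\<in>darts G. d) \<and>
     (\<forall>a\<in>arcs G. dag G (dag G a) = a \<and> dag G a \<noteq> a)"

definition nb :: "('a, 'v) graph \<Rightarrow> 'v \<Rightarrow> 'a set" where
  "nb G v = {d\<in>darts G. att G d = v}"

definition bdry :: "('a, 'v) graph \<Rightarrow> 'a set" where
  "bdry G = arcs G - darts G"

definition inner_edges :: "('a, 'v) graph \<Rightarrow> 'a set set" where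
  "inner_edges G = {{a, dag G a} | a. a \<in> darts G \<and> dag G a \<in> darts G}"

definition nonempty :: "('a, 'd, 'v) diag \<Rightarrow> bool" where
  "nonempty X \<longleftrightarrow> arcs X \<noteq> {} \<or> darts X \<noteq> {} \<or> verts X \<noteq> {}"

text \<open>
  The summands embed into \<open>X\<close>, so it is no restriction that they range over the
  same types as \<open>X\<close>.
\<close>

definition dconnected :: "('a, 'd, 'v) diag \<Rightarrow> bool" where
  "dconnected X \<longleftrightarrow> nonempty X \<and>
     \<not> (\<exists>Y :: bool \<Rightarrow> ('a, 'd, 'v) diag.
           (\<forall>b. diagram (Y b) \<and> nonempty (Y b)) \<and> isomorphic X (dcoprod UNIV Y))"

text \<open>The pullback condition: \<open>D\<close> maps bijectively to the fibre product of \<open>D'\<close> and \<open>V\<close> over \<open>V'\<close>.\<close>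

definition etale ::
  "('a, 'd, 'v) diag \<Rightarrow> ('b, 'e, 'w) diag \<Rightarrow> ('a, 'd, 'v, 'b, 'e, 'w) dmap \<Rightarrow> bool" where
  "etale X Y f \<longleftrightarrow> f \<in> dhom X Y \<and>
     bij_betw (\<lambda>d. (on_darts f d, att X d)) (darts X)
       {(e, v). e \<in> darts Y \<and> v \<in> verts X \<and> att Y e = on_verts f v}"

definition embedding ::
  "('b, 'w) graph \<Rightarrow> ('a, 'v) graph \<Rightarrow> ('b, 'b, 'w, 'a, 'a, 'v) dmap \<Rightarrow> bool" where
  "embedding H G f \<longleftrightarrow> is_graph H \<and> dconnected H \<and> is_graph G \<and> dconnected G \<and>
     etale H G f \<and> inj_on (on_verts f) (verts H)"

text \<open>The exceptional edge; \<open>True\<close> is \<open>\<natural>\<close> and \<open>False\<close> is its opposite arc.\<close>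

definition exc_edge :: "(bool, unit) graph" where
  "exc_edge = \<lparr>arcs = UNIV, darts = {}, verts = {}, dag = Not,
     inc = (\<lambda>_. undefined), att = (\<lambda>_. undefined)\<rparr>"

text \<open>In the star of \<open>v\<close>, \<open>Inl a\<close> is the dart \<open>a\<close> and \<open>Inr a\<close> is its formal opposite.\<close>

definition star :: "('a, 'v) graph \<Rightarrow> 'v \<Rightarrow> ('a + 'a, 'v) graph" where
  "star G v =
     \<lparr>arcs = nb G v <+> nb G v,
      darts = Inl ` nb G v,
      verts = {v},
      dag = (\<lambda>x\<in>nb G v <+> nb G v. case x of Inl a \<Rightarrow> Inr a | Inr a \<Rightarrow> Inl a),
      inc = (\<lambda>x\<in>Inl ` nb G v. x),
      att = (\<lambda>x\<in>Inl ` nb G v. v)\<rparr>"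

definition iota :: "('a, 'v) graph \<Rightarrow> 'v \<Rightarrow> ('a + 'a, 'a + 'a, 'v, 'a, 'a, 'v) dmap" where
  "iota G v =
     \<lparr>on_arcs = (\<lambda>x\<in>nb G v <+> nb G v. case x of Inl a \<Rightarrow> a | Inr a \<Rightarrow> dag G a),
      on_darts = (\<lambda>x\<in>Inl ` nb G v. projl x),
      on_verts = (\<lambda>u\<in>{v}. u)\<rparr>"

section \<open>Classes of embeddings\<close>

type_synonym ('a, 'v) emb = "('a, 'v) graph \<times> ('a, 'a, 'v, 'a, 'a, 'v) dmap"

text \<open>
  The class of an embedding \<open>g\<close> with target \<open>G\<close>.  Its domain \<open>X\<close> may live over any types,
  but the representatives in the class are taken over the types of \<open>G\<close>.  If these types are infinite, every
  finite graph is isomorphic to one over them, so no class of embeddings is lost.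
\<close>

definition emb_class ::
  "('a, 'v) graph \<Rightarrow> ('b, 'e, 'w) diag \<Rightarrow> ('b, 'e, 'w, 'a, 'a, 'v) dmap \<Rightarrow> ('a, 'v) emb set" where
  "emb_class G X g = {(H, f). embedding H G f \<and> (\<exists>z. diso H X z \<and> f = dcomp H g z)}"

definition Emb :: "('a, 'v) graph \<Rightarrow> ('a, 'v) emb set set" where
  "Emb G = {emb_class G H f | (H :: ('a, 'v) graph) f. embedding H G f}"

definition emb_rep :: "('a, 'v) emb set \<Rightarrow> ('a, 'v) emb" where
  "emb_rep c = (SOME p. p \<in> c)"

definition emb_dom :: "('a, 'v) emb set \<Rightarrow> ('a, 'v) graph" where
  "emb_dom c = fst (emb_rep c)"

definition emb_map :: "('a, 'v) emb set \<Rightarrow> ('a, 'a, 'v, 'a, 'a, 'v) dmap" where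
  "emb_map c = snd (emb_rep c)"

definition is_edge :: "('a, 'v) emb set \<Rightarrow> bool" where
  "is_edge c \<longleftrightarrow> isomorphic (emb_dom c) exc_edge"

definition emb_bdry :: "('a, 'v) emb set \<Rightarrow> 'a set" where
  "emb_bdry c = on_arcs (emb_map c) ` bdry (emb_dom c)"

section \<open>Graphical maps\<close>

record ('a, 'v) gmap =
  on0 :: "'a \<Rightarrow> 'a"
  on1 :: "'v \<Rightarrow> ('a, 'v) emb set"

definition graphical_map :: "('a, 'v) graph \<Rightarrow> ('a, 'v) graph \<Rightarrow> ('a, 'v) gmap \<Rightarrow> bool" where
  "graphical_map G G' \<phi> \<longleftrightarrow>
     is_graph G \<and> dconnected G \<and> is_graph G' \<and> dconnected G' \<and>
     on0 \<phi> \<in> arcs G \<rightarrow>\<^sub>E arcs G' \<and>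
     on1 \<phi> \<in> verts G \<rightarrow>\<^sub>E Emb G' \<and>
     (\<forall>a\<in>arcs G. on0 \<phi> (dag G a) = dag G' (on0 \<phi> a)) \<and>
     inj_on (\<lambda>(v, u). on_verts (emb_map (on1 \<phi> v)) u) (SIGMA v:verts G. verts (emb_dom (on1 \<phi> v))) \<and>
     (\<forall>v\<in>verts G. bij_betw (\<lambda>a. on0 \<phi> (dag G a)) (nb G v) (emb_bdry (on1 \<phi> v))) \<and>
     (bdry G = {} \<longrightarrow> (\<exists>v\<in>verts G. \<not> is_edge (on1 \<phi> v)))"

definition gmap_restrict ::
  "('a, 'v) graph \<Rightarrow> ('a, 'v) gmap \<Rightarrow> ('a, 'a, 'v, 'a, 'a, 'v) dmap \<Rightarrow> ('a, 'v) gmap" where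
  "gmap_restrict H \<phi> f =
     \<lparr>on0 = compose (arcs H) (on0 \<phi>) (on_arcs f),
      on1 = compose (verts H) (on1 \<phi>) (on_verts f)\<rparr>"

section \<open>Images and composition\<close>

definition pieces :: "('a, 'v) graph \<Rightarrow> ('a, 'v) gmap \<Rightarrow> ('v \<times> 'a, 'v \<times> 'a, 'v \<times> 'v) diag" where
  "pieces G \<phi> = dcoprod (verts G) (\<lambda>v. emb_dom (on1 \<phi> v))"

definition glue_edges :: "('a, 'v) graph \<Rightarrow> ('a set \<times> bool, 'a set \<times> bool, 'a set \<times> unit) diag" where
  "glue_edges G = dcoprod (inner_edges G) (\<lambda>_. exc_edge)"

text \<open>The bijection \<open>m\<^sub>v : i(nb v) \<rightarrow> \<eth>(H\<^sub>v)\<close> with \<open>\<phi>\<^sub>v m\<^sub>v = \<phi>\<^sub>0\<close>.\<close>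

definition bmatch :: "('a, 'v) gmap \<Rightarrow> 'v \<Rightarrow> 'a \<Rightarrow> 'a" where
  "bmatch \<phi> v a = inv_into (bdry (emb_dom (on1 \<phi> v))) (on_arcs (emb_map (on1 \<phi> v))) (on0 \<phi> a)"

text \<open>An ordering \<open>(x\<^sup>1, x\<^sup>2)\<close> of each internal edge.\<close>

definition end1 :: "'a set \<Rightarrow> 'a" where
  "end1 e = (SOME x. x \<in> e)"

definition end2 :: "('a, 'v) graph \<Rightarrow> 'a set \<Rightarrow> 'a" where
  "end2 G e = dag G (end1 e)"

definition glue1 ::
  "('a, 'v) graph \<Rightarrow> ('a, 'v) gmap
     \<Rightarrow> ('a set \<times> bool, 'a set \<times> bool, 'a set \<times> unit, 'v \<times> 'a, 'v \<times> 'a, 'v \<times> 'v) dmap" where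
  "glue1 G \<phi> =
     \<lparr>on_arcs = (\<lambda>(e, b)\<in>arcs (glue_edges G).
        let x = end1 e; v = att G x; y = bmatch \<phi> v (dag G x)
        in (v, if b then y else dag (emb_dom (on1 \<phi> v)) y)),
      on_darts = (\<lambda>_. undefined),
      on_verts = (\<lambda>_. undefined)\<rparr>"

definition glue2 ::
  "('a, 'v) graph \<Rightarrow> ('a, 'v) gmap
     \<Rightarrow> ('a set \<times> bool, 'a set \<times> bool, 'a set \<times> unit, 'v \<times> 'a, 'v \<times> 'a, 'v \<times> 'v) dmap" where
  "glue2 G \<phi> =
     \<lparr>on_arcs = (\<lambda>(e, b)\<in>arcs (glue_edges G).
        let x = end2 G e; v = att G x; y = bmatch \<phi> v (dag G x)
        in (v, if b then dag (emb_dom (on1 \<phi> v)) y else y)),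
      on_darts = (\<lambda>_. undefined),
      on_verts = (\<lambda>_. undefined)\<rparr>"

text \<open>\<open>substitution G \<phi>\<close> is \<open>G{H\<^sub>v}\<close>; \<open>substitution_map\<close> is the unique map to \<open>G'\<close> that restricts
  to \<open>\<phi>\<^sub>v\<close> on each \<open>H\<^sub>v\<close>.\<close>

definition substitution ::
  "('a, 'v) graph \<Rightarrow> ('a, 'v) gmap \<Rightarrow> (('v \<times> 'a) set, ('v \<times> 'a) set, ('v \<times> 'v) set) diag" where
  "substitution G \<phi> = dcoeq (glue_edges G) (pieces G \<phi>) (glue1 G \<phi>) (glue2 G \<phi>)"

definition substitution_map ::
  "('a, 'v) graph \<Rightarrow> ('a, 'v) graph \<Rightarrow> ('a, 'v) gmap
     \<Rightarrow> (('v \<times> 'a) set, ('v \<times> 'a) set, ('v \<times> 'v) set, 'a, 'a, 'v) dmap" where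
  "substitution_map G G' \<phi> = (THE h. h \<in> dhom (substitution G \<phi>) G' \<and>
     dcomp (pieces G \<phi>) h (dcoeq_proj (glue_edges G) (pieces G \<phi>) (glue1 G \<phi>) (glue2 G \<phi>)) =
     dcotuple (verts G) (\<lambda>v. emb_dom (on1 \<phi> v)) (\<lambda>v. emb_map (on1 \<phi> v)))"

text \<open>A graph isomorphic to the exceptional edge has no darts and no vertices.\<close>

definition gimage :: "('a, 'v) graph \<Rightarrow> ('a, 'v) graph \<Rightarrow> ('a, 'v) gmap \<Rightarrow> ('a, 'v) emb set" where
  "gimage G G' \<phi> =
     (if isomorphic G exc_edge
      then emb_class G' G
             \<lparr>on_arcs = on0 \<phi>, on_darts = (\<lambda>_. undefined), on_verts = (\<lambda>_. undefined)\<rparr>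
      else emb_class G' (substitution G \<phi>) (substitution_map G G' \<phi>))"

text \<open>The composite of \<open>\<phi> : G \<rightarrow> H\<close> and \<open>\<psi> : H \<rightarrow> K\<close>; it does not depend on \<open>H\<close> beyond \<open>\<phi>\<close> and \<open>\<psi>\<close>.\<close>

definition gcomp ::
  "('a, 'v) graph \<Rightarrow> ('a, 'v) graph \<Rightarrow> ('a, 'v) gmap \<Rightarrow> ('a, 'v) gmap \<Rightarrow> ('a, 'v) gmap" where
  "gcomp G K \<psi> \<phi> =
     \<lparr>on0 = compose (arcs G) (on0 \<psi>) (on0 \<phi>),
      on1 = (\<lambda>v\<in>verts G. gimage (emb_dom (on1 \<phi> v)) K
               (gmap_restrict (emb_dom (on1 \<phi> v)) \<psi> (emb_map (on1 \<phi> v))))\<rparr>"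

definition gmap_of_emb ::
  "('a, 'v) graph \<Rightarrow> ('a, 'v) graph \<Rightarrow> ('a, 'a, 'v, 'a, 'a, 'v) dmap \<Rightarrow> ('a, 'v) gmap" where
  "gmap_of_emb G G' f =
     \<lparr>on0 = on_arcs f,
      on1 = (\<lambda>v\<in>verts G. emb_class G' (star G' (on_verts f v)) (iota G' (on_verts f v)))\<rparr>"

section \<open>Categories and orthogonal factorization systems\<close>

record ('o, 'm) cat =
  obj :: "'o set"
  hom :: "'o \<Rightarrow> 'o \<Rightarrow> 'm set"
  ident :: "'o \<Rightarrow> 'm"
  cmp :: "'o \<Rightarrow> 'o \<Rightarrow> 'o \<Rightarrow> 'm \<Rightarrow> 'm \<Rightarrow> 'm"

text \<open>The record holds the data of a category only.  \<open>cmp C X Y Z g f\<close> is the composite of \<open>f : X \<rightarrow> Y\<close> and \<open>g : Y \<rightarrow> Z\<close>.\<close>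

definition isos :: "('o, 'm) cat \<Rightarrow> 'o \<Rightarrow> 'o \<Rightarrow> 'm set" where
  "isos C X Y = {f\<in>hom C X Y. \<exists>g\<in>hom C Y X.
     cmp C X Y X g f = ident C X \<and> cmp C Y X Y f g = ident C Y}"

definition orthogonal_factorization_system ::
  "('o, 'm) cat \<Rightarrow> ('o \<Rightarrow> 'o \<Rightarrow> 'm set) \<Rightarrow> ('o \<Rightarrow> 'o \<Rightarrow> 'm set) \<Rightarrow> bool" where
  "orthogonal_factorization_system C L R \<longleftrightarrow>
     (\<forall>X\<in>obj C. \<forall>Y\<in>obj C. L X Y \<subseteq> hom C X Y \<and> R X Y \<subseteq> hom C X Y) \<and>
     (\<forall>X\<in>obj C. \<forall>Y\<in>obj C. isos C X Y \<subseteq> L X Y \<and> isos C X Y \<subseteq> R X Y) \<and>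
     (\<forall>X\<in>obj C. \<forall>Y\<in>obj C. \<forall>Z\<in>obj C. \<forall>f\<in>L X Y. \<forall>g\<in>L Y Z. cmp C X Y Z g f \<in> L X Z) \<and>
     (\<forall>X\<in>obj C. \<forall>Y\<in>obj C. \<forall>Z\<in>obj C. \<forall>f\<in>R X Y. \<forall>g\<in>R Y Z. cmp C X Y Z g f \<in> R X Z) \<and>
     (\<forall>X\<in>obj C. \<forall>Y\<in>obj C. \<forall>f\<in>hom C X Y.
        (\<exists>Z\<in>obj C. \<exists>l\<in>L X Z. \<exists>r\<in>R Z Y. cmp C X Z Y r l = f) \<and>
        (\<forall>Z\<in>obj C. \<forall>Z'\<in>obj C. \<forall>l\<in>L X Z. \<forall>r\<in>R Z Y. \<forall>l'\<in>L X Z'. \<forall>r'\<in>R Z' Y.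
           cmp C X Z Y r l = f \<and> cmp C X Z' Y r' l' = f \<longrightarrow>
           (\<exists>!h. h \<in> isos C Z Z' \<and> cmp C X Z Z' h l = l' \<and> cmp C Z Z' Y r' h = r)))"

definition graphical_category :: "(('a, 'v) graph, ('a, 'v) gmap) cat" where
  "graphical_category =
     \<lparr>obj = {G. is_graph G \<and> dconnected G},
      hom = (\<lambda>G G'. {\<phi>. graphical_map G G' \<phi>}),
      ident = (\<lambda>G. gmap_of_emb G G (did G)),
      cmp = (\<lambda>G H K. gcomp G K)\<rparr>"

definition embedding_maps :: "('a, 'v) graph \<Rightarrow> ('a, 'v) graph \<Rightarrow> ('a, 'v) gmap set" where
  "embedding_maps G G' = {gmap_of_emb G G' f | f. embedding G G' f}"

definition active_maps :: "('a, 'v) graph \<Rightarrow> ('a, 'v) graph \<Rightarrow> ('a, 'v) gmap set" where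
  "active_maps G G' = {\<phi>. graphical_map G G' \<phi> \<and> bij_betw (on0 \<phi>) (bdry G) (bdry G')}"

end

theory Submission
  imports Defs
begin

text \<open>
  An embedding into a connected graph is determined, up to isomorphism of its domain, by the image
  \<open>W\<close> of its vertices and the image \<open>B\<close> of its boundary
  (\<open>presentation_unique\<close>): the darts of the domain are the darts at vertices in
  \<open>W\<close>, and such a dart has been cut from its opposite exactly if the opposite lies in
  \<open>B\<close>; if \<open>W\<close> is empty, the domain is an edge with image
  \<open>B\<close>. For a graphical map \<open>\<phi>\<close> the boundaries of the values are
  prescribed by the action on arcs. Hence \<open>\<phi>\<close> is the same as its action
  \<open>\<phi>\<^sub>0\<close> on arcs together with the family of vertex sets
  \<open>W\<^sub>v\<close> of its values (\<open>graphical_map_eqI\<close>), and a composite is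
  described by the composite of the arc maps and by unions of vertex sets
  (\<open>gcomp_graphical\<close>).

  The main point is the analysis of the graph substitution \<open>G{H\<^sub>v}\<close>: it is
  connected, its map to the target is an embedding with \<open>W = \<Union>W\<^sub>v\<close> and
  with \<open>B = \<phi>\<^sub>0(\<eth>(G))\<close>, and \<open>\<phi>\<close> lifts to a map from
  \<open>G\<close> to it that is bijective on boundaries (\<open>gimage_factorization\<close>).
  Its darts and vertices are those of the pieces; its arcs are chains of arcs of pieces, each
  glued to the next along an inner edge of \<open>G\<close>, which can be long because pieces can
  be exceptional edges. That every chain ends (\<open>reaches_terminal\<close>) uses the condition
  that a graphical map from a graph without boundary is not edge-valued everywhere, and that the
  end of a chain is unique makes the boundary the expected one.

  This lift followed by the image embedding is the factorization. For uniqueness, the embedding in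
  any factorization of \<open>f\<close> into an active map and an embedding has the vertices and
  the boundary of the image of \<open>f\<close>, because an active map covers all vertices of its
  target (\<open>active_cover\<close>). This gives an isomorphism \<open>z\<close> between the two
  middle graphs that is compatible with the embeddings. It is compatible with the active maps as
  well, because lifts of graphical maps along an embedding that preserve boundary arcs are unique
  (\<open>lift_unique\<close>), although embeddings are not injective on arcs. The same lemma
  shows that \<open>z\<close> is unique, once isomorphisms of the graphical category are known to
  come from embeddings of graphs (\<open>iso_is_embedding\<close>).
\<close>

section \<open>Isomorphisms and connectedness of diagrams\<close>

lemma dhomD:
  assumes "f \<in> dhom X Y"
  shows "on_arcs f \<in> arcs X \<rightarrow>\<^sub>E arcs Y" "on_darts f \<in> darts X \<rightarrow>\<^sub>E darts Y"
    "on_verts f \<in> verts X \<rightarrow>\<^sub>E verts Y"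
    "a \<in> arcs X \<Longrightarrow> on_arcs f a \<in> arcs Y"
    "d \<in> darts X \<Longrightarrow> on_darts f d \<in> darts Y"
    "v \<in> verts X \<Longrightarrow> on_verts f v \<in> verts Y"
    "a \<in> arcs X \<Longrightarrow> on_arcs f (dag X a) = dag Y (on_arcs f a)"
    "d \<in> darts X \<Longrightarrow> on_arcs f (inc X d) = inc Y (on_darts f d)"
    "d \<in> darts X \<Longrightarrow> on_verts f (att X d) = att Y (on_darts f d)"
  using assms unfolding dhom_def by blast+

lemma diagramD:
  assumes "diagram X"
  shows "a \<in> arcs X \<Longrightarrow> dag X a \<in> arcs X" "d \<in> darts X \<Longrightarrow> inc X d \<in> arcs X"
    "d \<in> darts X \<Longrightarrow> att X d \<in> verts X"
    "finite (arcs X)" "finite (darts X)" "finite (verts X)"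
  using assms unfolding diagram_def by blast+

lemma PiE_eqI:
  assumes "f \<in> A \<rightarrow>\<^sub>E B" "g \<in> A \<rightarrow>\<^sub>E C" "\<And>x. x \<in> A \<Longrightarrow> f x = g x"
  shows "f = g"
proof
  fix x show "f x = g x"
    using assms by (cases "x \<in> A") (auto simp: PiE_arb[OF assms(1)] PiE_arb[OF assms(2)])
qed

lemma dmap_eqI:
  fixes f g :: "('a, 'd, 'v, 'b, 'e, 'w) dmap"
  assumes "f \<in> dhom X Y" "g \<in> dhom X Z"
    "\<And>a. a \<in> arcs X \<Longrightarrow> on_arcs f a = on_arcs g a"
    "\<And>d. d \<in> darts X \<Longrightarrow> on_darts f d = on_darts g d"
    "\<And>v. v \<in> verts X \<Longrightarrow> on_verts f v = on_verts g v"
  shows "f = g"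
proof (rule dmap.equality)
  show "on_arcs f = on_arcs g"
    by (rule PiE_eqI[OF dhomD(1)[OF assms(1)] dhomD(1)[OF assms(2)] assms(3)])
  show "on_darts f = on_darts g"
    by (rule PiE_eqI[OF dhomD(2)[OF assms(1)] dhomD(2)[OF assms(2)] assms(4)])
  show "on_verts f = on_verts g"
    by (rule PiE_eqI[OF dhomD(3)[OF assms(1)] dhomD(3)[OF assms(2)] assms(5)])
qed simp

lemma dcomp_simps [simp]:
  "a \<in> arcs X \<Longrightarrow> on_arcs (dcomp X g f) a = on_arcs g (on_arcs f a)"
  "d \<in> darts X \<Longrightarrow> on_darts (dcomp X g f) d = on_darts g (on_darts f d)"
  "v \<in> verts X \<Longrightarrow> on_verts (dcomp X g f) v = on_verts g (on_verts f v)"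
  by (simp_all add: dcomp_def compose_def)

lemma did_simps [simp]:
  "a \<in> arcs X \<Longrightarrow> on_arcs (did X) a = a"
  "d \<in> darts X \<Longrightarrow> on_darts (did X) d = d"
  "v \<in> verts X \<Longrightarrow> on_verts (did X) v = v"
  by (simp_all add: did_def)

lemma did_hom: "diagram X \<Longrightarrow> did X \<in> dhom X X"
  by (auto simp: dhom_def did_def diagramD)

lemma dcomp_hom:
  assumes "diagram X" "f \<in> dhom X Y" "g \<in> dhom Y Z"
  shows "dcomp X g f \<in> dhom X Z"
  using assms unfolding dhom_def
  by (auto simp: diagramD dcomp_def compose_def PiE_mem)

lemma diso_iff_bij:
  assumes X: "diagram X"
  shows "diso X Y f \<longleftrightarrow> f \<in> dhom X Y \<and> bij_betw (on_arcs f) (arcs X) (arcs Y) \<and>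
    bij_betw (on_darts f) (darts X) (darts Y) \<and> bij_betw (on_verts f) (verts X) (verts Y)"
    (is "_ \<longleftrightarrow> ?R")
proof
  show "?R" if "diso X Y f"
  proof -
    from that obtain g where f: "f \<in> dhom X Y" and g: "g \<in> dhom Y X"
      and gf: "dcomp X g f = did X" and fg: "dcomp Y f g = did Y"
      unfolding diso_def by blast
    have "bij_betw (on_arcs f) (arcs X) (arcs Y)"
    proof (rule bij_betw_byWitness[where f' = "on_arcs g"])
      show "\<forall>a\<in>arcs X. on_arcs g (on_arcs f a) = a"
        by (metis gf dcomp_simps(1) did_simps(1))
      show "\<forall>a\<in>arcs Y. on_arcs f (on_arcs g a) = a"
        by (metis fg dcomp_simps(1) did_simps(1))
    qed (use f g in \<open>auto simp: dhomD\<close>)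
    moreover have "bij_betw (on_darts f) (darts X) (darts Y)"
    proof (rule bij_betw_byWitness[where f' = "on_darts g"])
      show "\<forall>a\<in>darts X. on_darts g (on_darts f a) = a"
        by (metis gf dcomp_simps(2) did_simps(2))
      show "\<forall>a\<in>darts Y. on_darts f (on_darts g a) = a"
        by (metis fg dcomp_simps(2) did_simps(2))
    qed (use f g in \<open>auto simp: dhomD\<close>)
    moreover have "bij_betw (on_verts f) (verts X) (verts Y)"
    proof (rule bij_betw_byWitness[where f' = "on_verts g"])
      show "\<forall>a\<in>verts X. on_verts g (on_verts f a) = a"
        by (metis gf dcomp_simps(3) did_simps(3))
      show "\<forall>a\<in>verts Y. on_verts f (on_verts g a) = a"
        by (metis fg dcomp_simps(3) did_simps(3))
    qed (use f g in \<open>auto simp: dhomD\<close>)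
    ultimately show ?thesis using f by blast
  qed
  show "diso X Y f" if R: ?R
  proof -
    have f: "f \<in> dhom X Y" and ba: "bij_betw (on_arcs f) (arcs X) (arcs Y)"
      and bd: "bij_betw (on_darts f) (darts X) (darts Y)"
      and bv: "bij_betw (on_verts f) (verts X) (verts Y)" using R by auto
    let ?ia = "inv_into (arcs X) (on_arcs f)"
    let ?id = "inv_into (darts X) (on_darts f)"
    let ?iv = "inv_into (verts X) (on_verts f)"
    note ia = bij_betwE[OF bij_betw_inv_into[OF ba], rule_format] bij_betw_inv_into_right[OF ba]
      and ia2 = bij_betw_inv_into_left[OF ba]
    note id = bij_betwE[OF bij_betw_inv_into[OF bd], rule_format] bij_betw_inv_into_right[OF bd]
      and id2 = bij_betw_inv_into_left[OF bd]
    note iv = bij_betwE[OF bij_betw_inv_into[OF bv], rule_format] bij_betw_inv_into_right[OF bv]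
      and iv2 = bij_betw_inv_into_left[OF bv]
    have Y1: "dag Y b \<in> arcs Y" if "b \<in> arcs Y" for b
      using ia(1)[OF that] ia(2)[OF that] dhomD(4,7)[OF f] diagramD(1)[OF X] by metis
    have Y2: "inc Y b \<in> arcs Y" if "b \<in> darts Y" for b
      using id(1)[OF that] id(2)[OF that] dhomD(4,8)[OF f] diagramD(2)[OF X] by metis
    have Y3: "att Y b \<in> verts Y" if "b \<in> darts Y" for b
      using id(1)[OF that] id(2)[OF that] dhomD(6,9)[OF f] diagramD(3)[OF X] by metis
    have c1: "?ia (dag Y b) = dag X (?ia b)" if "b \<in> arcs Y" for b
      using ia(1)[OF that] ia(2)[OF that] ia2 dhomD(7)[OF f] diagramD(1)[OF X] by metis
    have c2: "?ia (inc Y b) = inc X (?id b)" if "b \<in> darts Y" for b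
      using id(1)[OF that] id(2)[OF that] ia2 dhomD(8)[OF f] diagramD(2)[OF X] by metis
    have c3: "?iv (att Y b) = att X (?id b)" if "b \<in> darts Y" for b
      using id(1)[OF that] id(2)[OF that] iv2 dhomD(9)[OF f] diagramD(3)[OF X] by metis
    define g where "g = \<lparr>on_arcs = restrict ?ia (arcs Y), on_darts = restrict ?id (darts Y),
      on_verts = restrict ?iv (verts Y)\<rparr>"
    have "g \<in> dhom Y X"
      unfolding dhom_def g_def by (auto simp: ia id iv Y1 Y2 Y3 c1 c2 c3)
    moreover have "dcomp X g f = did X"
      unfolding g_def dcomp_def did_def compose_def using dhomD(4-6)[OF f]
      by (auto simp: ia2 id2 iv2 intro!: restrict_ext)
    moreover have "dcomp Y f g = did Y"
      unfolding g_def dcomp_def did_def compose_def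
      by (auto simp: ia id iv intro!: restrict_ext)
    ultimately show ?thesis unfolding diso_def using f by blast
  qed
qed

text \<open>
  Connectedness in terms of predicates: the diagram is nonempty, and whenever a predicate on arcs
  and a predicate on vertices are compatible with the structure maps, they are constant with the
  same value. A compatible pair splits the diagram into the part where it holds and the part where
  it fails, so this is the absence of a nontrivial coproduct decomposition. All arguments by
  connectedness below exhibit such a pair of predicates.
\<close>

definition linked :: "('a, 'd, 'v) diag \<Rightarrow> bool" where
  "linked X \<longleftrightarrow> nonempty X \<and>
     (\<forall>(P :: 'a \<Rightarrow> bool) (Q :: 'v \<Rightarrow> bool). (\<forall>a\<in>arcs X. P (dag X a) = P a) \<longrightarrow> (\<forall>d\<in>darts X. Q (att X d) = P (inc X d)) \<longrightarrow>
        (\<exists>b. (\<forall>a\<in>arcs X. P a = b) \<and> (\<forall>v\<in>verts X. Q v = b)))"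

lemma linkedD:
  fixes X :: "('a, 'd, 'v) diag" and P :: "'a \<Rightarrow> bool" and Q :: "'v \<Rightarrow> bool"
  assumes "linked X" "\<And>a. a \<in> arcs X \<Longrightarrow> P (dag X a) = P a"
    "\<And>d. d \<in> darts X \<Longrightarrow> Q (att X d) = P (inc X d)"
  shows "\<exists>b. (\<forall>a\<in>arcs X. P a = b) \<and> (\<forall>v\<in>verts X. Q v = b)"
proof -
  have *: "\<forall>(P :: 'a \<Rightarrow> bool) (Q :: 'v \<Rightarrow> bool). (\<forall>a\<in>arcs X. P (dag X a) = P a) \<longrightarrow> (\<forall>d\<in>darts X. Q (att X d) = P (inc X d)) \<longrightarrow>
      (\<exists>b. (\<forall>a\<in>arcs X. P a = b) \<and> (\<forall>v\<in>verts X. Q v = b))"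
    using assms(1) unfolding linked_def by (rule conjunct2)
  show ?thesis
    by (rule *[THEN spec, THEN spec, THEN mp, THEN mp]) (use assms(2,3) in blast)+
qed

lemma dconnected_iff_linked:
  fixes X :: "('a, 'd, 'v) diag"
  assumes X: "diagram X"
  shows "dconnected X \<longleftrightarrow> linked X"
proof
  assume con: "dconnected X"
  show "linked X" unfolding linked_def
  proof (intro conjI allI impI)
    show "nonempty X" using con by (simp add: dconnected_def)
    fix P :: "'a \<Rightarrow> bool" and Q :: "'v \<Rightarrow> bool"
    assume P: "\<forall>a\<in>arcs X. P (dag X a) = P a"
      and Q: "\<forall>d\<in>darts X. Q (att X d) = P (inc X d)"
    define Y :: "bool \<Rightarrow> ('a, 'd, 'v) diag" where "Y = (\<lambda>b.
      \<lparr>arcs = {a\<in>arcs X. P a = b}, darts = {d\<in>darts X. P (inc X d) = b},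
       verts = {v\<in>verts X. Q v = b}, dag = restrict (dag X) {a\<in>arcs X. P a = b},
       inc = restrict (inc X) {d\<in>darts X. P (inc X d) = b},
       att = restrict (att X) {d\<in>darts X. P (inc X d) = b}\<rparr>)"
    define f :: "('a, 'd, 'v, bool \<times> 'a, bool \<times> 'd, bool \<times> 'v) dmap" where "f =
      \<lparr>on_arcs = (\<lambda>a\<in>arcs X. (P a, a)), on_darts = (\<lambda>d\<in>darts X. (P (inc X d), d)),
       on_verts = (\<lambda>v\<in>verts X. (Q v, v))\<rparr>"
    have Yd: "diagram (Y b)" for b
      using X P Q unfolding diagram_def Y_def by (auto simp: PiE_iff)
    have "f \<in> dhom X (dcoprod UNIV Y)"
      using P Q X unfolding dhom_def f_def dcoprod_def Y_def by (auto simp: diagramD)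
    moreover have "bij_betw (on_arcs f) (arcs X) (arcs (dcoprod UNIV Y))"
      "bij_betw (on_darts f) (darts X) (darts (dcoprod UNIV Y))"
      "bij_betw (on_verts f) (verts X) (verts (dcoprod UNIV Y))"
      unfolding bij_betw_def f_def dcoprod_def Y_def by (auto simp: inj_on_def image_iff)
    ultimately have "isomorphic X (dcoprod UNIV Y)"
      unfolding isomorphic_def diso_iff_bij(1)[OF X] by blast
    then obtain b where "\<not> nonempty (Y b)"
      using con Yd unfolding dconnected_def by blast
    then have "(\<forall>a\<in>arcs X. P a = (\<not> b)) \<and> (\<forall>v\<in>verts X. Q v = (\<not> b))"
      unfolding nonempty_def Y_def by auto
    then show "\<exists>b. (\<forall>a\<in>arcs X. P a = b) \<and> (\<forall>v\<in>verts X. Q v = b)" by blast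
  qed
next
  assume con: "linked X"
  show "dconnected X" unfolding dconnected_def
  proof (intro conjI notI)
    show "nonempty X" using con by (simp add: linked_def)
    assume "\<exists>Y :: bool \<Rightarrow> ('a, 'd, 'v) diag.
      (\<forall>b. diagram (Y b) \<and> nonempty (Y b)) \<and> isomorphic X (dcoprod UNIV Y)"
    then obtain Y :: "bool \<Rightarrow> ('a, 'd, 'v) diag" and f
      where Yd: "\<And>b. diagram (Y b)" and Yn: "\<And>b. nonempty (Y b)"
        and iso: "diso X (dcoprod UNIV Y) f"
      unfolding isomorphic_def by blast
    note iso' = iso[unfolded diso_iff_bij(1)[OF X]]
    have f: "f \<in> dhom X (dcoprod UNIV Y)" using iso' by blast
    have "fst (on_arcs f (dag X a)) = fst (on_arcs f a)" if "a \<in> arcs X" for a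
      using dhomD(4)[OF f that] dhomD(7)[OF f that]
      by (cases "on_arcs f a") (simp add: dcoprod_def)
    moreover have "fst (on_verts f (att X d)) = fst (on_arcs f (inc X d))" if "d \<in> darts X" for d
      using dhomD(5)[OF f that] dhomD(8)[OF f that] dhomD(9)[OF f that]
      by (cases "on_darts f d") (simp add: dcoprod_def)
    ultimately obtain b where b: "\<forall>a\<in>arcs X. fst (on_arcs f a) = b"
      "\<forall>v\<in>verts X. fst (on_verts f v) = b"
      using linkedD[OF con, of "\<lambda>a. fst (on_arcs f a)" "\<lambda>v. fst (on_verts f v)"] by blast
    have A: "arcs (Y (\<not> b)) = {}"
    proof (rule ccontr)
      assume "arcs (Y (\<not> b)) \<noteq> {}"
      then obtain a where "(\<not> b, a) \<in> arcs (dcoprod UNIV Y)" by (auto simp: dcoprod_def)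
      then obtain a' where "a' \<in> arcs X" "on_arcs f a' = (\<not> b, a)"
        using iso' by (metis bij_betw_def imageE)
      then show False using b(1) by force
    qed
    have V: "verts (Y (\<not> b)) = {}"
    proof (rule ccontr)
      assume "verts (Y (\<not> b)) \<noteq> {}"
      then obtain a where "(\<not> b, a) \<in> verts (dcoprod UNIV Y)" by (auto simp: dcoprod_def)
      then obtain a' where "a' \<in> verts X" "on_verts f a' = (\<not> b, a)"
        using iso' by (metis bij_betw_def imageE)
      then show False using b(2) by force
    qed
    have "darts (Y (\<not> b)) = {}" using A diagramD(2)[OF Yd] by blast
    then show False using A V Yn[of "\<not> b"] by (simp add: nonempty_def)
  qed
qed

lemma linked_nonempty: "linked X \<Longrightarrow> nonempty X"
  unfolding linked_def by (rule conjunct1)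

section \<open>Embeddings of graphs\<close>

lemma graphD:
  assumes "is_graph G"
  shows "diagram G" "a \<in> arcs G \<Longrightarrow> dag G a \<in> arcs G" "a \<in> arcs G \<Longrightarrow> dag G (dag G a) = a"
    "a \<in> arcs G \<Longrightarrow> dag G a \<noteq> a" "d \<in> darts G \<Longrightarrow> d \<in> arcs G" "d \<in> darts G \<Longrightarrow> inc G d = d"
    "d \<in> darts G \<Longrightarrow> att G d \<in> verts G" "inc G ` darts G = darts G"
  using assms unfolding is_graph_def by (auto simp: diagramD)

lemma graph_linked: "is_graph G \<Longrightarrow> dconnected G \<longleftrightarrow> linked G"
  by (rule dconnected_iff_linked[OF graphD(1)])

text \<open>
  The arcs that do not underlie a dart. For a graph this is the boundary; for a diagram such as a
  star or a graph substitution, whose darts are not literally a subset of its arcs, it is the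
  corresponding notion.
\<close>

definition loose :: "('b, 'e, 'w) diag \<Rightarrow> 'b set" where
  "loose X = arcs X - inc X ` darts X"

lemma loose_graph: "is_graph G \<Longrightarrow> loose G = bdry G"
  by (simp add: loose_def bdry_def graphD)

text \<open>
  Embeddings with a general domain: \<open>g\<close> exhibits the diagram \<open>X\<close>, over
  arbitrary types, as the domain of an embedding into \<open>G\<close>. The map from darts to arcs
  of \<open>X\<close> only has to be injective. An embedding of graphs is the case that
  \<open>X\<close> is a graph; stars and graph substitutions are the other examples. That the
  involution of \<open>X\<close> has no fixed points follows from the same property of
  \<open>G\<close>.
\<close>

locale presentation =
  fixes X :: "('b, 'e, 'w) diag" and G :: "('a, 'v) graph" and g :: "('b, 'e, 'w, 'a, 'a, 'v) dmap"
  assumes diagX: "diagram X" and inc_inj: "inj_on (inc X) (darts X)"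
    and dag_dag: "\<And>a. a \<in> arcs X \<Longrightarrow> dag X (dag X a) = a" and linkX: "linked X"
    and graphG: "is_graph G" and linkG: "linked G"
    and etale: "etale X G g" and verts_inj: "inj_on (on_verts g) (verts X)"
begin

lemma hom: "g \<in> dhom X G"
  using etale by (simp add: etale_def)

lemma on_inc: "d \<in> darts X \<Longrightarrow> on_arcs g (inc X d) = on_darts g d"
  using dhomD(5,8)[OF hom] graphD(6)[OF graphG] by simp

lemma darts_inj: "inj_on (on_darts g) (darts X)"
proof (rule inj_onI)
  fix d d' assume d: "d \<in> darts X" "d' \<in> darts X" and eq: "on_darts g d = on_darts g d'"
  have "on_verts g (att X d) = on_verts g (att X d')"
    using dhomD(9)[OF hom] d eq by simp
  then have "att X d = att X d'"
    using inj_onD[OF verts_inj] diagramD(3)[OF diagX] d by blast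
  then show "d = d'"
    using etale d eq inj_onD[of "\<lambda>d. (on_darts g d, att X d)" "darts X" d d']
    by (simp add: etale_def bij_betw_def)
qed

lemma darts_image:
  "on_darts g ` darts X = {e\<in>darts G. att G e \<in> on_verts g ` verts X}"
proof
  show "on_darts g ` darts X \<subseteq> {e\<in>darts G. att G e \<in> on_verts g ` verts X}"
  proof
    fix e assume "e \<in> on_darts g ` darts X"
    then obtain d where d: "d \<in> darts X" "e = on_darts g d" by blast
    then show "e \<in> {e\<in>darts G. att G e \<in> on_verts g ` verts X}"
      using dhomD(5)[OF hom d(1)] dhomD(9)[OF hom d(1), symmetric] diagramD(3)[OF diagX d(1)] by simp
  qed
  show "{e\<in>darts G. att G e \<in> on_verts g ` verts X} \<subseteq> on_darts g ` darts X"
  proof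
    fix e assume "e \<in> {e\<in>darts G. att G e \<in> on_verts g ` verts X}"
    then obtain v where v: "e \<in> darts G" "v \<in> verts X" "att G e = on_verts g v" by blast
    then have "(e, v) \<in> {(e, v). e \<in> darts G \<and> v \<in> verts X \<and> att G e = on_verts g v}" by simp
    then have "(e, v) \<in> (\<lambda>d. (on_darts g d, att X d)) ` darts X"
      using etale unfolding etale_def bij_betw_def by simp
    then show "e \<in> on_darts g ` darts X" by auto
  qed
qed

lemma dart_arcs_image:
  "on_arcs g ` inc X ` darts X = {e\<in>darts G. att G e \<in> on_verts g ` verts X}"
  unfolding darts_image[symmetric] using on_inc by (auto simp: image_iff)

lemma dart_arcs_inj: "inj_on (on_arcs g) (inc X ` darts X)"
  using darts_inj on_inc by (auto simp: inj_on_def)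

lemma dag_neq: "a \<in> arcs X \<Longrightarrow> dag X a \<noteq> a"
  using dhomD(4,7)[OF hom] graphD(4)[OF graphG] by metis

lemma inc_arcs: "a \<in> inc X ` darts X \<Longrightarrow> a \<in> arcs X"
  using diagramD(2)[OF diagX] by blast

lemma no_verts:
  assumes "verts X = {}"
  shows "darts X = {}" "\<exists>a\<in>arcs X. arcs X = {a, dag X a}"
proof -
  show d: "darts X = {}" using diagramD(3)[OF diagX] assms by blast
  then obtain a where a: "a \<in> arcs X"
    using linked_nonempty[OF linkX] assms unfolding nonempty_def by blast
  have "(dag X x \<in> {a, dag X a}) = (x \<in> {a, dag X a})" if "x \<in> arcs X" for x
    using dag_dag[OF a] dag_dag[OF that] by (metis insert_iff singletonD)
  moreover have "True = (inc X e \<in> {a, dag X a})" if "e \<in> darts X" for e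
    using d that by simp
  ultimately have "\<exists>b. (\<forall>x\<in>arcs X. (x \<in> {a, dag X a}) = b) \<and> (\<forall>v\<in>verts X. True = b)"
    by (rule linkedD[OF linkX])
  then obtain b where "\<forall>x\<in>arcs X. (x \<in> {a, dag X a}) = b" by blast
  then have "arcs X \<subseteq> {a, dag X a}" using a by blast
  then show "\<exists>a\<in>arcs X. arcs X = {a, dag X a}" using a diagramD(1)[OF diagX] by blast
qed

lemma flip_dart:
  assumes "verts X \<noteq> {}" "a \<in> arcs X" "a \<notin> inc X ` darts X"
  shows "dag X a \<in> inc X ` darts X"
proof (rule ccontr)
  assume n: "dag X a \<notin> inc X ` darts X"
  have "(dag X x \<in> {a, dag X a}) = (x \<in> {a, dag X a})" if "x \<in> arcs X" for x
    using dag_dag[OF assms(2)] dag_dag[OF that] by (metis insert_iff singletonD)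
  moreover have "False = (inc X d \<in> {a, dag X a})" if "d \<in> darts X" for d
    using n assms(3) imageI[OF that, of "inc X"] by (metis insert_iff singletonD)
  ultimately have "\<exists>b. (\<forall>x\<in>arcs X. (x \<in> {a, dag X a}) = b) \<and> (\<forall>v\<in>verts X. False = b)"
    by (rule linkedD[OF linkX])
  then obtain b where b: "\<forall>x\<in>arcs X. (x \<in> {a, dag X a}) = b" "\<forall>v\<in>verts X. False = b"
    by blast
  then show False using assms by blast
qed

lemma loose_inj: "inj_on (on_arcs g) (loose X)"
proof (rule inj_onI)
  fix a b assume ab: "a \<in> loose X" "b \<in> loose X" and eq: "on_arcs g a = on_arcs g b"
  have A: "a \<in> arcs X" "b \<in> arcs X" using ab by (auto simp: loose_def)
  have eq': "on_arcs g (dag X a) = on_arcs g (dag X b)"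
    using eq A dhomD(7)[OF hom] by simp
  show "a = b"
  proof (cases "verts X = {}")
    case True
    then obtain c where c: "c \<in> arcs X" "arcs X = {c, dag X c}" using no_verts by blast
    have "on_arcs g (dag X c) \<noteq> on_arcs g c"
      using dhomD(4,7)[OF hom] graphD(4)[OF graphG] c(1) by metis
    then show ?thesis using A c(2) eq by auto
  next
    case False
    then have "dag X a = dag X b"
      using flip_dart[OF False] ab eq' inj_onD[OF dart_arcs_inj] by (simp add: loose_def)
    then show ?thesis using dag_dag A by metis
  qed
qed

text \<open>An arc of \<open>X\<close> is determined by its image together with the information whether it is a dart.\<close>

lemma arc_key:
  "inj_on (\<lambda>a. (on_arcs g a, a \<in> inc X ` darts X)) (arcs X)"
  "(\<lambda>a. (on_arcs g a, a \<in> inc X ` darts X)) ` arcs X =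
     {e\<in>darts G. att G e \<in> on_verts g ` verts X} \<times> {True} \<union> (on_arcs g ` loose X) \<times> {False}"
proof -
  show "inj_on (\<lambda>a. (on_arcs g a, a \<in> inc X ` darts X)) (arcs X)"
  proof (rule inj_onI)
    fix a b assume ab: "a \<in> arcs X" "b \<in> arcs X"
      "(on_arcs g a, a \<in> inc X ` darts X) = (on_arcs g b, b \<in> inc X ` darts X)"
    show "a = b"
    proof (cases "a \<in> inc X ` darts X")
      case True
      then show ?thesis using ab inj_onD[OF dart_arcs_inj] by simp
    next
      case False
      then show ?thesis using ab inj_onD[OF loose_inj] by (simp add: loose_def)
    qed
  qed
  let ?k = "\<lambda>a. (on_arcs g a, a \<in> inc X ` darts X)"
  have 1: "arcs X = inc X ` darts X \<union> loose X" using inc_arcs by (auto simp: loose_def)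
  have 2: "?k ` (inc X ` darts X) = (on_arcs g ` (inc X ` darts X)) \<times> {True}" by auto
  have 3: "?k ` loose X = (on_arcs g ` loose X) \<times> {False}" by (auto simp: loose_def)
  have "?k ` arcs X = ?k ` (inc X ` darts X) \<union> ?k ` loose X"
    using arg_cong[OF 1, of "image ?k"] by (simp only: image_Un)
  then show "?k ` arcs X =
     {e\<in>darts G. att G e \<in> on_verts g ` verts X} \<times> {True} \<union> (on_arcs g ` loose X) \<times> {False}"
    unfolding 2 3 dart_arcs_image .
qed

text \<open>
  Whether the opposite of a dart is again a dart can be read off in \<open>G\<close> from the
  images of the vertices and of the loose arcs; the next lemma treats the opposite of a loose arc.
\<close>

lemma dag_loose_iff:
  assumes "a \<in> inc X ` darts X"
  shows "dag X a \<in> inc X ` darts X \<longleftrightarrow> dag G (on_arcs g a) \<notin> on_arcs g ` loose X"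
proof -
  have a: "a \<in> arcs X" using assms inc_arcs by blast
  have V: "verts X \<noteq> {}" using assms no_verts(1) by blast
  have 1: "dag G (on_arcs g a) \<in> on_arcs g ` loose X" if "dag X a \<notin> inc X ` darts X"
    using that dhomD(7)[OF hom a] diagramD(1)[OF diagX a]
    by (intro rev_image_eqI[of "dag X a"]) (simp_all add: loose_def)
  have 2: "dag X a \<notin> inc X ` darts X" if "dag G (on_arcs g a) \<in> on_arcs g ` loose X"
  proof -
    from that obtain b where b: "b \<in> loose X" "dag G (on_arcs g a) = on_arcs g b" by blast
    then have bA: "b \<in> arcs X" by (simp add: loose_def)
    have "dag X b \<in> inc X ` darts X"
      using flip_dart[OF V bA] b by (simp add: loose_def)
    moreover have "on_arcs g (dag X b) = on_arcs g a"
      using dhomD(7)[OF hom bA] b(2) graphD(3)[OF graphG] dhomD(4)[OF hom a] by metis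
    ultimately have "dag X b = a" using assms inj_onD[OF dart_arcs_inj] by blast
    then have "dag X a = b" using dag_dag[OF bA] by simp
    then show ?thesis using b(1) by (simp add: loose_def)
  qed
  show ?thesis using 1 2 by blast
qed

lemma dag_loose_iff':
  assumes "a \<in> loose X"
  shows "dag X a \<in> inc X ` darts X \<longleftrightarrow> on_verts g ` verts X \<noteq> {}"
  using assms flip_dart no_verts(1) by (auto simp: loose_def)

end

lemma embedding_iff_presentation:
  "embedding H G f \<longleftrightarrow> is_graph H \<and> presentation H G f"
proof
  assume e: "embedding H G f"
  then have H: "is_graph H" and G: "is_graph G" by (auto simp: embedding_def)
  have "inj_on (inc H) (darts H)" using graphD(6)[OF H] by (auto simp: inj_on_def)
  then show "is_graph H \<and> presentation H G f"
    using e graphD[OF H] graph_linked[OF H] graph_linked[OF G]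
    unfolding embedding_def presentation_def by auto
next
  assume "is_graph H \<and> presentation H G f"
  then show "embedding H G f"
    unfolding presentation_def embedding_def by (auto simp: graph_linked)
qed

lemma embeddingD:
  assumes "embedding H G f"
  shows "is_graph H" "is_graph G" "presentation H G f" "f \<in> dhom H G" "linked H" "linked G"
    "inj_on (on_verts f) (verts H)" "inj_on (on_arcs f) (darts H)" "inj_on (on_arcs f) (bdry H)"
    "d \<in> darts H \<Longrightarrow> on_darts f d = on_arcs f d"
    "on_arcs f ` darts H = {e\<in>darts G. att G e \<in> on_verts f ` verts H}"
proof -
  show H: "is_graph H" and p: "presentation H G f"
    using assms by (auto simp: embedding_iff_presentation)
  interpret presentation H G f by (rule p)
  show "is_graph G" "f \<in> dhom H G" "linked H" "linked G" "inj_on (on_verts f) (verts H)"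
    using graphG hom linkX linkG verts_inj by auto
  show "inj_on (on_arcs f) (darts H)" "inj_on (on_arcs f) (bdry H)"
    using dart_arcs_inj loose_inj by (simp_all add: graphD[OF H] loose_graph[OF H])
  show "d \<in> darts H \<Longrightarrow> on_darts f d = on_arcs f d"
    using on_inc graphD(6)[OF H] by simp
  show "on_arcs f ` darts H = {e\<in>darts G. att G e \<in> on_verts f ` verts H}"
    using dart_arcs_image by (simp add: graphD[OF H])
qed

lemma bij_betw_inv_into_comp:
  assumes "inj_on f A" "inj_on g B" "f ` A = g ` B"
  shows "bij_betw (\<lambda>a. inv_into B g (f a)) A B"
proof -
  have "bij_betw f A (g ` B)" using inj_on_imp_bij_betw[OF assms(1)] assms(3) by simp
  moreover have "bij_betw (inv_into B g) (g ` B) B"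
    by (rule bij_betw_inv_into[OF inj_on_imp_bij_betw[OF assms(2)]])
  ultimately show ?thesis using bij_betw_trans by (fastforce simp: comp_def)
qed

text \<open>
  An embedding is determined, up to isomorphism of the domain, by the image of its vertices and
  the image of its boundary. These two sets determine the range of the injection of
  \<open>arc_key\<close>, and the involution of \<open>X\<close> is determined by
  \<open>dag_loose_iff\<close>.
\<close>

lemma presentation_unique:
  assumes pX: "presentation X G g" and pY: "presentation Y G h"
    and V: "on_verts g ` verts X = on_verts h ` verts Y"
    and B: "on_arcs g ` loose X = on_arcs h ` loose Y"
  shows "\<exists>z. diso X Y z \<and> g = dcomp X h z"
proof -
  interpret X: presentation X G g by (rule pX)
  interpret Y: presentation Y G h by (rule pY)
  \<comment> \<open>the arcs of \<open>X\<close> and \<open>Y\<close> are compared through the common range of these two injections\<close>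
  let ?kX = "\<lambda>a. (on_arcs g a, a \<in> inc X ` darts X)"
  let ?kY = "\<lambda>a. (on_arcs h a, a \<in> inc Y ` darts Y)"
  have kim: "?kX ` arcs X = ?kY ` arcs Y"
    unfolding X.arc_key(2) Y.arc_key(2) V B ..
  have dim: "on_darts g ` darts X = on_darts h ` darts Y"
    unfolding X.darts_image Y.darts_image V ..
  define za where "za a = inv_into (arcs Y) ?kY (?kX a)" for a
  define zd where "zd d = inv_into (darts Y) (on_darts h) (on_darts g d)" for d
  define zv where "zv v = inv_into (verts Y) (on_verts h) (on_verts g v)" for v
  have za: "za a \<in> arcs Y" "on_arcs h (za a) = on_arcs g a"
    "za a \<in> inc Y ` darts Y \<longleftrightarrow> a \<in> inc X ` darts X" if "a \<in> arcs X" for a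
  proof -
    have *: "?kX a \<in> ?kY ` arcs Y" using that kim by blast
    show "za a \<in> arcs Y" unfolding za_def using * by (rule inv_into_into)
    have "?kY (za a) = ?kX a" unfolding za_def using * by (rule f_inv_into_f)
    then show "on_arcs h (za a) = on_arcs g a"
      "za a \<in> inc Y ` darts Y \<longleftrightarrow> a \<in> inc X ` darts X" by auto
  qed
  have zd: "zd d \<in> darts Y" "on_darts h (zd d) = on_darts g d" if "d \<in> darts X" for d
  proof -
    have *: "on_darts g d \<in> on_darts h ` darts Y" using that dim by blast
    show "zd d \<in> darts Y" "on_darts h (zd d) = on_darts g d"
      unfolding zd_def using inv_into_into[OF *] f_inv_into_f[OF *] by auto
  qed
  have zv: "zv d \<in> verts Y" "on_verts h (zv d) = on_verts g d" if "d \<in> verts X" for d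
  proof -
    have *: "on_verts g d \<in> on_verts h ` verts Y" using that V by blast
    show "zv d \<in> verts Y" "on_verts h (zv d) = on_verts g d"
      unfolding zv_def using inv_into_into[OF *] f_inv_into_f[OF *] by auto
  qed
  have kY: "a = b" if "a \<in> arcs Y" "b \<in> arcs Y" "on_arcs h a = on_arcs h b"
    "a \<in> inc Y ` darts Y \<longleftrightarrow> b \<in> inc Y ` darts Y" for a b
    by (rule inj_onD[OF Y.arc_key(1) _ that(1,2)]) (simp add: that(3,4))
  define z where
    "z = \<lparr>on_arcs = restrict za (arcs X), on_darts = restrict zd (darts X),
          on_verts = restrict zv (verts X)\<rparr>"
  have dagz: "za (dag X a) = dag Y (za a)" if a: "a \<in> arcs X" for a
  proof (rule kY)
    have a': "dag X a \<in> arcs X" using a diagramD(1)[OF X.diagX] by blast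
    show "za (dag X a) \<in> arcs Y" "dag Y (za a) \<in> arcs Y"
      using za a a' diagramD(1)[OF Y.diagX] by auto
    show "on_arcs h (za (dag X a)) = on_arcs h (dag Y (za a))"
      using za[OF a] za[OF a'] dhomD(7)[OF X.hom a] dhomD(7)[OF Y.hom] by simp
    have "dag X a \<in> inc X ` darts X \<longleftrightarrow> dag Y (za a) \<in> inc Y ` darts Y"
    proof (cases "a \<in> inc X ` darts X")
      case True
      then show ?thesis
        using X.dag_loose_iff[OF True] Y.dag_loose_iff[of "za a"] za[OF a] B by simp
    next
      case False
      then show ?thesis
        using X.dag_loose_iff'[of a] Y.dag_loose_iff'[of "za a"] za[OF a] V a
        by (simp add: loose_def)
    qed
    then show "za (dag X a) \<in> inc Y ` darts Y \<longleftrightarrow> dag Y (za a) \<in> inc Y ` darts Y"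
      using za(3)[OF a'] by simp
  qed
  have incz: "za (inc X d) = inc Y (zd d)" if d: "d \<in> darts X" for d
  proof (rule kY)
    have a: "inc X d \<in> arcs X" using d diagramD(2)[OF X.diagX] by blast
    show "za (inc X d) \<in> arcs Y" "inc Y (zd d) \<in> arcs Y"
      using za[OF a] zd[OF d] diagramD(2)[OF Y.diagX] by auto
    show "on_arcs h (za (inc X d)) = on_arcs h (inc Y (zd d))"
      using za[OF a] zd[OF d] X.on_inc[OF d] Y.on_inc by simp
    show "za (inc X d) \<in> inc Y ` darts Y \<longleftrightarrow> inc Y (zd d) \<in> inc Y ` darts Y"
      using za(3)[OF a] zd[OF d] d by blast
  qed
  have attz: "zv (att X d) = att Y (zd d)" if d: "d \<in> darts X" for d
  proof -
    have v: "att X d \<in> verts X" using d diagramD(3)[OF X.diagX] by blast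
    have "on_verts h (zv (att X d)) = on_verts h (att Y (zd d))"
      using zv[OF v] zd[OF d] dhomD(9)[OF X.hom d] dhomD(9)[OF Y.hom zd(1)[OF d]] by simp
    then show ?thesis
      using inj_onD[OF Y.verts_inj] zv[OF v] zd[OF d] diagramD(3)[OF Y.diagX] by blast
  qed
  have zh: "z \<in> dhom X Y"
    unfolding dhom_def z_def
    by (auto simp: za zd zv dagz incz attz diagramD[OF X.diagX])
  have "bij_betw (on_arcs z) (arcs X) (arcs Y)"
    using bij_betw_inv_into_comp[OF X.arc_key(1) Y.arc_key(1) kim]
    by (rule iffD1[OF bij_betw_cong, rotated]) (simp add: z_def za_def)
  moreover have "bij_betw (on_darts z) (darts X) (darts Y)"
    using bij_betw_inv_into_comp[OF X.darts_inj Y.darts_inj dim]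
    by (rule iffD1[OF bij_betw_cong, rotated]) (simp add: z_def zd_def)
  moreover have "bij_betw (on_verts z) (verts X) (verts Y)"
    using bij_betw_inv_into_comp[OF X.verts_inj Y.verts_inj V]
    by (rule iffD1[OF bij_betw_cong, rotated]) (simp add: z_def zv_def)
  ultimately have "diso X Y z"
    using zh diso_iff_bij[OF X.diagX] by blast
  moreover have "g = dcomp X h z"
    by (rule dmap_eqI[OF X.hom dcomp_hom[OF X.diagX zh Y.hom]])
      (auto simp: z_def za zd zv)
  ultimately show ?thesis by blast
qed

lemma diso_loose:
  assumes X: "diagram X" and Y: "diagram Y" and z: "diso X Y z"
  shows "on_arcs z ` loose X = loose Y" "on_verts z ` verts X = verts Y"
    "a \<in> arcs X \<Longrightarrow> on_arcs z a \<in> inc Y ` darts Y \<longleftrightarrow> a \<in> inc X ` darts X"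
proof -
  note z' = z[unfolded diso_iff_bij[OF X]]
  then have h: "z \<in> dhom X Y" by blast
  show "on_verts z ` verts X = verts Y" using z' by (simp add: bij_betw_def)
  have "on_arcs z ` inc X ` darts X = inc Y ` on_darts z ` darts X"
    unfolding image_image by (intro image_cong refl dhomD(8)[OF h])
  also have "on_darts z ` darts X = darts Y" using z' by (simp add: bij_betw_def)
  finally have d: "on_arcs z ` inc X ` darts X = inc Y ` darts Y" .
  have i: "inj_on (on_arcs z) (arcs X)" and A: "on_arcs z ` arcs X = arcs Y"
    using z' by (auto simp: bij_betw_def)
  have s: "inc X ` darts X \<subseteq> arcs X" using diagramD(2)[OF X] by blast
  show "on_arcs z ` loose X = loose Y"
    unfolding loose_def using inj_on_image_set_diff[OF i, of "arcs X" "inc X ` darts X"] s A d by auto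
  show "a \<in> arcs X \<Longrightarrow> on_arcs z a \<in> inc Y ` darts Y \<longleftrightarrow> a \<in> inc X ` darts X"
    using inj_on_image_mem_iff[OF i _ s] d by metis
qed

lemma emb_class_eq:
  assumes p: "presentation X G g"
  shows "emb_class G X g = {(H, f). embedding H G f \<and>
    on_verts f ` verts H = on_verts g ` verts X \<and> on_arcs f ` bdry H = on_arcs g ` loose X}"
    (is "_ = ?R")
proof
  interpret presentation X G g by (rule p)
  show "emb_class G X g \<subseteq> ?R"
  proof
    fix q assume "q \<in> emb_class G X g"
    then obtain H f z where q: "q = (H, f)" and e: "embedding H G f" and z: "diso H X z"
      and f: "f = dcomp H g z" unfolding emb_class_def by blast
    have H: "is_graph H" using embeddingD[OF e] by blast
    note dl = diso_loose[OF graphD(1)[OF H] diagX z]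
    have "on_verts f ` verts H = on_verts g ` on_verts z ` verts H"
      unfolding f by (auto simp: image_iff)
    moreover have "on_arcs f ` bdry H = on_arcs g ` on_arcs z ` loose H"
      unfolding f loose_graph[OF H] by (auto simp: image_iff bdry_def)
    ultimately show "q \<in> ?R" using q e dl by simp
  qed
  show "?R \<subseteq> emb_class G X g"
  proof
    fix q assume q': "q \<in> ?R"
    obtain H f where q: "q = (H, f)" by (cases q)
    have e: "embedding H G f" and v: "on_verts f ` verts H = on_verts g ` verts X"
      and b: "on_arcs f ` bdry H = on_arcs g ` loose X" using q' unfolding q by auto
    have "on_arcs f ` loose H = on_arcs g ` loose X"
      unfolding loose_graph[OF embeddingD(1)[OF e]] by (rule b)
    then have "\<exists>z. diso H X z \<and> f = dcomp H g z"
      by (rule presentation_unique[OF embeddingD(3)[OF e] p v])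
    then show "q \<in> emb_class G X g" unfolding emb_class_def q using e by simp
  qed
qed

lemma etaleI:
  assumes K: "diagram K" and q: "q \<in> dhom K H" and v: "inj_on (on_verts q) (verts K)"
    and d: "inj_on (on_darts q) (darts K)"
    and s: "\<And>e. e \<in> darts H \<Longrightarrow> att H e \<in> on_verts q ` verts K \<Longrightarrow> e \<in> on_darts q ` darts K"
  shows "etale K H q"
  unfolding etale_def bij_betw_def
proof (intro conjI)
  show "q \<in> dhom K H" by (rule q)
  show "inj_on (\<lambda>d. (on_darts q d, att K d)) (darts K)"
    using d by (simp add: inj_on_def)
  show "(\<lambda>d. (on_darts q d, att K d)) ` darts K =
    {(e, v). e \<in> darts H \<and> v \<in> verts K \<and> att H e = on_verts q v}"
  proof (intro equalityI subsetI)
    fix p assume "p \<in> (\<lambda>d. (on_darts q d, att K d)) ` darts K"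
    then obtain d where d: "d \<in> darts K" "p = (on_darts q d, att K d)" by blast
    then show "p \<in> {(e, v). e \<in> darts H \<and> v \<in> verts K \<and> att H e = on_verts q v}"
      using dhomD(5)[OF q d(1)] dhomD(9)[OF q d(1)] diagramD(3)[OF K d(1)] by simp
  next
    fix p assume "p \<in> {(e, v). e \<in> darts H \<and> v \<in> verts K \<and> att H e = on_verts q v}"
    then obtain e u where p: "p = (e, u)" "e \<in> darts H" "u \<in> verts K" "att H e = on_verts q u"
      by blast
    then have "e \<in> on_darts q ` darts K" using s[OF p(2)] by simp
    then obtain d where d: "d \<in> darts K" "e = on_darts q d" by blast
    have "on_verts q (att K d) = on_verts q u"
      using dhomD(9)[OF q d(1)] d(2) p(4) by simp
    then have "att K d = u"
      by (rule inj_onD[OF v _ diagramD(3)[OF K d(1)] p(3)])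
    then show "p \<in> (\<lambda>d. (on_darts q d, att K d)) ` darts K"
      using d p(1) by (intro rev_image_eqI[OF d(1)]) simp
  qed
qed

text \<open>
  For every embedding with general domain there is one with the same images of vertices and
  boundary, hence an isomorphic one by \<open>presentation_unique\<close>, whose domain is a graph
  over the types of the target. Vertices are taken to be their images in \<open>G\<close>; since
  etale maps with injective vertex map need not be injective on arcs, the arcs need fresh names,
  for which an infinite type is required.
\<close>

lemma presentation_transport:
  fixes G :: "('a, 'v) graph"
  assumes inf: "infinite (UNIV :: 'a set)" and p: "presentation X G g"
  shows "\<exists>(H :: ('a, 'v) graph) f. embedding H G f \<and> on_verts f ` verts H = on_verts g ` verts X \<and>
    on_arcs f ` bdry H = on_arcs g ` loose X"
proof -
  interpret presentation X G g by (rule p)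
  obtain B :: "'a set" where B: "finite B" "card B = card (arcs X)"
    using infinite_arbitrarily_large[OF inf] by blast
  then obtain i where i: "bij_betw i (arcs X) B"
    using finite_same_card_bij diagramD(4)[OF diagX] by metis
  have inj: "inj_on i (arcs X)" using i by (simp add: bij_betw_def)
  define j where "j = inv_into (arcs X) i"
  have ji [simp]: "j (i a) = a" if "a \<in> arcs X" for a
    using that inj by (simp add: j_def)
  define H :: "('a, 'v) graph" where "H =
    \<lparr>arcs = i ` arcs X, darts = i ` inc X ` darts X, verts = on_verts g ` verts X,
     dag = (\<lambda>b\<in>i ` arcs X. i (dag X (j b))),
     inc = (\<lambda>b\<in>i ` inc X ` darts X. b),
     att = (\<lambda>b\<in>i ` inc X ` darts X. att G (on_arcs g (j b)))\<rparr>"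
  define f :: "('a, 'a, 'v, 'a, 'a, 'v) dmap" where "f =
    \<lparr>on_arcs = (\<lambda>b\<in>i ` arcs X. on_arcs g (j b)),
     on_darts = (\<lambda>b\<in>i ` inc X ` darts X. on_arcs g (j b)),
     on_verts = (\<lambda>v\<in>on_verts g ` verts X. v)\<rparr>"
  have H_simps [simp]: "arcs H = i ` arcs X" "darts H = i ` inc X ` darts X"
    "verts H = on_verts g ` verts X"
    by (simp_all add: H_def)
  have Hdag [simp]: "dag H (i a) = i (dag X a)" if "a \<in> arcs X" for a
    using that by (simp add: H_def)
  have incA [simp]: "inc X d \<in> arcs X" if "d \<in> darts X" for d
    using that diagramD(2)[OF diagX] by blast
  have dagA [simp]: "dag X d \<in> arcs X" if "d \<in> arcs X" for d
    using that diagramD(1)[OF diagX] by blast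
  have Hinc [simp]: "inc H (i (inc X d)) = i (inc X d)" if "d \<in> darts X" for d
    using that by (simp add: H_def)
  have Hatt [simp]: "att H (i (inc X d)) = on_verts g (att X d)" if "d \<in> darts X" for d
    using that by (simp add: H_def on_inc dhomD(9)[OF hom])
  have fa [simp]: "on_arcs f (i a) = on_arcs g a" if "a \<in> arcs X" for a
    using that by (simp add: f_def)
  have fd [simp]: "on_darts f (i (inc X d)) = on_darts g d" if "d \<in> darts X" for d
    using that by (simp add: f_def on_inc)
  have fv [simp]: "on_verts f v = v" if "v \<in> on_verts g ` verts X" for v
    using that by (simp add: f_def)
  have attv [simp]: "on_verts g (att X d) \<in> on_verts g ` verts X" if "d \<in> darts X" for d
    using that diagramD(3)[OF diagX] by blast
  have dH: "diagram H"
    unfolding diagram_def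
  proof (intro conjI)
    show "finite (arcs H)" "finite (darts H)" "finite (verts H)"
      using diagramD(4-6)[OF diagX] by simp_all
    show "dag H \<in> arcs H \<rightarrow>\<^sub>E arcs H"
      by (auto simp: PiE_iff extensional_def H_def)
    show "inc H \<in> darts H \<rightarrow>\<^sub>E arcs H"
      by (auto simp: PiE_iff extensional_def H_def)
    show "att H \<in> darts H \<rightarrow>\<^sub>E verts H"
      by (auto simp: PiE_iff extensional_def H_def on_inc dhomD(9)[OF hom, symmetric])
  qed
  have gH: "is_graph H"
    unfolding is_graph_def
  proof (intro conjI ballI)
    show "diagram H" by (rule dH)
    show "darts H \<subseteq> arcs H" by auto
    show "inc H = (\<lambda>d\<in>darts H. d)" by (simp add: H_def)
    show "dag H (dag H a) = a" if "a \<in> arcs H" for a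
      using that dag_dag by auto
    show "dag H a \<noteq> a" if "a \<in> arcs H" for a
      using that dag_neq inj_onD[OF inj _ dagA] by fastforce
  qed
  have fh: "f \<in> dhom H G"
    unfolding dhom_def mem_Collect_eq
  proof (intro conjI ballI)
    show "on_arcs f \<in> arcs H \<rightarrow>\<^sub>E arcs G"
      by (auto simp: PiE_iff extensional_def f_def dhomD(4)[OF hom])
    show "on_darts f \<in> darts H \<rightarrow>\<^sub>E darts G"
      by (auto simp: PiE_iff extensional_def f_def on_inc dhomD(5)[OF hom])
    show "on_verts f \<in> verts H \<rightarrow>\<^sub>E verts G"
      by (auto simp: PiE_iff extensional_def f_def dhomD(6)[OF hom])
    show "on_arcs f (dag H a) = dag G (on_arcs f a)" if "a \<in> arcs H" for a
      using that dhomD(7)[OF hom] by auto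
    show "on_arcs f (inc H a) = inc G (on_darts f a)" if "a \<in> darts H" for a
      using that dhomD(8)[OF hom] by auto
    show "on_verts f (att H a) = att G (on_darts f a)" if "a \<in> darts H" for a
      using that by (auto simp: dhomD(9)[OF hom, symmetric])
  qed
  have inv: "inj_on (on_verts f) (verts H)" by (simp add: inj_on_def)
  have et: "etale H G f"
  proof (rule etaleI[OF dH fh inv])
    show "inj_on (on_darts f) (darts H)"
    proof (rule inj_onI)
      fix a b assume "a \<in> darts H" "b \<in> darts H" and eq: "on_darts f a = on_darts f b"
      then obtain d d' where d: "d \<in> darts X" "a = i (inc X d)" "d' \<in> darts X" "b = i (inc X d')"
        by auto
      then have "on_darts g d = on_darts g d'" using eq by simp
      then have "d = d'" by (rule inj_onD[OF darts_inj _ d(1,3)])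
      then show "a = b" using d by simp
    qed
    fix e assume "e \<in> darts G" "att G e \<in> on_verts f ` verts H"
    then have "e \<in> on_darts g ` darts X" unfolding darts_image by auto
    then obtain d where d: "d \<in> darts X" "e = on_darts g d" by blast
    then show "e \<in> on_darts f ` darts H"
      by (intro rev_image_eqI[of "i (inc X d)"]) simp_all
  qed
  have lH: "linked H"
    unfolding linked_def
  proof (intro conjI allI impI)
    have "arcs X \<noteq> {} \<or> verts X \<noteq> {}"
      using linked_nonempty[OF linkX] incA unfolding nonempty_def by blast
    then show "nonempty H" by (auto simp: nonempty_def)
    fix P :: "'a \<Rightarrow> bool" and Q :: "'v \<Rightarrow> bool"
    assume P: "\<forall>a\<in>arcs H. P (dag H a) = P a" and Q: "\<forall>d\<in>darts H. Q (att H d) = P (inc H d)"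
    have "\<exists>b. (\<forall>a\<in>arcs X. P (i a) = b) \<and> (\<forall>v\<in>verts X. Q (on_verts g v) = b)"
    proof (rule linkedD[OF linkX])
      show "P (i (dag X a)) = P (i a)" if "a \<in> arcs X" for a
        using bspec[OF P, of "i a"] that by simp
      show "Q (on_verts g (att X d)) = P (i (inc X d))" if "d \<in> darts X" for d
        using bspec[OF Q, of "i (inc X d)"] that by simp
    qed
    then show "\<exists>b. (\<forall>a\<in>arcs H. P a = b) \<and> (\<forall>v\<in>verts H. Q v = b)" by simp
  qed
  have "embedding H G f"
    unfolding embedding_def using gH graphG et inv lH linkG by (simp add: graph_linked)
  moreover have "on_verts f ` verts H = on_verts g ` verts X" by (auto simp: image_iff)
  moreover have "on_arcs f ` bdry H = on_arcs g ` loose X"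
  proof -
    have "bdry H = i ` loose X"
      unfolding bdry_def loose_def H_simps
      by (rule inj_on_image_set_diff[symmetric, OF inj]) auto
    then have "on_arcs f ` bdry H = (\<lambda>a. on_arcs f (i a)) ` loose X" by (simp add: image_image)
    also have "\<dots> = on_arcs g ` loose X" by (intro image_cong refl) (simp add: loose_def)
    finally show ?thesis .
  qed
  ultimately show ?thesis by blast
qed

section \<open>Classes of embeddings\<close>

text \<open>
  The image of the vertices under an embedding of the class; it is independent of the
  representative, as is \<^const>\<open>emb_bdry\<close>, and the two together determine the class
  (\<open>Emb_eqI\<close> below).
\<close>

definition emb_verts :: "('a, 'v) emb set \<Rightarrow> 'v set" where
  "emb_verts c = on_verts (emb_map c) ` verts (emb_dom c)"

lemma embedding_class:
  assumes "embedding H G f"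
  shows "emb_class G H f = {(H', f'). embedding H' G f' \<and>
    on_verts f' ` verts H' = on_verts f ` verts H \<and> on_arcs f' ` bdry H' = on_arcs f ` bdry H}"
  using emb_class_eq[OF embeddingD(3)[OF assms]] loose_graph[OF embeddingD(1)[OF assms]] by simp

lemma Emb_rep:
  fixes G :: "('a, 'v) graph"
  assumes "c \<in> Emb G"
  shows "embedding (emb_dom c) G (emb_map c)" "c = emb_class G (emb_dom c) (emb_map c)"
proof -
  obtain H :: "('a, 'v) graph" and f where e: "embedding H G f" and c: "c = emb_class G H f"
    using assms unfolding Emb_def by blast
  have "(H, f) \<in> c" unfolding c embedding_class[OF e] using e by simp
  then have "emb_rep c \<in> c" unfolding emb_rep_def by (rule someI)
  then have r: "(emb_dom c, emb_map c) \<in> c" by (simp add: emb_dom_def emb_map_def)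
  then show e': "embedding (emb_dom c) G (emb_map c)"
    unfolding c embedding_class[OF e] by simp
  have "on_verts (emb_map c) ` verts (emb_dom c) = on_verts f ` verts H"
    "on_arcs (emb_map c) ` bdry (emb_dom c) = on_arcs f ` bdry H"
    using r c embedding_class[OF e] by auto
  then show "c = emb_class G (emb_dom c) (emb_map c)"
    unfolding embedding_class[OF e'] by (simp add: c embedding_class[OF e])
qed

lemma Emb_eqI:
  assumes c: "c \<in> Emb G" and c': "c' \<in> Emb G"
    and eq: "emb_verts c = emb_verts c'" "emb_bdry c = emb_bdry c'"
  shows "c = c'"
proof -
  have "c = emb_class G (emb_dom c) (emb_map c)" by (rule Emb_rep(2)[OF c])
  also have "\<dots> = emb_class G (emb_dom c') (emb_map c')"
    unfolding embedding_class[OF Emb_rep(1)[OF c]] embedding_class[OF Emb_rep(1)[OF c']]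
      eq[unfolded emb_verts_def emb_bdry_def] ..
  also have "\<dots> = c'" by (rule Emb_rep(2)[OF c', symmetric])
  finally show ?thesis .
qed

lemma presentation_Emb:
  fixes G :: "('a, 'v) graph"
  assumes inf: "infinite (UNIV :: 'a set)" and p: "presentation X G g"
  shows "emb_class G X g \<in> Emb G" "emb_verts (emb_class G X g) = on_verts g ` verts X"
    "emb_bdry (emb_class G X g) = on_arcs g ` loose X"
proof -
  obtain H :: "('a, 'v) graph" and f where e: "embedding H G f"
    and v: "on_verts f ` verts H = on_verts g ` verts X"
    and b: "on_arcs f ` bdry H = on_arcs g ` loose X"
    using presentation_transport[OF inf p] by (elim exE conjE) (rule that)
  have eq: "emb_class G X g = emb_class G H f"
    unfolding emb_class_eq[OF p] embedding_class[OF e] v b ..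
  show "emb_class G X g \<in> Emb G" unfolding Emb_def eq mem_Collect_eq
    by (intro exI conjI) (rule refl, rule e)
  have "(H, f) \<in> emb_class G X g" unfolding eq embedding_class[OF e] using e by simp
  then have "emb_rep (emb_class G X g) \<in> emb_class G X g" unfolding emb_rep_def by (rule someI)
  then have "(emb_dom (emb_class G X g), emb_map (emb_class G X g)) \<in> emb_class G X g"
    by (simp add: emb_dom_def emb_map_def)
  then show "emb_verts (emb_class G X g) = on_verts g ` verts X"
    "emb_bdry (emb_class G X g) = on_arcs g ` loose X"
    unfolding emb_verts_def emb_bdry_def by (simp_all add: emb_class_eq[OF p])
qed

lemma embedding_Emb:
  fixes G :: "('a, 'v) graph"
  assumes inf: "infinite (UNIV :: 'a set)" and e: "embedding H G f"
  shows "emb_class G H f \<in> Emb G" "emb_verts (emb_class G H f) = on_verts f ` verts H"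
    "emb_bdry (emb_class G H f) = on_arcs f ` bdry H"
  using presentation_Emb[OF inf embeddingD(3)[OF e]] loose_graph[OF embeddingD(1)[OF e]] by auto

lemma (in presentation) exc_edge_iff: "isomorphic X exc_edge \<longleftrightarrow> verts X = {}"
proof
  assume "isomorphic X exc_edge"
  then obtain z where "diso X exc_edge z" unfolding isomorphic_def by blast
  then have "z \<in> dhom X exc_edge" unfolding diso_def by blast
  then show "verts X = {}" using dhomD(6)[of z X exc_edge] by (auto simp: exc_edge_def)
next
  assume V: "verts X = {}"
  obtain a where a: "a \<in> arcs X" and A: "arcs X = {a, dag X a}" using no_verts(2)[OF V] by blast
  have D: "darts X = {}" by (rule no_verts(1)[OF V])
  define z :: "('b, 'e, 'w, bool, bool, unit) dmap" where
    "z = \<lparr>on_arcs = (\<lambda>x\<in>arcs X. x = a), on_darts = (\<lambda>_. undefined), on_verts = (\<lambda>_. undefined)\<rparr>"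
  have n: "dag X a \<noteq> a" by (rule dag_neq[OF a])
  have "z \<in> dhom X exc_edge"
    unfolding dhom_def mem_Collect_eq
  proof (intro conjI ballI)
    fix x assume x: "x \<in> arcs X"
    then have "x = a \<or> x = dag X a" using A by simp
    then show "on_arcs z (dag X x) = dag exc_edge (on_arcs z x)"
      using n dag_dag[OF a] diagramD(1)[OF diagX] a by (auto simp: z_def exc_edge_def)
  qed (simp_all add: z_def exc_edge_def V D)
  moreover have "bij_betw (on_arcs z) (arcs X) (arcs exc_edge)"
    using n unfolding bij_betw_def by (auto simp: z_def exc_edge_def A inj_on_def)
  ultimately have "diso X exc_edge z"
    unfolding diso_iff_bij[OF diagX] by (simp add: V D exc_edge_def bij_betw_def)
  then show "isomorphic X exc_edge" unfolding isomorphic_def by blast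
qed

lemma is_edge_iff:
  assumes "c \<in> Emb G"
  shows "is_edge c \<longleftrightarrow> emb_verts c = {}"
  using presentation.exc_edge_iff[OF embeddingD(3)[OF Emb_rep(1)[OF assms]]]
  by (simp add: is_edge_def emb_verts_def)

section \<open>Composites of embeddings\<close>

lemma graph_did_embedding:
  assumes "is_graph G" "linked G"
  shows "embedding G G (did G)"
proof -
  have "etale G G (did G)"
    by (rule etaleI[OF graphD(1)[OF assms(1)] did_hom[OF graphD(1)[OF assms(1)]]])
      (auto simp: inj_on_def graphD(7)[OF assms(1)] image_iff)
  then show ?thesis
    unfolding embedding_def using assms by (simp add: graph_linked inj_on_def)
qed

lemma embedding_dcomp:
  assumes f: "embedding H G f" and q: "embedding K H q"
  shows "embedding K G (dcomp K f q)"
proof -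
  note F = embeddingD[OF f] note Q = embeddingD[OF q]
  note K = graphD[OF Q(1)]
  have h: "dcomp K f q \<in> dhom K G" by (rule dcomp_hom[OF K(1) Q(4) F(4)])
  have v: "inj_on (on_verts (dcomp K f q)) (verts K)"
    using comp_inj_on[OF Q(7) inj_on_subset[OF F(7)]] dhomD(6)[OF Q(4)]
    by (auto simp: inj_on_def)
  have "etale K G (dcomp K f q)"
  proof (rule etaleI[OF K(1) h v])
    show "inj_on (on_darts (dcomp K f q)) (darts K)"
    proof (rule inj_onI)
      fix x y assume xy: "x \<in> darts K" "y \<in> darts K"
        and "on_darts (dcomp K f q) x = on_darts (dcomp K f q) y"
      then have "on_darts f (on_darts q x) = on_darts f (on_darts q y)" by simp
      then have "on_darts q x = on_darts q y"
        by (rule inj_onD[OF presentation.darts_inj[OF F(3)] _ dhomD(5)[OF Q(4) xy(1)] dhomD(5)[OF Q(4) xy(2)]])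
      then show "x = y" by (rule inj_onD[OF presentation.darts_inj[OF Q(3)] _ xy])
    qed
    fix e assume e: "e \<in> darts G" "att G e \<in> on_verts (dcomp K f q) ` verts K"
    then obtain v where v: "v \<in> verts K" "att G e = on_verts f (on_verts q v)" by auto
    then have "att G e \<in> on_verts f ` verts H" using dhomD(6)[OF Q(4) v(1)] by simp
    then have "e \<in> on_darts f ` darts H"
      unfolding presentation.darts_image[OF F(3)] using e(1) by simp
    then obtain d where d: "d \<in> darts H" "e = on_darts f d" by blast
    have "on_verts f (att H d) = on_verts f (on_verts q v)"
      using dhomD(9)[OF F(4) d(1)] d(2) v(2) by simp
    then have "att H d = on_verts q v"
      by (rule inj_onD[OF F(7) _ graphD(7)[OF F(1) d(1)] dhomD(6)[OF Q(4) v(1)]])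
    then have "d \<in> on_darts q ` darts K"
      unfolding presentation.darts_image[OF Q(3)] using d(1) v(1) by simp
    then obtain x where "x \<in> darts K" "d = on_darts q x" by blast
    then show "e \<in> on_darts (dcomp K f q) ` darts K"
      using d(2) by (intro rev_image_eqI[of x]) simp_all
  qed
  then show ?thesis
    unfolding embedding_def using Q(1,5) F(2,6) v by (simp add: graph_linked)
qed

lemma embedding_cancel:
  assumes f: "embedding H G f" and g: "embedding K G (dcomp K f q)" and h: "q \<in> dhom K H"
  shows "embedding K H q"
proof -
  note F = embeddingD[OF f] note Q = embeddingD[OF g]
  note K = graphD[OF Q(1)]
  have v: "inj_on (on_verts q) (verts K)"
  proof (rule inj_onI)
    fix x y assume xy: "x \<in> verts K" "y \<in> verts K" and "on_verts q x = on_verts q y"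
    then have "on_verts (dcomp K f q) x = on_verts (dcomp K f q) y" by simp
    then show "x = y" by (rule inj_onD[OF Q(7) _ xy])
  qed
  have "etale K H q"
  proof (rule etaleI[OF K(1) h v])
    show "inj_on (on_darts q) (darts K)"
    proof (rule inj_onI)
      fix x y assume xy: "x \<in> darts K" "y \<in> darts K" and "on_darts q x = on_darts q y"
      then have "on_darts (dcomp K f q) x = on_darts (dcomp K f q) y" by simp
      then show "x = y" by (rule inj_onD[OF presentation.darts_inj[OF Q(3)] _ xy])
    qed
    fix e assume e: "e \<in> darts H" "att H e \<in> on_verts q ` verts K"
    then obtain v where v: "v \<in> verts K" "att H e = on_verts q v" by blast
    have "att G (on_darts f e) = on_verts (dcomp K f q) v"
      using dhomD(9)[OF F(4) e(1)] v by simp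
    then have "on_darts f e \<in> on_darts (dcomp K f q) ` darts K"
      unfolding presentation.darts_image[OF Q(3)] using dhomD(5)[OF F(4) e(1)] v(1) by simp
    then obtain x where x: "x \<in> darts K" "on_darts f e = on_darts f (on_darts q x)" by auto
    have "e = on_darts q x"
      by (rule inj_onD[OF presentation.darts_inj[OF F(3)] x(2) e(1) dhomD(5)[OF h x(1)]])
    then show "e \<in> on_darts q ` darts K" using x(1) by blast
  qed
  then show ?thesis
    unfolding embedding_def using Q(1,5) F(1,5) v by (simp add: graph_linked)
qed

lemma embedding_nb:
  assumes f: "embedding H G f" and v: "v \<in> verts H"
  shows "on_arcs f ` nb H v = nb G (on_verts f v)"
proof -
  note F = embeddingD[OF f]
  show ?thesis
  proof (intro equalityI subsetI)
    fix e assume "e \<in> on_arcs f ` nb H v"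
    then obtain d where d: "d \<in> darts H" "att H d = v" "e = on_arcs f d" by (auto simp: nb_def)
    then show "e \<in> nb G (on_verts f v)"
      using dhomD(5)[OF F(4) d(1)] dhomD(9)[OF F(4) d(1)] F(10)[OF d(1)] by (simp add: nb_def)
  next
    fix e assume e: "e \<in> nb G (on_verts f v)"
    then have "e \<in> on_arcs f ` darts H" unfolding F(11) using v by (simp add: nb_def)
    then obtain d where d: "d \<in> darts H" "e = on_arcs f d" by blast
    have "on_verts f (att H d) = on_verts f v"
      using dhomD(9)[OF F(4) d(1)] F(10)[OF d(1)] d(2) e by (simp add: nb_def)
    then have "att H d = v"
      by (rule inj_onD[OF F(7) _ graphD(7)[OF F(1) d(1)] v])
    then show "e \<in> on_arcs f ` nb H v" using d by (auto simp: nb_def)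
  qed
qed

text \<open>An embedding that sends boundary arcs to boundary arcs is surjective: its image is closed
  under adjacency, and the target is connected.\<close>

lemma embedding_onto:
  assumes f: "embedding H G f" and b: "on_arcs f ` bdry H \<subseteq> bdry G"
  shows "on_verts f ` verts H = verts G" "on_arcs f ` arcs H = arcs G"
    "bdry H = {} \<Longrightarrow> bdry G = {}"
proof -
  note F = embeddingD[OF f]
  have "(dag G a \<in> on_arcs f ` arcs H) = (a \<in> on_arcs f ` arcs H)" if a: "a \<in> arcs G" for a
  proof -
    have *: "dag G x \<in> on_arcs f ` arcs H" if "x \<in> on_arcs f ` arcs H" for x
    proof -
      from that obtain y where y: "y \<in> arcs H" "x = on_arcs f y" by blast
      then show ?thesis
        using dhomD(7)[OF F(4) y(1)] graphD(2)[OF F(1) y(1)]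
        by (intro rev_image_eqI[of "dag H y"]) simp_all
    qed
    show ?thesis using *[of a] *[of "dag G a"] graphD(3)[OF F(2) a] by auto
  qed
  moreover have "(att G d \<in> on_verts f ` verts H) = (inc G d \<in> on_arcs f ` arcs H)"
    if d: "d \<in> darts G" for d
  proof
    assume "att G d \<in> on_verts f ` verts H"
    then have "d \<in> on_arcs f ` darts H" unfolding F(11) using d by simp
    then show "inc G d \<in> on_arcs f ` arcs H"
      using graphD(6)[OF F(2) d] graphD(5)[OF F(1)] by auto
  next
    assume "inc G d \<in> on_arcs f ` arcs H"
    then obtain y where y: "y \<in> arcs H" "d = on_arcs f y" using graphD(6)[OF F(2) d] by auto
    have "y \<in> darts H"
    proof (rule ccontr)
      assume "y \<notin> darts H"
      then have "d \<in> bdry G" using b y by (auto simp: bdry_def)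
      then show False using d by (simp add: bdry_def)
    qed
    then have "d \<in> on_arcs f ` darts H" using y by blast
    then show "att G d \<in> on_verts f ` verts H" unfolding F(11) by simp
  qed
  ultimately have "\<exists>b. (\<forall>a\<in>arcs G. (a \<in> on_arcs f ` arcs H) = b) \<and>
      (\<forall>v\<in>verts G. (v \<in> on_verts f ` verts H) = b)"
    by (rule linkedD[OF F(6)])
  then obtain b where b: "\<forall>a\<in>arcs G. (a \<in> on_arcs f ` arcs H) = b"
    "\<forall>v\<in>verts G. (v \<in> on_verts f ` verts H) = b" by blast
  have b
  proof (cases "arcs H = {}")
    case True
    then have "verts H \<noteq> {}"
      using linked_nonempty[OF F(5)] graphD(5)[OF F(1)] unfolding nonempty_def by blast
    then obtain v where "v \<in> verts H" by blast
    then show ?thesis using b(2) dhomD(6)[OF F(4)] by blast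
  next
    case False
    then obtain v where "v \<in> arcs H" by blast
    then show ?thesis using b(1) dhomD(4)[OF F(4)] by blast
  qed
  then show "on_verts f ` verts H = verts G" and A: "on_arcs f ` arcs H = arcs G"
    using b dhomD(4)[OF F(4)] dhomD(6)[OF F(4)] by auto
  show "bdry G = {}" if H: "bdry H = {}"
  proof -
    have "arcs H = darts H" using H graphD(5)[OF F(1)] by (auto simp: bdry_def)
    then have "arcs G \<subseteq> darts G" using A F(11) by auto
    then show ?thesis by (simp add: bdry_def)
  qed
qed

section \<open>Graphical maps\<close>

lemma graphical_mapD:
  assumes "graphical_map G G' \<phi>"
  shows "is_graph G" "linked G" "is_graph G'" "linked G'"
    "on0 \<phi> \<in> arcs G \<rightarrow>\<^sub>E arcs G'" "on1 \<phi> \<in> verts G \<rightarrow>\<^sub>E Emb G'"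
    "a \<in> arcs G \<Longrightarrow> on0 \<phi> a \<in> arcs G'"
    "v \<in> verts G \<Longrightarrow> on1 \<phi> v \<in> Emb G'"
    "a \<in> arcs G \<Longrightarrow> on0 \<phi> (dag G a) = dag G' (on0 \<phi> a)"
    "v \<in> verts G \<Longrightarrow> embedding (emb_dom (on1 \<phi> v)) G' (emb_map (on1 \<phi> v))"
    "\<lbrakk>v \<in> verts G; w \<in> verts G; x \<in> emb_verts (on1 \<phi> v); x \<in> emb_verts (on1 \<phi> w)\<rbrakk> \<Longrightarrow> v = w"
    "v \<in> verts G \<Longrightarrow> bij_betw (\<lambda>a. on0 \<phi> (dag G a)) (nb G v) (emb_bdry (on1 \<phi> v))"
    "bdry G = {} \<Longrightarrow> \<exists>v\<in>verts G. emb_verts (on1 \<phi> v) \<noteq> {}"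
proof -
  show G: "is_graph G" and "linked G" and G': "is_graph G'" and "linked G'"
    using assms unfolding graphical_map_def by (auto simp: graph_linked)
  show "on0 \<phi> \<in> arcs G \<rightarrow>\<^sub>E arcs G'" and o1: "on1 \<phi> \<in> verts G \<rightarrow>\<^sub>E Emb G'"
    using assms unfolding graphical_map_def by auto
  then show "a \<in> arcs G \<Longrightarrow> on0 \<phi> a \<in> arcs G'" by blast
  show E: "v \<in> verts G \<Longrightarrow> on1 \<phi> v \<in> Emb G'" for v using o1 by blast
  show "a \<in> arcs G \<Longrightarrow> on0 \<phi> (dag G a) = dag G' (on0 \<phi> a)"
    using assms unfolding graphical_map_def by blast
  show "v \<in> verts G \<Longrightarrow> embedding (emb_dom (on1 \<phi> v)) G' (emb_map (on1 \<phi> v))"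
    by (rule Emb_rep(1)[OF E])
  show "v = w" if vw: "v \<in> verts G" "w \<in> verts G"
    "x \<in> emb_verts (on1 \<phi> v)" "x \<in> emb_verts (on1 \<phi> w)"
  proof -
    have inj: "inj_on (\<lambda>(v, u). on_verts (emb_map (on1 \<phi> v)) u)
        (SIGMA v:verts G. verts (emb_dom (on1 \<phi> v)))"
      using assms unfolding graphical_map_def by blast
    obtain y where y: "y \<in> verts (emb_dom (on1 \<phi> v))" "x = on_verts (emb_map (on1 \<phi> v)) y"
      using vw by (auto simp: emb_verts_def)
    obtain z where z: "z \<in> verts (emb_dom (on1 \<phi> w))" "x = on_verts (emb_map (on1 \<phi> w)) z"
      using vw by (auto simp: emb_verts_def)
    have "(v, y) = (w, z)"
      by (rule inj_onD[OF inj]) (use y z vw in auto)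
    then show ?thesis by simp
  qed
  show "v \<in> verts G \<Longrightarrow> bij_betw (\<lambda>a. on0 \<phi> (dag G a)) (nb G v) (emb_bdry (on1 \<phi> v))"
    using assms unfolding graphical_map_def by blast
  show "bdry G = {} \<Longrightarrow> \<exists>v\<in>verts G. emb_verts (on1 \<phi> v) \<noteq> {}"
    using assms is_edge_iff[OF E] unfolding graphical_map_def by auto
qed

lemma graphical_map_bdry:
  assumes "graphical_map G G' \<phi>" "v \<in> verts G"
  shows "emb_bdry (on1 \<phi> v) = (\<lambda>a. on0 \<phi> (dag G a)) ` nb G v"
  using graphical_mapD(12)[OF assms] by (simp add: bij_betw_def)

lemma graphical_mapI:
  assumes "is_graph G" "linked G" "is_graph G'" "linked G'"
    "on0 \<phi> \<in> arcs G \<rightarrow>\<^sub>E arcs G'" and o1: "on1 \<phi> \<in> verts G \<rightarrow>\<^sub>E Emb G'"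
    "\<And>a. a \<in> arcs G \<Longrightarrow> on0 \<phi> (dag G a) = dag G' (on0 \<phi> a)"
    and dj: "\<And>v w x. \<lbrakk>v \<in> verts G; w \<in> verts G; x \<in> emb_verts (on1 \<phi> v); x \<in> emb_verts (on1 \<phi> w)\<rbrakk>
      \<Longrightarrow> v = w"
    and "\<And>v. v \<in> verts G \<Longrightarrow> bij_betw (\<lambda>a. on0 \<phi> (dag G a)) (nb G v) (emb_bdry (on1 \<phi> v))"
    and ne: "bdry G = {} \<Longrightarrow> \<exists>v\<in>verts G. emb_verts (on1 \<phi> v) \<noteq> {}"
  shows "graphical_map G G' \<phi>"
proof -
  have E: "on1 \<phi> v \<in> Emb G'" if "v \<in> verts G" for v using o1 that by blast
  have "inj_on (\<lambda>(v, u). on_verts (emb_map (on1 \<phi> v)) u)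
      (SIGMA v:verts G. verts (emb_dom (on1 \<phi> v)))"
  proof (rule inj_onI, clarify)
    fix v y w z
    assume vw: "v \<in> verts G" "w \<in> verts G"
      and y: "y \<in> verts (emb_dom (on1 \<phi> v))" and z: "z \<in> verts (emb_dom (on1 \<phi> w))"
      and eq: "on_verts (emb_map (on1 \<phi> v)) y = on_verts (emb_map (on1 \<phi> w)) z"
    have "on_verts (emb_map (on1 \<phi> v)) y \<in> emb_verts (on1 \<phi> v)"
      "on_verts (emb_map (on1 \<phi> v)) y \<in> emb_verts (on1 \<phi> w)"
      unfolding emb_verts_def by (rule imageI[OF y], unfold eq, rule imageI[OF z])
    then have vw': "v = w" by (rule dj[OF vw])
    have "y = z"
      by (rule inj_onD[OF embeddingD(7)[OF Emb_rep(1)[OF E[OF vw(1)]]]]) (use y z eq vw' in auto)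
    then show "v = w \<and> y = z" using vw' by simp
  qed
  moreover have "\<exists>v\<in>verts G. \<not> is_edge (on1 \<phi> v)" if "bdry G = {}"
    using ne[OF that] is_edge_iff[OF E] by blast
  ultimately show ?thesis
    unfolding graphical_map_def using assms by (simp add: graph_linked)
qed

text \<open>A graphical map is determined by its action on arcs and by the vertex sets of its values,
  because the boundaries of the values are prescribed by the action on arcs.\<close>

lemma graphical_map_eqI:
  assumes f: "graphical_map G G' \<phi>" and p: "graphical_map G G' \<psi>"
    and a: "\<And>a. a \<in> arcs G \<Longrightarrow> on0 \<phi> a = on0 \<psi> a"
    and v: "\<And>v. v \<in> verts G \<Longrightarrow> emb_verts (on1 \<phi> v) = emb_verts (on1 \<psi> v)"
  shows "\<phi> = \<psi>"
proof (rule gmap.equality)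
  note F = graphical_mapD[OF f] note P = graphical_mapD[OF p]
  show "on0 \<phi> = on0 \<psi>" by (rule PiE_eqI[OF F(5) P(5) a])
  show "on1 \<phi> = on1 \<psi>"
  proof (rule PiE_eqI[OF F(6) P(6)])
    fix u assume u: "u \<in> verts G"
    have "(\<lambda>a. on0 \<phi> (dag G a)) ` nb G u = (\<lambda>a. on0 \<psi> (dag G a)) ` nb G u"
      by (intro image_cong refl a) (simp add: nb_def graphD[OF F(1)])
    then show "on1 \<phi> u = on1 \<psi> u"
      using Emb_eqI[OF F(8)[OF u] P(8)[OF u] v[OF u]]
        graphical_map_bdry[OF f u] graphical_map_bdry[OF p u] by simp
  qed
qed simp

section \<open>Embeddings as graphical maps\<close>

text \<open>
  The boundary of \<open>\<iota>\<^sub>v\<close> consists of the opposites of all darts at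
  \<open>v\<close>: loops at \<open>v\<close> are cut in the star.
\<close>

lemma star_presentation:
  assumes G: "is_graph G" "linked G" and v: "v \<in> verts G"
  shows "presentation (star G v) G (iota G v)"
    "on_verts (iota G v) ` verts (star G v) = {v}"
    "on_arcs (iota G v) ` loose (star G v) = dag G ` nb G v"
proof -
  note GD = graphD[OF G(1)]
  have nb: "a \<in> nb G v \<longleftrightarrow> a \<in> darts G \<and> att G a = v" for a by (auto simp: nb_def)
  have fin: "finite (nb G v)"
    using diagramD(5)[OF GD(1)] by (rule rev_finite_subset) (auto simp: nb_def)
  have S [simp]: "arcs (star G v) = nb G v <+> nb G v" "darts (star G v) = Inl ` nb G v"
    "verts (star G v) = {v}" by (simp_all add: star_def)
  have D [simp]: "dag (star G v) (Inl a) = Inr a" "dag (star G v) (Inr a) = Inl a"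
    if "a \<in> nb G v" for a using that by (simp_all add: star_def InlI InrI)
  have I [simp]: "inc (star G v) (Inl a) = Inl a" "att (star G v) (Inl a) = v"
    if "a \<in> nb G v" for a using that by (simp_all add: star_def)
  have i [simp]: "on_arcs (iota G v) (Inl a) = a" "on_arcs (iota G v) (Inr a) = dag G a"
    "on_darts (iota G v) (Inl a) = a" if "a \<in> nb G v" for a
    using that by (simp_all add: iota_def InlI InrI)
  have iv [simp]: "on_verts (iota G v) v = v" by (simp add: iota_def)
  have dS: "diagram (star G v)"
    unfolding diagram_def by (auto simp: fin star_def PiE_iff extensional_def)
  have nbA: "a \<in> arcs G" "a \<in> darts G" "att G a = v" if "a \<in> nb G v" for a
    using that GD(5) by (auto simp: nb_def)
  have h: "iota G v \<in> dhom (star G v) G"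
    unfolding dhom_def mem_Collect_eq
  proof (intro conjI ballI)
    show "on_arcs (iota G v) \<in> arcs (star G v) \<rightarrow>\<^sub>E arcs G"
      using nbA GD(2) by (auto simp: PiE_iff extensional_def iota_def)
    show "on_darts (iota G v) \<in> darts (star G v) \<rightarrow>\<^sub>E darts G"
      using nbA by (auto simp: PiE_iff extensional_def iota_def)
    show "on_verts (iota G v) \<in> verts (star G v) \<rightarrow>\<^sub>E verts G"
      using v by (auto simp: PiE_iff extensional_def iota_def)
    show "on_arcs (iota G v) (dag (star G v) a) = dag G (on_arcs (iota G v) a)"
      if "a \<in> arcs (star G v)" for a using that nbA GD(3) by auto
    show "on_arcs (iota G v) (inc (star G v) a) = inc G (on_darts (iota G v) a)"
      if "a \<in> darts (star G v)" for a using that nbA GD(6) by auto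
    show "on_verts (iota G v) (att (star G v) a) = att G (on_darts (iota G v) a)"
      if "a \<in> darts (star G v)" for a using that nbA by auto
  qed
  have inv: "inj_on (on_verts (iota G v)) (verts (star G v))" by simp
  have et: "etale (star G v) G (iota G v)"
  proof (rule etaleI[OF dS h inv])
    show "inj_on (on_darts (iota G v)) (darts (star G v))" by (auto simp: inj_on_def)
    fix e assume "e \<in> darts G" "att G e \<in> on_verts (iota G v) ` verts (star G v)"
    then have e: "e \<in> nb G v" by (simp add: nb_def)
    then show "e \<in> on_darts (iota G v) ` darts (star G v)"
      by (intro rev_image_eqI[of "Inl e"]) simp_all
  qed
  have l: "linked (star G v)"
    unfolding linked_def
  proof (intro conjI allI impI)
    show "nonempty (star G v)" by (simp add: nonempty_def)
    fix P :: "'a + 'a \<Rightarrow> bool" and Q :: "'b \<Rightarrow> bool"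
    assume P: "\<forall>a\<in>arcs (star G v). P (dag (star G v) a) = P a"
      and Q: "\<forall>d\<in>darts (star G v). Q (att (star G v) d) = P (inc (star G v) d)"
    have "P (Inl a) = Q v" if "a \<in> nb G v" for a
      using bspec[OF Q, of "Inl a"] that by simp
    moreover have "P (Inr a) = P (Inl a)" if "a \<in> nb G v" for a
      using bspec[OF P, of "Inl a"] that by (simp add: InlI)
    ultimately show "\<exists>b. (\<forall>a\<in>arcs (star G v). P a = b) \<and> (\<forall>v\<in>verts (star G v). Q v = b)"
      by (intro exI[of _ "Q v"]) auto
  qed
  have ii: "inj_on (inc (star G v)) (darts (star G v))" by (auto simp: inj_on_def)
  show "presentation (star G v) G (iota G v)"
    by (rule presentation.intro) (use dS ii l G et inv in auto)
  show "on_verts (iota G v) ` verts (star G v) = {v}" by simp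
  have "inc (star G v) ` darts (star G v) = Inl ` nb G v"
    unfolding S image_image by (intro image_cong refl) simp
  then have "loose (star G v) = Inr ` nb G v" unfolding loose_def by auto
  then have "on_arcs (iota G v) ` loose (star G v) = (\<lambda>a. on_arcs (iota G v) (Inr a)) ` nb G v"
    by (simp add: image_image)
  also have "\<dots> = dag G ` nb G v" by (intro image_cong refl) simp
  finally show "on_arcs (iota G v) ` loose (star G v) = dag G ` nb G v" .
qed

lemma gmap_of_emb:
  fixes G' :: "('a, 'v) graph"
  assumes inf: "infinite (UNIV :: 'a set)" and e: "embedding G G' f"
  shows "graphical_map G G' (gmap_of_emb G G' f)"
    "on0 (gmap_of_emb G G' f) = on_arcs f"
    "v \<in> verts G \<Longrightarrow> emb_verts (on1 (gmap_of_emb G G' f) v) = {on_verts f v}"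
proof -
  note E = embeddingD[OF e]
  let ?s = "\<lambda>v. emb_class G' (star G' (on_verts f v)) (iota G' (on_verts f v))"
  have s: "?s v \<in> Emb G'" "emb_verts (?s v) = {on_verts f v}"
    "emb_bdry (?s v) = dag G' ` nb G' (on_verts f v)" if "v \<in> verts G" for v
  proof -
    note sp = star_presentation[OF E(2,6) dhomD(6)[OF E(4) that]]
    show "?s v \<in> Emb G'" by (rule presentation_Emb(1)[OF inf sp(1)])
    show "emb_verts (?s v) = {on_verts f v}"
      using presentation_Emb(2)[OF inf sp(1)] sp(2) by simp
    show "emb_bdry (?s v) = dag G' ` nb G' (on_verts f v)"
      using presentation_Emb(3)[OF inf sp(1)] sp(3) by simp
  qed
  have o1: "on1 (gmap_of_emb G G' f) v = ?s v" if "v \<in> verts G" for v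
    using that by (simp add: gmap_of_emb_def)
  show o0: "on0 (gmap_of_emb G G' f) = on_arcs f" by (simp add: gmap_of_emb_def)
  show ev: "emb_verts (on1 (gmap_of_emb G G' f) v) = {on_verts f v}" if "v \<in> verts G" for v
    using s(2)[OF that] o1[OF that] by simp
  have nbA: "a \<in> arcs G" "a \<in> darts G" if "a \<in> nb G v" for a v
    using that graphD(5)[OF E(1)] by (auto simp: nb_def)
  show "graphical_map G G' (gmap_of_emb G G' f)"
  proof (rule graphical_mapI[OF E(1,5,2,6)], unfold o0)
    show "on_arcs f \<in> arcs G \<rightarrow>\<^sub>E arcs G'" by (rule dhomD(1)[OF E(4)])
    show "on1 (gmap_of_emb G G' f) \<in> verts G \<rightarrow>\<^sub>E Emb G'"
      using s(1) by (auto simp: gmap_of_emb_def)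
    show "on_arcs f (dag G a) = dag G' (on_arcs f a)" if "a \<in> arcs G" for a
      by (rule dhomD(7)[OF E(4) that])
    show "v = w" if "v \<in> verts G" "w \<in> verts G" "x \<in> emb_verts (on1 (gmap_of_emb G G' f) v)"
      "x \<in> emb_verts (on1 (gmap_of_emb G G' f) w)" for v w x
      using that inj_onD[OF E(7)] ev by auto
    show "bij_betw (\<lambda>a. on_arcs f (dag G a)) (nb G v) (emb_bdry (on1 (gmap_of_emb G G' f) v))"
      if v: "v \<in> verts G" for v
      unfolding bij_betw_def
    proof
      show "inj_on (\<lambda>a. on_arcs f (dag G a)) (nb G v)"
      proof (rule inj_onI)
        fix a b assume ab: "a \<in> nb G v" "b \<in> nb G v" "on_arcs f (dag G a) = on_arcs f (dag G b)"
        note A = nbA[OF ab(1)] note B = nbA[OF ab(2)]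
        have "dag G' (on_arcs f a) = dag G' (on_arcs f b)"
          using ab(3) dhomD(7)[OF E(4)] A B by simp
        then have "on_arcs f a = on_arcs f b"
          using graphD(3)[OF E(2)] dhomD(4)[OF E(4)] A B by metis
        then show "a = b" by (rule inj_onD[OF E(8) _ A(2) B(2)])
      qed
      have "(\<lambda>a. on_arcs f (dag G a)) ` nb G v = dag G' ` on_arcs f ` nb G v"
        unfolding image_image by (intro image_cong refl dhomD(7)[OF E(4)] nbA(1))
      then show "(\<lambda>a. on_arcs f (dag G a)) ` nb G v = emb_bdry (on1 (gmap_of_emb G G' f) v)"
        unfolding o1[OF v] s(3)[OF v] embedding_nb[OF e v] .
    qed
    show "\<exists>v\<in>verts G. emb_verts (on1 (gmap_of_emb G G' f) v) \<noteq> {}" if "bdry G = {}"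
    proof -
      have "verts G \<noteq> {}"
      proof
        assume "verts G = {}"
        then have "darts G = {}" "arcs G \<noteq> {}"
          using presentation.no_verts[OF E(3)] by auto
        then show False using that by (simp add: bdry_def)
      qed
      then show ?thesis using ev by fastforce
    qed
  qed
qed

section \<open>Restriction of graphical maps along embeddings\<close>

lemma gmap_restrict_simps [simp]:
  "a \<in> arcs H \<Longrightarrow> on0 (gmap_restrict H \<phi> f) a = on0 \<phi> (on_arcs f a)"
  "v \<in> verts H \<Longrightarrow> on1 (gmap_restrict H \<phi> f) v = on1 \<phi> (on_verts f v)"
  by (simp_all add: gmap_restrict_def compose_def)

lemma gmap_restrict_graphical:
  assumes p: "graphical_map G K \<phi>" and f: "embedding H G f"
  shows "graphical_map H K (gmap_restrict H \<phi> f)"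
proof -
  note P = graphical_mapD[OF p] note F = embeddingD[OF f]
  note HD = graphD[OF F(1)]
  have nbA: "a \<in> arcs H" "a \<in> darts H" "dag H a \<in> arcs H" if "a \<in> nb H v" for a v
    using that HD by (auto simp: nb_def)
  show ?thesis
  proof (rule graphical_mapI[OF F(1,5) P(3,4)])
    show "on0 (gmap_restrict H \<phi> f) \<in> arcs H \<rightarrow>\<^sub>E arcs K"
      using P(7) dhomD(4)[OF F(4)] by (auto simp: gmap_restrict_def compose_def)
    show "on1 (gmap_restrict H \<phi> f) \<in> verts H \<rightarrow>\<^sub>E Emb K"
      using P(8) dhomD(6)[OF F(4)] by (auto simp: gmap_restrict_def compose_def)
    show "on0 (gmap_restrict H \<phi> f) (dag H a) = dag K (on0 (gmap_restrict H \<phi> f) a)"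
      if "a \<in> arcs H" for a
      using that HD(2)[OF that] dhomD(7)[OF F(4) that] P(9)[OF dhomD(4)[OF F(4) that]] by simp
    show "v = w" if "v \<in> verts H" "w \<in> verts H" "x \<in> emb_verts (on1 (gmap_restrict H \<phi> f) v)"
      "x \<in> emb_verts (on1 (gmap_restrict H \<phi> f) w)" for v w x
    proof -
      have "on_verts f v = on_verts f w"
        by (rule P(11)[of _ _ x]) (use that dhomD(6)[OF F(4)] in auto)
      then show ?thesis by (rule inj_onD[OF F(7) _ that(1,2)])
    qed
    show "bij_betw (\<lambda>a. on0 (gmap_restrict H \<phi> f) (dag H a)) (nb H v)
      (emb_bdry (on1 (gmap_restrict H \<phi> f) v))" if v: "v \<in> verts H" for v
    proof -
      have "inj_on (on_arcs f) (nb H v)"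
        using F(8) by (rule inj_on_subset) (auto simp: nb_def)
      then have 1: "bij_betw (on_arcs f) (nb H v) (nb G (on_verts f v))"
        unfolding bij_betw_def using embedding_nb[OF f v] by simp
      have "bij_betw ((\<lambda>a. on0 \<phi> (dag G a)) \<circ> on_arcs f) (nb H v) (emb_bdry (on1 \<phi> (on_verts f v)))"
        by (rule bij_betw_trans[OF 1 P(12)[OF dhomD(6)[OF F(4) v]]])
      moreover have "on0 (gmap_restrict H \<phi> f) (dag H a) = ((\<lambda>a. on0 \<phi> (dag G a)) \<circ> on_arcs f) a"
        if "a \<in> nb H v" for a
        using nbA[OF that] dhomD(7)[OF F(4)] by simp
      ultimately show ?thesis
        unfolding gmap_restrict_simps(2)[OF v] by (subst bij_betw_cong) simp_all
    qed
    show "\<exists>v\<in>verts H. emb_verts (on1 (gmap_restrict H \<phi> f) v) \<noteq> {}" if b: "bdry H = {}"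
    proof -
      have *: "on_arcs f ` bdry H \<subseteq> bdry G" using b by simp
      note on = embedding_onto[OF f *]
      have "bdry G = {}" by (rule on(3)[OF b])
      then obtain w where w: "w \<in> verts G" "emb_verts (on1 \<phi> w) \<noteq> {}" using P(13) by blast
      then obtain v where "v \<in> verts H" "w = on_verts f v" using on(1) by blast
      then show ?thesis using w by auto
    qed
  qed
qed

section \<open>The arcs of a graph substitution\<close>

text \<open>
  The equivalence relation defined as an intersection is the least one containing
  \<open>r\<close>.
\<close>

lemma generated_equiv:
  assumes "r \<subseteq> S \<times> S"
  shows "equiv S (generated_equiv S r)" "r \<subseteq> generated_equiv S r"
    "\<And>F. equiv S F \<Longrightarrow> r \<subseteq> F \<Longrightarrow> generated_equiv S r \<subseteq> F"
proof -
  have S: "equiv S (S \<times> S)"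
    by (rule equivI) (auto simp: refl_on_def sym_def trans_def)
  show "r \<subseteq> generated_equiv S r" unfolding generated_equiv_def by blast
  show "generated_equiv S r \<subseteq> F" if "equiv S F" "r \<subseteq> F" for F
    using that unfolding generated_equiv_def by blast
  show "equiv S (generated_equiv S r)"
  proof (rule equivI)
    show "generated_equiv S r \<subseteq> S \<times> S" unfolding generated_equiv_def using S assms by blast
    show "refl_on S (generated_equiv S r)"
      unfolding generated_equiv_def refl_on_def equiv_def by blast
    show "sym (generated_equiv S r)"
    proof (rule symI)
      fix x y assume xy: "(x, y) \<in> generated_equiv S r"
      show "(y, x) \<in> generated_equiv S r"
        unfolding generated_equiv_def
      proof (rule InterI, clarify)
        fix F assume F: "equiv S F" "r \<subseteq> F"
        then have "(x, y) \<in> F" using xy unfolding generated_equiv_def by blast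
        then show "(y, x) \<in> F" using F(1) unfolding equiv_def sym_def by blast
      qed
    qed
    show "trans (generated_equiv S r)"
    proof (rule transI)
      fix x y z assume xy: "(x, y) \<in> generated_equiv S r" and yz: "(y, z) \<in> generated_equiv S r"
      show "(x, z) \<in> generated_equiv S r"
        unfolding generated_equiv_def
      proof (rule InterI, clarify)
        fix F assume F: "equiv S F" "r \<subseteq> F"
        then have "(x, y) \<in> F" "(y, z) \<in> F" using xy yz unfolding generated_equiv_def by blast+
        then show "(x, z) \<in> F" using F(1) unfolding equiv_def trans_def by blast
      qed
    qed
  qed
qed

lemma generated_equiv_empty: "generated_equiv S {} = Id_on S"
proof
  have "equiv S (Id_on S)" by (rule equivI) (auto simp: refl_on_def sym_def trans_def)
  then show "generated_equiv S {} \<subseteq> Id_on S" by (rule generated_equiv(3)[OF empty_subsetI _ empty_subsetI])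
  show "Id_on S \<subseteq> generated_equiv S {}"
    using generated_equiv(1)[of "{}" S] unfolding equiv_def refl_on_def by auto
qed

text \<open>
  The situation in which the image of \<open>\<phi>\<close> is a graph substitution:
  \<open>G\<close> is not the exceptional edge, which for a connected graph means that it has a
  vertex. The pieces are \<open>K v\<close>, with embeddings \<open>k v\<close> into
  \<open>G'\<close> and coproduct \<open>P\<close>, and \<open>E\<close> is the equivalence
  relation on the arcs of \<open>P\<close> whose classes are the arcs of the substitution.
\<close>

locale gluing =
  fixes G G' :: "('a, 'v) graph" and \<phi> :: "('a, 'v) gmap"
  assumes gm: "graphical_map G G' \<phi>" and verts_ne: "verts G \<noteq> {}"
begin

abbreviation K :: "'v \<Rightarrow> ('a, 'v) graph" where "K v \<equiv> emb_dom (on1 \<phi> v)"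

abbreviation k :: "'v \<Rightarrow> ('a, 'a, 'v, 'a, 'a, 'v) dmap" where "k v \<equiv> emb_map (on1 \<phi> v)"

abbreviation P :: "('v \<times> 'a, 'v \<times> 'a, 'v \<times> 'v) diag" where "P \<equiv> pieces G \<phi>"

abbreviation val :: "'v \<times> 'a \<Rightarrow> 'a" where "val p \<equiv> on_arcs (k (fst p)) (snd p)"

text \<open>
  \<open>beta\<close> is the bijection from the darts of \<open>G\<close> to the boundary arcs of
  all pieces together: the dart \<open>x\<close> at \<open>v\<close> corresponds to the boundary
  arc of \<open>K v\<close> that is matched with the opposite of \<open>x\<close>.
\<close>

definition beta :: "'a \<Rightarrow> 'v \<times> 'a" where
  "beta x = (att G x, bmatch \<phi> (att G x) (dag G x))"

text \<open>
  For every inner dart \<open>x\<close> of \<open>G\<close>, the boundary arc \<open>beta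
  x\<close> is identified with the opposite of the boundary arc at the other end of the edge. Read
  as a directed relation, this is a partial injection, so a class of \<open>E\<close> is either a
  directed path or a directed cycle. A step can be followed by another step only if the piece that
  is entered is an exceptional edge.
\<close>

definition nxt :: "(('v \<times> 'a) \<times> ('v \<times> 'a)) set" where
  "nxt = {(beta x, dag P (beta (dag G x))) | x. x \<in> darts G \<and> dag G x \<in> darts G}"

abbreviation E :: "(('v \<times> 'a) \<times> ('v \<times> 'a)) set" where
  "E \<equiv> coeq_arcs (glue_edges G) P (glue1 G \<phi>) (glue2 G \<phi>)"

lemmas gmD = graphical_mapD[OF gm]

lemmas GD = graphD[OF gmD(1)] and G'D = graphD[OF gmD(3)]

lemmas kD = embeddingD[OF gmD(10)]

lemmas KD = graphD[OF kD(1)]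

lemma P_arcs: "p \<in> arcs P \<longleftrightarrow> fst p \<in> verts G \<and> snd p \<in> arcs (K (fst p))"
  by (cases p) (simp add: pieces_def dcoprod_def)

lemma P_darts: "p \<in> darts P \<longleftrightarrow> fst p \<in> verts G \<and> snd p \<in> darts (K (fst p))"
  by (cases p) (simp add: pieces_def dcoprod_def)

lemma P_verts: "p \<in> verts P \<longleftrightarrow> fst p \<in> verts G \<and> snd p \<in> verts (K (fst p))"
  by (cases p) (simp add: pieces_def dcoprod_def)

lemma P_dag: "p \<in> arcs P \<Longrightarrow> dag P p = (fst p, dag (K (fst p)) (snd p))"
  unfolding P_arcs by (cases p) (simp add: pieces_def dcoprod_def)

lemma P_inc: "p \<in> darts P \<Longrightarrow> inc P p = p"
  unfolding P_darts using KD(6) by (cases p) (simp add: pieces_def dcoprod_def)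

lemma P_att: "p \<in> darts P \<Longrightarrow> att P p = (fst p, att (K (fst p)) (snd p))"
  unfolding P_darts by (cases p) (simp add: pieces_def dcoprod_def)

lemma P_dag_arcs: "p \<in> arcs P \<Longrightarrow> dag P p \<in> arcs P"
  using P_dag[of p] KD(2) by (simp add: P_arcs)

lemma P_dag_dag: "p \<in> arcs P \<Longrightarrow> dag P (dag P p) = p"
  using P_dag[of p] P_dag[OF P_dag_arcs[of p]] KD(3) by (simp add: P_arcs)

lemma P_darts_arcs: "p \<in> darts P \<Longrightarrow> p \<in> arcs P"
  using KD(5) by (simp add: P_arcs P_darts)

lemma finite_P: "finite (arcs P)" "finite (darts P)" "finite (verts P)"
  using diagramD(4-6)[OF GD(1)] diagramD(4-6)[OF KD(1)]
  by (simp_all add: pieces_def dcoprod_def)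

lemma val_arcs: "p \<in> arcs P \<Longrightarrow> val p \<in> arcs G'"
  using dhomD(4)[OF kD(4)] by (simp add: P_arcs)

lemma val_dag: "p \<in> arcs P \<Longrightarrow> val (dag P p) = dag G' (val p)"
  using P_dag[of p] dhomD(7)[OF kD(4)] by (simp add: P_arcs)

lemma flip_G:
  assumes "a \<in> arcs G" "a \<notin> darts G"
  shows "dag G a \<in> darts G"
proof -
  have "presentation G G (did G)"
    using graph_did_embedding[OF gmD(1,2)] embeddingD(3) by blast
  then show ?thesis
    using presentation.flip_dart[of G G "did G" a] verts_ne assms GD(8) by simp
qed

lemma beta:
  assumes "x \<in> darts G"
  shows "beta x \<in> arcs P" "beta x \<notin> darts P" "val (beta x) = on0 \<phi> (dag G x)"
    "fst (beta x) = att G x"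
proof -
  let ?v = "att G x"
  have v: "?v \<in> verts G" by (rule GD(7)[OF assms])
  have "on0 \<phi> (dag G x) \<in> (\<lambda>a. on0 \<phi> (dag G a)) ` nb G ?v" using assms by (auto simp: nb_def)
  then have im: "on0 \<phi> (dag G x) \<in> on_arcs (k ?v) ` bdry (K ?v)"
    using graphical_map_bdry[OF gm v] by (simp add: emb_bdry_def)
  show "val (beta x) = on0 \<phi> (dag G x)"
    using f_inv_into_f[OF im] by (simp add: beta_def bmatch_def)
  have "bmatch \<phi> ?v (dag G x) \<in> bdry (K ?v)"
    using inv_into_into[OF im] by (simp add: bmatch_def)
  then show "beta x \<in> arcs P" "beta x \<notin> darts P"
    using v by (simp_all add: P_arcs P_darts beta_def bdry_def)
  show "fst (beta x) = att G x" by (simp add: beta_def)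
qed

lemma beta_inj:
  assumes "x \<in> darts G" "y \<in> darts G" "beta x = beta y"
  shows "x = y"
proof -
  have v: "att G x = att G y" using assms(3) by (simp add: beta_def)
  have "on0 \<phi> (dag G x) = on0 \<phi> (dag G y)" using beta(3)[OF assms(1)] beta(3)[OF assms(2)] assms(3) by simp
  moreover have "inj_on (\<lambda>a. on0 \<phi> (dag G a)) (nb G (att G x))"
    using gmD(12)[OF GD(7)[OF assms(1)]] by (simp add: bij_betw_def)
  moreover have "x \<in> nb G (att G x)" "y \<in> nb G (att G x)" using assms v by (auto simp: nb_def)
  ultimately show ?thesis by (simp add: inj_on_def)
qed

lemma beta_surj:
  assumes p: "p \<in> arcs P" "p \<notin> darts P"
  shows "\<exists>x\<in>darts G. p = beta x"
proof -
  obtain v b where vb: "p = (v, b)" by (cases p)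
  have v: "v \<in> verts G" and b: "b \<in> bdry (K v)" using p by (auto simp: P_arcs P_darts vb bdry_def)
  have "on_arcs (k v) b \<in> emb_bdry (on1 \<phi> v)" using b by (auto simp: emb_bdry_def)
  then obtain x where x: "x \<in> nb G v" "on_arcs (k v) b = on0 \<phi> (dag G x)"
    unfolding graphical_map_bdry[OF gm v] by blast
  have xd: "x \<in> darts G" and xv: "att G x = v" using x(1) by (auto simp: nb_def)
  have "snd (beta x) \<in> bdry (K v)"
    using beta(1,2,4)[OF xd] xv by (auto simp: P_arcs P_darts bdry_def)
  moreover have "on_arcs (k v) (snd (beta x)) = on_arcs (k v) b"
    using beta(3,4)[OF xd] x(2) xv by simp
  ultimately have "snd (beta x) = b" using inj_onD[OF kD(9)[OF v]] b by blast
  then have "p = beta x" using vb xv beta(4)[OF xd] by (metis prod.collapse)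
  then show ?thesis using xd by blast
qed

lemma end1_inner:
  assumes "e \<in> inner_edges G"
  shows "end1 e \<in> darts G" "dag G (end1 e) \<in> darts G" "e = {end1 e, dag G (end1 e)}"
proof -
  obtain a where a: "e = {a, dag G a}" "a \<in> darts G" "dag G a \<in> darts G"
    using assms unfolding inner_edges_def by blast
  have "end1 e \<in> e" unfolding end1_def by (rule someI[of _ a]) (simp add: a(1))
  then have "end1 e = a \<or> end1 e = dag G a" using a(1) by simp
  then show "end1 e \<in> darts G" "dag G (end1 e) \<in> darts G" "e = {end1 e, dag G (end1 e)}"
    using a GD(3)[OF GD(5)[OF a(2)]] by auto
qed

lemma glue_arcs: "arcs (glue_edges G) = inner_edges G \<times> UNIV"
  by (auto simp: glue_edges_def dcoprod_def exc_edge_def)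

lemma glue_pair:
  assumes "e \<in> inner_edges G"
  shows "on_arcs (glue1 G \<phi>) (e, True) = beta (end1 e)"
    "on_arcs (glue1 G \<phi>) (e, False) = dag P (beta (end1 e))"
    "on_arcs (glue2 G \<phi>) (e, True) = dag P (beta (dag G (end1 e)))"
    "on_arcs (glue2 G \<phi>) (e, False) = beta (dag G (end1 e))"
  using assms end1_inner[OF assms] beta(1)[OF end1_inner(1)[OF assms]] beta(1)[OF end1_inner(2)[OF assms]]
  by (simp_all add: glue1_def glue2_def glue_arcs Let_def beta_def end2_def P_dag)

text \<open>
  The generating relation of the coequalizer. Depending on the chosen ordering of the edge, its
  pairs are those of \<open>nxt\<close> or their converses.
\<close>

definition R :: "(('v \<times> 'a) \<times> ('v \<times> 'a)) set" where
  "R = (\<lambda>a. (on_arcs (glue1 G \<phi>) a, on_arcs (glue2 G \<phi>) a)) ` arcs (glue_edges G)"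

lemma nxtI: "x \<in> darts G \<Longrightarrow> dag G x \<in> darts G \<Longrightarrow> (beta x, dag P (beta (dag G x))) \<in> nxt"
  by (auto simp: nxt_def)

lemma nxt_flip:
  assumes "x \<in> darts G" "dag G x \<in> darts G"
  shows "(beta (dag G x), dag P (beta x)) \<in> nxt"
  using nxtI[of "dag G x"] assms GD(3)[OF GD(5)[OF assms(1)]] by simp

lemma R_nxt: "R \<subseteq> nxt \<union> nxt\<inverse>"
proof
  fix q assume "q \<in> R"
  then obtain e b where e: "e \<in> inner_edges G"
    and q: "q = (on_arcs (glue1 G \<phi>) (e, b), on_arcs (glue2 G \<phi>) (e, b))"
    unfolding R_def glue_arcs by auto
  note x = end1_inner[OF e]
  show "q \<in> nxt \<union> nxt\<inverse>"
    using nxtI[OF x(1,2)] nxt_flip[OF x(1,2)] glue_pair[OF e] q by (cases b) auto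
qed

lemma nxt_R: "nxt \<subseteq> R \<union> R\<inverse>"
proof
  fix q assume "q \<in> nxt"
  then obtain x where x: "x \<in> darts G" "dag G x \<in> darts G" "q = (beta x, dag P (beta (dag G x)))"
    unfolding nxt_def by blast
  let ?e = "{x, dag G x}"
  have e: "?e \<in> inner_edges G" unfolding inner_edges_def using x by blast
  have r: "(on_arcs (glue1 G \<phi>) (?e, b), on_arcs (glue2 G \<phi>) (?e, b)) \<in> R" for b
    unfolding R_def glue_arcs using e by blast
  have "end1 ?e \<in> ?e" unfolding end1_def by (rule someI[of _ x]) simp
  then consider "end1 ?e = x" | "end1 ?e = dag G x" by blast
  then show "q \<in> R \<union> R\<inverse>"
  proof cases
    case 1
    then show ?thesis using r[of True] glue_pair[OF e] x(3) by simp
  next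
    case 2
    then show ?thesis using r[of False] glue_pair[OF e] x(3) GD(3)[OF GD(5)[OF x(1)]] by simp
  qed
qed

lemma nxt_arcs: "(p, q) \<in> nxt \<Longrightarrow> p \<in> arcs P \<and> q \<in> arcs P"
  unfolding nxt_def using beta(1) P_dag_arcs by blast

lemma R_sub: "R \<subseteq> arcs P \<times> arcs P"
proof
  fix q assume "q \<in> R"
  then have "q \<in> nxt \<or> q \<in> nxt\<inverse>" using R_nxt by blast
  then show "q \<in> arcs P \<times> arcs P" using nxt_arcs by (cases q) auto
qed

lemma E_def': "E = generated_equiv (arcs P) R"
  by (simp add: coeq_arcs_def R_def)

lemma E_equiv: "equiv (arcs P) E"
  unfolding E_def' by (rule generated_equiv(1)[OF R_sub])

lemma E_sym: "(p, q) \<in> E \<Longrightarrow> (q, p) \<in> E"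
  using E_equiv unfolding equiv_def sym_def by blast

lemma E_refl: "p \<in> arcs P \<Longrightarrow> (p, p) \<in> E"
  using E_equiv unfolding equiv_def refl_on_def by blast

lemma E_trans: "(p, q) \<in> E \<Longrightarrow> (q, r) \<in> E \<Longrightarrow> (p, r) \<in> E"
  using E_equiv unfolding equiv_def trans_def by blast

lemma nxt_E: "nxt \<subseteq> E"
proof -
  have "R \<subseteq> E" unfolding E_def' by (rule generated_equiv(2)[OF R_sub])
  moreover have "R\<inverse> \<subseteq> E"
  proof
    fix q assume "q \<in> R\<inverse>"
    then show "q \<in> E" using \<open>R \<subseteq> E\<close> E_sym by (cases q) blast
  qed
  ultimately show ?thesis using nxt_R by blast
qed

lemma E_minimal:
  assumes F: "equiv (arcs P) F" and n: "nxt \<subseteq> F"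
  shows "E \<subseteq> F"
proof -
  have "nxt\<inverse> \<subseteq> F"
  proof
    fix q assume "q \<in> nxt\<inverse>"
    then show "q \<in> F" using n F unfolding equiv_def sym_def by (cases q) blast
  qed
  then have "R \<subseteq> F" using R_nxt n by blast
  then show ?thesis unfolding E_def' by (rule generated_equiv(3)[OF R_sub F])
qed

lemma E_val: "(p, q) \<in> E \<Longrightarrow> val p = val q"
proof -
  let ?F = "{(p, q). p \<in> arcs P \<and> q \<in> arcs P \<and> val p = val q}"
  have "equiv (arcs P) ?F" by (rule equivI) (auto simp: refl_on_def sym_def trans_def)
  moreover have "nxt \<subseteq> ?F"
  proof
    fix q assume "q \<in> nxt"
    then obtain x where x: "x \<in> darts G" "dag G x \<in> darts G" "q = (beta x, dag P (beta (dag G x)))"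
      unfolding nxt_def by blast
    have "val (dag P (beta (dag G x))) = dag G' (on0 \<phi> (dag G (dag G x)))"
      using val_dag[OF beta(1)[OF x(2)]] beta(3)[OF x(2)] by simp
    also have "\<dots> = on0 \<phi> (dag G x)" using GD(3)[OF GD(5)[OF x(1)]] gmD(9)[OF GD(5)[OF x(1)]] by simp
    finally have "val (beta x) = val (dag P (beta (dag G x)))" using beta(3)[OF x(1)] by simp
    then show "q \<in> ?F" using x(3) beta(1)[OF x(1)] P_dag_arcs[OF beta(1)[OF x(2)]] by simp
  qed
  ultimately have "E \<subseteq> ?F" by (rule E_minimal)
  then show "(p, q) \<in> E \<Longrightarrow> val p = val q" by blast
qed

lemma E_dag: "(p, q) \<in> E \<Longrightarrow> (dag P p, dag P q) \<in> E"
proof -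
  let ?F = "{(p, q). p \<in> arcs P \<and> q \<in> arcs P \<and> (dag P p, dag P q) \<in> E}"
  have "equiv (arcs P) ?F"
  proof (rule equivI)
    show "refl_on (arcs P) ?F" using P_dag_arcs E_refl by (auto simp: refl_on_def)
    show "sym ?F" using E_sym by (auto simp: sym_def)
    show "trans ?F"
    proof (rule transI)
      fix x y z assume xyz: "(x, y) \<in> ?F" "(y, z) \<in> ?F"
      then have "(dag P x, dag P y) \<in> E" "(dag P y, dag P z) \<in> E" by simp_all
      then have "(dag P x, dag P z) \<in> E" by (rule E_trans)
      then show "(x, z) \<in> ?F" using xyz by simp
    qed
  qed auto
  moreover have "nxt \<subseteq> ?F"
  proof
    fix q assume q: "q \<in> nxt"
    then obtain x where x: "x \<in> darts G" "dag G x \<in> darts G" "q = (beta x, dag P (beta (dag G x)))"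
      unfolding nxt_def by blast
    have "(dag P (beta x), beta (dag G x)) \<in> E" using nxt_flip[OF x(1,2)] nxt_E E_sym by blast
    then show "q \<in> ?F"
      using x beta(1) P_dag_arcs P_dag_dag by simp
  qed
  ultimately have "E \<subseteq> ?F" by (rule E_minimal)
  then show "(p, q) \<in> E \<Longrightarrow> (dag P p, dag P q) \<in> E" by blast
qed

lemma nxt_single_valued: "single_valued nxt"
  unfolding single_valued_def nxt_def using beta_inj by blast

text \<open>
  Since \<open>nxt\<close> is single-valued, any two members of a class have a common iterated
  successor.
\<close>

lemma E_joinable: "(p, q) \<in> E \<Longrightarrow> \<exists>s. (p, s) \<in> nxt\<^sup>* \<and> (q, s) \<in> nxt\<^sup>*"
proof -
  let ?F = "{(p, q). p \<in> arcs P \<and> q \<in> arcs P \<and> (\<exists>s. (p, s) \<in> nxt\<^sup>* \<and> (q, s) \<in> nxt\<^sup>*)}"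
  have "equiv (arcs P) ?F"
  proof (rule equivI)
    show "refl_on (arcs P) ?F" by (auto simp: refl_on_def)
    show "sym ?F" by (auto simp: sym_def)
    show "trans ?F"
    proof (rule transI)
      fix x y z assume "(x, y) \<in> ?F" "(y, z) \<in> ?F"
      then obtain s t where A: "x \<in> arcs P" "z \<in> arcs P" "(x, s) \<in> nxt\<^sup>*" "(y, s) \<in> nxt\<^sup>*"
        "(y, t) \<in> nxt\<^sup>*" "(z, t) \<in> nxt\<^sup>*" by auto
      from single_valued_confluent[OF nxt_single_valued A(4,5)]
      have "\<exists>u. (x, u) \<in> nxt\<^sup>* \<and> (z, u) \<in> nxt\<^sup>*"
        using A by (meson rtrancl_trans)
      then show "(x, z) \<in> ?F" using A by simp
    qed
  qed auto
  moreover have "nxt \<subseteq> ?F" using nxt_arcs by auto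
  ultimately have "E \<subseteq> ?F" by (rule E_minimal)
  then show "(p, q) \<in> E \<Longrightarrow> \<exists>s. (p, s) \<in> nxt\<^sup>* \<and> (q, s) \<in> nxt\<^sup>*" by blast
qed

text \<open>
  The arcs without a successor: the darts of the pieces, and the boundary arcs of pieces that come
  from boundary arcs of \<open>G\<close>.
\<close>

definition terminal :: "'v \<times> 'a \<Rightarrow> bool" where
  "terminal p \<longleftrightarrow> p \<in> darts P \<or> (\<exists>x\<in>darts G. dag G x \<in> bdry G \<and> p = beta x)"

lemma terminal_nxt: "terminal p \<Longrightarrow> (p, q) \<notin> nxt"
proof
  assume t: "terminal p" and "(p, q) \<in> nxt"
  then obtain x where x: "x \<in> darts G" "dag G x \<in> darts G" "p = beta x" unfolding nxt_def by blast
  then show False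
    using t beta(2)[OF x(1)] beta_inj[OF x(1)] unfolding terminal_def bdry_def by blast
qed

lemma terminal_unique:
  assumes "terminal p" "terminal q" "(p, q) \<in> E"
  shows "p = q"
proof -
  obtain s where s: "(p, s) \<in> nxt\<^sup>*" "(q, s) \<in> nxt\<^sup>*" using E_joinable[OF assms(3)] by blast
  have "p = s" using s(1) terminal_nxt[OF assms(1)] by (meson converse_rtranclE)
  moreover have "q = s" using s(2) terminal_nxt[OF assms(2)] by (meson converse_rtranclE)
  ultimately show ?thesis by simp
qed

lemma not_terminal:
  assumes "p \<in> arcs P" "\<not> terminal p"
  shows "\<exists>x. x \<in> darts G \<and> dag G x \<in> darts G \<and> p = beta x"
proof -
  obtain x where x: "x \<in> darts G" "p = beta x"
    using beta_surj[OF assms(1)] assms(2) by (auto simp: terminal_def)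
  then have "dag G x \<in> darts G"
    using assms(2) GD(2)[OF GD(5)] by (auto simp: terminal_def bdry_def)
  then show ?thesis using x by blast
qed

text \<open>
  No class is a cycle. On the set \<open>N\<close> of arcs from which no terminal arc is reached,
  \<open>nxt\<close> is a permutation, and its inverse is its conjugate under the involution;
  hence \<open>N\<close> is closed under the involution, all pieces it meets are exceptional
  edges, and by connectedness all of \<open>G\<close> is involved. Then \<open>G\<close> has no
  boundary and all values of \<open>\<phi>\<close> are edges, which the third condition on
  graphical maps excludes.
\<close>

lemma reaches_terminal:
  assumes "p \<in> arcs P"
  shows "\<exists>q. (p, q) \<in> nxt\<^sup>* \<and> terminal q"
proof (rule ccontr)
  assume contra: "\<nexists>q. (p, q) \<in> nxt\<^sup>* \<and> terminal q"
  define N where "N = {p\<in>arcs P. \<nexists>q. (p, q) \<in> nxt\<^sup>* \<and> terminal q}"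
  have pN: "p \<in> N" using assms contra by (simp add: N_def)
  have NP: "q \<in> arcs P" if "q \<in> N" for q using that by (simp add: N_def)
  have Nx: "\<exists>x. x \<in> darts G \<and> dag G x \<in> darts G \<and> q = beta x" if "q \<in> N" for q
  proof (rule not_terminal[OF NP[OF that]])
    show "\<not> terminal q" using that rtrancl_refl[of q nxt] unfolding N_def by blast
  qed
  have Nn: "r \<in> N" if "q \<in> N" "(q, r) \<in> nxt" for q r
    using that nxt_arcs by (auto simp: N_def intro: converse_rtrancl_into_rtrancl)
  define nx where "nx q = dag P (beta (dag G (inv_into (darts G) beta q)))" for q
  have nx: "nx (beta x) = dag P (beta (dag G x))" if "x \<in> darts G" for x
  proof -
    have "inj_on beta (darts G)" using beta_inj by (auto simp: inj_on_def)
    then show ?thesis using that by (simp add: nx_def)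
  qed
  have nxN: "nx q \<in> N" if q: "q \<in> N" for q
  proof -
    obtain x where x: "x \<in> darts G" "dag G x \<in> darts G" "q = beta x" using Nx[OF q] by blast
    then show ?thesis using nxtI[OF x(1,2)] Nn q nx by simp
  qed
  have "inj_on nx N"
  proof (rule inj_onI)
    fix q r assume qr: "q \<in> N" "r \<in> N" "nx q = nx r"
    obtain x where x: "x \<in> darts G" "dag G x \<in> darts G" "q = beta x" using Nx[OF qr(1)] by blast
    obtain y where y: "y \<in> darts G" "dag G y \<in> darts G" "r = beta y" using Nx[OF qr(2)] by blast
    have "dag P (beta (dag G x)) = dag P (beta (dag G y))" using qr(3) nx x y by simp
    then have "beta (dag G x) = beta (dag G y)"
      using P_dag_dag[OF beta(1)[OF x(2)]] P_dag_dag[OF beta(1)[OF y(2)]] by metis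
    then have "dag G x = dag G y" by (rule beta_inj[OF x(2) y(2)])
    then have "x = y" using GD(3)[OF GD(5)] x(1) y(1) by metis
    then show "q = r" using x y by simp
  qed
  moreover have "finite N" using finite_P(1) by (simp add: N_def)
  ultimately have surj: "nx ` N = N" using nxN by (simp add: endo_inj_surj image_subset_iff)
  have pre: "\<exists>x. x \<in> darts G \<and> dag G x \<in> darts G \<and> dag P q = beta (dag G x) \<and> beta x \<in> N"
    if q: "q \<in> N" for q
  proof -
    obtain r where r: "r \<in> N" "q = nx r" using surj q by blast
    obtain x where x: "x \<in> darts G" "dag G x \<in> darts G" "r = beta x" using Nx[OF r(1)] by blast
    have "dag P q = beta (dag G x)"
      using r(2) x nx P_dag_dag[OF beta(1)[OF x(2)]] by simp
    then show ?thesis using x r(1) by blast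
  qed
  have dagN: "dag P q \<in> N" if q: "q \<in> N" for q
  proof -
    have "r \<in> dag P ` N" if "(dag P q, r) \<in> nxt\<^sup>*" for r
      using that
    proof (induction rule: rtrancl_induct)
      case base
      show ?case using q by blast
    next
      case (step y z)
      then obtain s where s: "s \<in> N" "y = dag P s" by blast
      obtain x where x: "x \<in> darts G" "dag G x \<in> darts G" "dag P s = beta (dag G x)" "beta x \<in> N"
        using pre[OF s(1)] by blast
      have "(y, dag P (beta x)) \<in> nxt" using nxt_flip[OF x(1,2)] s(2) x(3) by simp
      then have "z = dag P (beta x)" using step.hyps(2) single_valuedD[OF nxt_single_valued] by blast
      then show ?case using x(4) by blast
    qed
    moreover have "\<not> terminal r" if r: "r \<in> dag P ` N" for r
    proof -
      obtain s where s: "s \<in> N" "r = dag P s" using r by blast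
      obtain x where x: "x \<in> darts G" "dag G x \<in> darts G" "dag P s = beta (dag G x)" "beta x \<in> N"
        using pre[OF s(1)] by blast
      have "(r, dag P (beta x)) \<in> nxt" using nxt_flip[OF x(1,2)] x(3) s(2) by simp
      then show ?thesis using terminal_nxt by blast
    qed
    ultimately have "\<not> terminal r" if "(dag P q, r) \<in> nxt\<^sup>*" for r using that by simp
    then show ?thesis using P_dag_arcs[OF NP[OF q]] unfolding N_def by blast
  qed
  have edge: "verts (K v) = {} \<and> {v} \<times> arcs (K v) \<subseteq> N" if q: "(v, b) \<in> N" for v b
  proof -
    have vb: "v \<in> verts G" "b \<in> arcs (K v)" using NP[OF q] by (auto simp: P_arcs)
    have nd: "(v, b) \<notin> darts P" "dag P (v, b) \<notin> darts P"
      using Nx[OF q] Nx[OF dagN[OF q]] beta(2) by auto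
    have d: "dag P (v, b) = (v, dag (K v) b)" using P_dag[OF NP[OF q]] by simp
    have b: "b \<notin> inc (K v) ` darts (K v)" "dag (K v) b \<notin> inc (K v) ` darts (K v)"
      using nd d vb KD(8)[OF vb(1)] by (auto simp: P_darts)
    note pr = kD(3)[OF vb(1)]
    have V: "verts (K v) = {}" using presentation.flip_dart[OF pr _ vb(2) b(1)] b(2) by blast
    obtain a where a: "a \<in> arcs (K v)" "arcs (K v) = {a, dag (K v) a}"
      using presentation.no_verts(2)[OF pr V] by blast
    then have "arcs (K v) \<subseteq> {b, dag (K v) b}" using vb(2) KD(3)[OF vb(1)] by auto
    then have "{v} \<times> arcs (K v) \<subseteq> {(v, b), dag P (v, b)}" using d by auto
    moreover have "{(v, b), dag P (v, b)} \<subseteq> N" using q dagN[OF q] by simp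
    ultimately have "{v} \<times> arcs (K v) \<subseteq> N" by (rule subset_trans)
    then show ?thesis using V by simp
  qed
  \<comment> \<open>the arcs of \<open>G\<close> involved in \<open>N\<close>; they turn out to be all arcs\<close>
  define T where "T = {x\<in>darts G. beta x \<in> N}"
  have T: "dag G x \<in> T" if x: "x \<in> T" for x
  proof -
    have xd: "x \<in> darts G" "beta x \<in> N" using x by (auto simp: T_def)
    then obtain y where y: "y \<in> darts G" "dag G y \<in> darts G" "beta x = beta y" using Nx by blast
    then have xd': "dag G x \<in> darts G" using beta_inj[OF xd(1) y(1)] by simp
    have "dag P (beta (dag G x)) \<in> N" using Nn[OF xd(2) nxtI[OF xd(1) xd']] .
    then have "beta (dag G x) \<in> N" using dagN P_dag_dag[OF beta(1)[OF xd']] by metis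
    then show ?thesis using xd' by (simp add: T_def)
  qed
  have "(dag G a \<in> T) = (a \<in> T)" if "a \<in> arcs G" for a
    using T[of a] T[of "dag G a"] GD(3)[OF that] by auto
  moreover have "(verts (K (att G d)) = {} \<and> {att G d} \<times> arcs (K (att G d)) \<subseteq> N) = (inc G d \<in> T)"
    if d: "d \<in> darts G" for d
  proof
    assume "verts (K (att G d)) = {} \<and> {att G d} \<times> arcs (K (att G d)) \<subseteq> N"
    moreover have "beta d \<in> {att G d} \<times> arcs (K (att G d))"
      using beta(1,4)[OF d] by (cases "beta d") (simp add: P_arcs)
    ultimately show "inc G d \<in> T" using d GD(6)[OF d] by (auto simp: T_def)
  next
    assume "inc G d \<in> T"
    then have "beta d \<in> N" using GD(6)[OF d] by (simp add: T_def)
    then show "verts (K (att G d)) = {} \<and> {att G d} \<times> arcs (K (att G d)) \<subseteq> N"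
      using edge[of "att G d" "snd (beta d)"] beta(4)[OF d] by (metis prod.collapse)
  qed
  ultimately have "\<exists>b. (\<forall>a\<in>arcs G. (a \<in> T) = b) \<and>
      (\<forall>v\<in>verts G. (verts (K v) = {} \<and> {v} \<times> arcs (K v) \<subseteq> N) = b)"
    by (rule linkedD[OF gmD(2)])
  then obtain b where b: "\<forall>a\<in>arcs G. (a \<in> T) = b"
    "\<forall>v\<in>verts G. (verts (K v) = {} \<and> {v} \<times> arcs (K v) \<subseteq> N) = b" by blast
  obtain x where x: "x \<in> darts G" "p = beta x" using Nx[OF pN] by blast
  then have "x \<in> T" using pN by (simp add: T_def)
  then have b using b(1) GD(5)[OF x(1)] by blast
  then have "bdry G = {}" and e: "\<forall>v\<in>verts G. verts (K v) = {}"
    using b by (auto simp: bdry_def T_def)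
  then show False using gmD(13) by (auto simp: emb_verts_def)
qed

end

section \<open>The image of a graphical map\<close>

context gluing
begin

abbreviation X :: "(('v \<times> 'a) set, ('v \<times> 'a) set, ('v \<times> 'v) set) diag" where
  "X \<equiv> substitution G \<phi>"

abbreviation cls :: "'v \<times> 'a \<Rightarrow> ('v \<times> 'a) set" where "cls p \<equiv> E `` {p}"

lemma cls_eq: "p \<in> arcs P \<Longrightarrow> q \<in> arcs P \<Longrightarrow> cls p = cls q \<longleftrightarrow> (p, q) \<in> E"
  by (rule eq_equiv_class_iff[OF E_equiv])

lemma cls_E: "(p, q) \<in> E \<Longrightarrow> cls p = cls q"
  by (rule equiv_class_eq[OF E_equiv])

lemma glue_empty: "darts (glue_edges G) = {}" "verts (glue_edges G) = {}"
  by (auto simp: glue_edges_def dcoprod_def exc_edge_def)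

lemma coeq_discrete:
  "coeq_darts (glue_edges G) P (glue1 G \<phi>) (glue2 G \<phi>) = Id_on (darts P)"
  "coeq_verts (glue_edges G) P (glue1 G \<phi>) (glue2 G \<phi>) = Id_on (verts P)"
  by (simp_all add: coeq_darts_def coeq_verts_def glue_empty generated_equiv_empty)

lemma quotient_Id_on: "S // Id_on S = (\<lambda>x. {x}) ` S"
  unfolding quotient_def by auto

lemma quotient_image: "S // r = (\<lambda>x. r `` {x}) ` S"
  unfolding quotient_def by blast

lemma X_arcs: "arcs X = cls ` arcs P"
proof -
  have "arcs X = arcs P // E" by (simp only: substitution_def dcoeq_def diag.select_convs)
  then show ?thesis unfolding quotient_image .
qed

lemma X_darts: "darts X = (\<lambda>d. {d}) ` darts P"
  by (simp only: substitution_def dcoeq_def diag.select_convs coeq_discrete quotient_Id_on)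

lemma X_verts: "verts X = (\<lambda>u. {u}) ` verts P"
  by (simp only: substitution_def dcoeq_def diag.select_convs coeq_discrete quotient_Id_on)

lemmas X_sets = X_arcs X_darts X_verts

lemma UN_class_const:
  assumes "\<And>q. q \<in> c \<Longrightarrow> f q = f p" "p \<in> c"
  shows "(\<Union>q\<in>c. f q) = f p"
proof -
  have "f ` c = {f p}" using assms by blast
  then show ?thesis by simp
qed

lemma X_dag: "p \<in> arcs P \<Longrightarrow> dag X (cls p) = cls (dag P p)"
proof -
  assume p: "p \<in> arcs P"
  have "(\<Union>q\<in>cls p. cls (dag P q)) = cls (dag P p)"
  proof (rule UN_class_const)
    show "p \<in> cls p" using E_refl[OF p] by simp
    show "cls (dag P q) = cls (dag P p)" if "q \<in> cls p" for q
    proof -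
      have "(p, q) \<in> E" using that by simp
      then show ?thesis using cls_E[OF E_dag] by metis
    qed
  qed
  moreover have "cls p \<in> arcs P // E" using p by (rule quotientI)
  ultimately show ?thesis unfolding substitution_def dcoeq_def by simp
qed

lemma X_inc: "d \<in> darts P \<Longrightarrow> inc X {d} = cls d"
  unfolding substitution_def dcoeq_def by (simp add: coeq_discrete quotient_Id_on P_inc)

lemma X_att: "d \<in> darts P \<Longrightarrow> att X {d} = {att P d}"
proof -
  assume d: "d \<in> darts P"
  have "att P d \<in> verts P" using d KD(7) P_att[OF d] by (simp add: P_darts P_verts)
  then show ?thesis
    using d unfolding substitution_def dcoeq_def by (auto simp: coeq_discrete quotient_Id_on)
qed

lemma P_att_verts: "d \<in> darts P \<Longrightarrow> att P d \<in> verts P"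
  using KD(7) P_att by (simp add: P_darts P_verts)

lemma X_diagram: "diagram X"
  unfolding diagram_def
proof (intro conjI)
  show "finite (arcs X)" "finite (darts X)" "finite (verts X)" using finite_P by (simp_all add: X_sets)
  have ext: "dag X \<in> extensional (arcs X)" "inc X \<in> extensional (darts X)"
    "att X \<in> extensional (darts X)"
    unfolding substitution_def dcoeq_def by simp_all
  show "dag X \<in> arcs X \<rightarrow>\<^sub>E arcs X"
    using ext(1) X_dag P_dag_arcs by (auto simp: PiE_iff X_sets)
  show "inc X \<in> darts X \<rightarrow>\<^sub>E arcs X"
    using ext(2) X_inc P_darts_arcs by (auto simp: PiE_iff X_sets)
  show "att X \<in> darts X \<rightarrow>\<^sub>E verts X"
    using ext(3) X_att P_att_verts by (auto simp: PiE_iff X_sets)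
qed

text \<open>
  The actions on vertices, on darts and on the whole substitution of the map induced by the
  \<open>k v\<close>. On an arc of the substitution, any member of the class may be chosen, by
  \<open>E_val\<close>.
\<close>

definition vval :: "'v \<times> 'v \<Rightarrow> 'v" where "vval u = on_verts (k (fst u)) (snd u)"

definition dval :: "'v \<times> 'a \<Rightarrow> 'a" where "dval d = on_darts (k (fst d)) (snd d)"

definition s :: "(('v \<times> 'a) set, ('v \<times> 'a) set, ('v \<times> 'v) set, 'a, 'a, 'v) dmap" where
  "s = \<lparr>on_arcs = (\<lambda>c\<in>arcs X. val (SOME p. p \<in> c)),
        on_darts = (\<lambda>c\<in>darts X. dval (the_elem c)),
        on_verts = (\<lambda>c\<in>verts X. vval (the_elem c))\<rparr>"

lemma s_arcs: "p \<in> arcs P \<Longrightarrow> on_arcs s (cls p) = val p"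
proof -
  assume p: "p \<in> arcs P"
  have "(SOME q. q \<in> cls p) \<in> cls p" by (rule someI[of _ p]) (use E_refl[OF p] in simp)
  then have "(p, SOME q. q \<in> cls p) \<in> E" by simp
  then have "val p = val (SOME q. q \<in> cls p)" by (rule E_val)
  then show ?thesis using p by (simp add: s_def X_sets)
qed

lemma s_darts: "d \<in> darts P \<Longrightarrow> on_darts s {d} = dval d"
  by (simp add: s_def X_sets)

lemma s_verts: "u \<in> verts P \<Longrightarrow> on_verts s {u} = vval u"
  by (simp add: s_def X_sets)

lemma dval_val: "d \<in> darts P \<Longrightarrow> dval d = val d"
  using kD(10) by (simp add: P_darts dval_def)

lemma s_hom: "s \<in> dhom X G'"
  unfolding dhom_def mem_Collect_eq
proof (intro conjI ballI)
  have ext: "on_arcs s \<in> extensional (arcs X)" "on_darts s \<in> extensional (darts X)"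
    "on_verts s \<in> extensional (verts X)" unfolding s_def by simp_all
  have dv: "dval d \<in> darts G'" if "d \<in> darts P" for d
    using that dhomD(5)[OF kD(4)] by (simp add: P_darts dval_def)
  have vv: "vval d \<in> verts G'" if "d \<in> verts P" for d
    using that dhomD(6)[OF kD(4)] by (simp add: P_verts vval_def)
  show "on_arcs s \<in> arcs X \<rightarrow>\<^sub>E arcs G'"
    using ext(1) s_arcs val_arcs by (auto simp: PiE_iff X_sets)
  show "on_darts s \<in> darts X \<rightarrow>\<^sub>E darts G'"
    using ext(2) s_darts dv by (auto simp: PiE_iff X_sets)
  show "on_verts s \<in> verts X \<rightarrow>\<^sub>E verts G'"
    using ext(3) s_verts vv by (auto simp: PiE_iff X_sets)
  show "on_arcs s (dag X c) = dag G' (on_arcs s c)" if "c \<in> arcs X" for c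
  proof -
    obtain p where p: "p \<in> arcs P" "c = cls p" using \<open>c \<in> arcs X\<close> unfolding X_sets by blast
    then show ?thesis using s_arcs[OF p(1)] X_dag[OF p(1)] s_arcs[OF P_dag_arcs[OF p(1)]] val_dag[OF p(1)]
      by simp
  qed
  show "on_arcs s (inc X c) = inc G' (on_darts s c)" if "c \<in> darts X" for c
  proof -
    obtain d where d: "d \<in> darts P" "c = {d}" using \<open>c \<in> darts X\<close> unfolding X_sets by blast
    then show ?thesis
      using X_inc[OF d(1)] s_arcs[OF P_darts_arcs[OF d(1)]] s_darts[OF d(1)] dval_val[OF d(1)]
        G'D(6)[OF dv[OF d(1)]] by simp
  qed
  show "on_verts s (att X c) = att G' (on_darts s c)" if "c \<in> darts X" for c
  proof -
    obtain d where d: "d \<in> darts P" "c = {d}" using \<open>c \<in> darts X\<close> unfolding X_sets by blast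
    have "vval (att P d) = att G' (dval d)"
      using dhomD(9)[OF kD(4)] d(1) P_att[OF d(1)] by (simp add: P_darts vval_def dval_def)
    then show ?thesis
      using d X_att[OF d(1)] s_verts[OF P_att_verts[OF d(1)]] s_darts[OF d(1)] by simp
  qed
qed

lemma substitution_map_eq: "substitution_map G G' \<phi> = s"
  unfolding substitution_map_def
proof (rule the_equality)
  let ?pr = "dcoeq_proj (glue_edges G) P (glue1 G \<phi>) (glue2 G \<phi>)"
  let ?ct = "dcotuple (verts G) (\<lambda>v. K v) (\<lambda>v. k v)"
  have pr: "p \<in> arcs P \<Longrightarrow> on_arcs ?pr p = cls p" "d \<in> darts P \<Longrightarrow> on_darts ?pr d = {d}"
    "u \<in> verts P \<Longrightarrow> on_verts ?pr u = {u}" for p d u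
    by (auto simp: dcoeq_proj_def coeq_discrete)
  have ct: "p \<in> arcs P \<Longrightarrow> on_arcs ?ct p = val p" "d \<in> darts P \<Longrightarrow> on_darts ?ct d = dval d"
    "u \<in> verts P \<Longrightarrow> on_verts ?ct u = vval u" for p d u
    by (cases p, simp add: dcotuple_def P_arcs) (cases d, simp add: dcotuple_def P_darts dval_def,
        cases u, simp add: dcotuple_def P_verts vval_def)
  have ext: "on_arcs ?ct \<in> extensional (arcs P)" "on_darts ?ct \<in> extensional (darts P)"
    "on_verts ?ct \<in> extensional (verts P)"
    unfolding dcotuple_def pieces_def dcoprod_def by simp_all
  have "dcomp P s ?pr = ?ct"
  proof (rule dmap.equality)
    show "on_arcs (dcomp P s ?pr) = on_arcs ?ct"
      by (rule extensionalityI[OF _ ext(1)]) (simp_all add: dcomp_def compose_def pr ct s_arcs)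
    show "on_darts (dcomp P s ?pr) = on_darts ?ct"
      by (rule extensionalityI[OF _ ext(2)]) (simp_all add: dcomp_def compose_def pr ct s_darts)
    show "on_verts (dcomp P s ?pr) = on_verts ?ct"
      by (rule extensionalityI[OF _ ext(3)]) (simp_all add: dcomp_def compose_def pr ct s_verts)
  qed simp
  then show "s \<in> dhom X G' \<and> dcomp P s ?pr = ?ct" using s_hom by blast
  fix h assume h: "h \<in> dhom X G' \<and> dcomp P h ?pr = ?ct"
  show "h = s"
  proof (rule dmap_eqI[OF _ s_hom])
    show "h \<in> dhom X G'" using h by blast
    show "on_arcs h c = on_arcs s c" if "c \<in> arcs X" for c
    proof -
      obtain p where p: "p \<in> arcs P" "c = cls p" using \<open>c \<in> arcs X\<close> unfolding X_sets by blast
      have "on_arcs (dcomp P h ?pr) p = val p" using h ct(1)[OF p(1)] by simp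
      then show ?thesis using p pr(1)[OF p(1)] s_arcs[OF p(1)] by simp
    qed
    show "on_darts h c = on_darts s c" if "c \<in> darts X" for c
    proof -
      obtain d where d: "d \<in> darts P" "c = {d}" using \<open>c \<in> darts X\<close> unfolding X_sets by blast
      have "on_darts (dcomp P h ?pr) d = dval d" using h ct(2)[OF d(1)] by simp
      then show ?thesis using d pr(2)[OF d(1)] s_darts[OF d(1)] by simp
    qed
    show "on_verts h c = on_verts s c" if "c \<in> verts X" for c
    proof -
      obtain d where d: "d \<in> verts P" "c = {d}" using \<open>c \<in> verts X\<close> unfolding X_sets by blast
      have "on_verts (dcomp P h ?pr) d = vval d" using h ct(3)[OF d(1)] by simp
      then show ?thesis using d pr(3)[OF d(1)] s_verts[OF d(1)] by simp
    qed
  qed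
qed

lemma vval_inj:
  assumes "u \<in> verts P" "w \<in> verts P" "vval u = vval w"
  shows "u = w"
proof -
  have u: "fst u \<in> verts G" "snd u \<in> verts (K (fst u))" and w: "fst w \<in> verts G" "snd w \<in> verts (K (fst w))"
    using assms by (auto simp: P_verts)
  have 1: "vval u \<in> emb_verts (on1 \<phi> (fst u))" using u(2) by (simp add: emb_verts_def vval_def)
  have 2: "vval u \<in> emb_verts (on1 \<phi> (fst w))" using w(2) assms(3) by (simp add: emb_verts_def vval_def)
  have f: "fst u = fst w" by (rule gmD(11)[OF u(1) w(1) 1 2])
  have "snd u = snd w"
    by (rule inj_onD[OF kD(7)[OF u(1)] _ u(2)]) (use f w(2) assms(3) in \<open>simp_all add: vval_def\<close>)
  then show ?thesis using f by (simp add: prod_eq_iff)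
qed

lemma dval_inj:
  assumes "d \<in> darts P" "e \<in> darts P" "dval d = dval e"
  shows "d = e"
proof -
  have d: "fst d \<in> verts G" "snd d \<in> darts (K (fst d))" and e: "fst e \<in> verts G" "snd e \<in> darts (K (fst e))"
    using assms by (auto simp: P_darts)
  have "vval (att P d) = vval (att P e)"
    using dhomD(9)[OF kD(4)[OF d(1)] d(2)] dhomD(9)[OF kD(4)[OF e(1)] e(2)] assms
    by (simp add: P_att vval_def dval_def)
  then have "att P d = att P e" by (rule vval_inj[OF P_att_verts[OF assms(1)] P_att_verts[OF assms(2)]])
  then have f: "fst d = fst e" using P_att assms by simp
  have "snd d = snd e"
    by (rule inj_onD[OF presentation.darts_inj[OF kD(3)[OF d(1)]] _ d(2)])
      (use f e(2) assms(3) in \<open>simp_all add: dval_def\<close>)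
  then show ?thesis using f by (simp add: prod_eq_iff)
qed

lemma X_linked: "linked X"
  unfolding linked_def
proof (intro conjI allI impI)
  fix A :: "('v \<times> 'a) set \<Rightarrow> bool" and V :: "('v \<times> 'v) set \<Rightarrow> bool"
  assume A: "\<forall>a\<in>arcs X. A (dag X a) = A a" and V: "\<forall>d\<in>darts X. V (att X d) = A (inc X d)"
  have A': "A (cls (dag P p)) = A (cls p)" if "p \<in> arcs P" for p
    using bspec[OF A, of "cls p"] X_dag[OF that] that by (simp add: X_sets)
  have V': "V {att P d} = A (cls d)" if "d \<in> darts P" for d
    using bspec[OF V, of "{d}"] X_att[OF that] X_inc[OF that] that by (simp add: X_sets)
  have piece: "\<exists>b. (\<forall>a\<in>arcs (K v). A (cls (v, a)) = b) \<and> (\<forall>u\<in>verts (K v). V {(v, u)} = b)"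
    if v: "v \<in> verts G" for v
  proof (rule linkedD[OF kD(5)[OF v]])
    show "A (cls (v, dag (K v) a)) = A (cls (v, a))" if a: "a \<in> arcs (K v)" for a
    proof -
      have p: "(v, a) \<in> arcs P" using v a by (simp add: P_arcs)
      have "dag P (v, a) = (v, dag (K v) a)" using P_dag[OF p] by simp
      then show ?thesis using A'[OF p] by simp
    qed
    show "V {(v, att (K v) d)} = A (cls (v, inc (K v) d))" if d: "d \<in> darts (K v)" for d
    proof -
      have p: "(v, d) \<in> darts P" using v d by (simp add: P_darts)
      have "att P (v, d) = (v, att (K v) d)" using P_att[OF p] by simp
      then show ?thesis using V'[OF p] KD(6)[OF v d] by simp
    qed
  qed
  \<comment> \<open>\<open>q v\<close> is the constant value on the piece \<open>K v\<close>; it extends to a compatible pair on \<open>G\<close>\<close>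
  define q where "q v = (SOME b. (\<forall>a\<in>arcs (K v). A (cls (v, a)) = b) \<and> (\<forall>u\<in>verts (K v). V {(v, u)} = b))" for v
  have q: "(\<forall>a\<in>arcs (K v). A (cls (v, a)) = q v) \<and> (\<forall>u\<in>verts (K v). V {(v, u)} = q v)"
    if "v \<in> verts G" for v
    unfolding q_def by (rule someI_ex[OF piece[OF that]])
  have qb: "A (cls (beta x)) = q (att G x)" if x: "x \<in> darts G" for x
    using q[OF GD(7)[OF x]] beta(1,4)[OF x] by (cases "beta x") (simp add: P_arcs)
  define r where "r a = (if a \<in> darts G then q (att G a) else q (att G (dag G a)))" for a
  have "r (dag G a) = r a" if a: "a \<in> arcs G" for a
  proof (cases "a \<in> darts G")
    case True
    show ?thesis
    proof (cases "dag G a \<in> darts G")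
      case True': True
      have "cls (beta a) = cls (dag P (beta (dag G a)))"
        by (rule cls_E) (use nxtI[OF True True'] nxt_E in blast)
      then have "A (cls (beta a)) = A (cls (beta (dag G a)))" using A'[OF beta(1)[OF True']] by simp
      then show ?thesis using qb True True' by (simp add: r_def)
    next
      case False
      then show ?thesis using True GD(3)[OF a] by (simp add: r_def)
    qed
  next
    case False
    then show ?thesis using flip_G[OF a False] by (simp add: r_def)
  qed
  moreover have "q (att G d) = r (inc G d)" if "d \<in> darts G" for d
    using that GD(6) by (simp add: r_def)
  ultimately have "\<exists>b. (\<forall>a\<in>arcs G. r a = b) \<and> (\<forall>v\<in>verts G. q v = b)"
    by (rule linkedD[OF gmD(2)])
  then obtain b where "\<forall>v\<in>verts G. q v = b" by blast
  then show "\<exists>b. (\<forall>a\<in>arcs X. A a = b) \<and> (\<forall>v\<in>verts X. V v = b)"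
    using q by (intro exI[of _ b]) (auto simp: X_sets P_arcs P_verts)
next
  obtain v where v: "v \<in> verts G" using verts_ne by blast
  have "arcs (K v) \<noteq> {} \<or> verts (K v) \<noteq> {}"
    using linked_nonempty[OF kD(5)[OF v]] KD(5)[OF v] unfolding nonempty_def by blast
  then have "arcs P \<noteq> {} \<or> verts P \<noteq> {}"
  proof
    assume "arcs (K v) \<noteq> {}"
    then obtain a where "(v, a) \<in> arcs P" using v by (auto simp: P_arcs)
    then show ?thesis by blast
  next
    assume "verts (K v) \<noteq> {}"
    then obtain u where "(v, u) \<in> verts P" using v by (auto simp: P_verts)
    then show ?thesis by blast
  qed
  then show "nonempty X" unfolding nonempty_def X_sets by simp
qed

lemma X_presentation: "presentation X G' s"
proof (rule presentation.intro)
  show "diagram X" "linked X" "is_graph G'" "linked G'" by (fact X_diagram X_linked gmD)+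
  show "inj_on (inc X) (darts X)"
  proof (rule inj_onI)
    fix c c' assume "c \<in> darts X" "c' \<in> darts X" and eq: "inc X c = inc X c'"
    then obtain d d' where d: "d \<in> darts P" "c = {d}" "d' \<in> darts P" "c' = {d'}" unfolding X_sets by blast
    then have "cls d = cls d'" using eq X_inc by simp
    then have "(d, d') \<in> E" using cls_eq P_darts_arcs d by blast
    then have "d = d'" using terminal_unique[of d d'] d by (simp add: terminal_def)
    then show "c = c'" using d by simp
  qed
  show "dag X (dag X a) = a" if "a \<in> arcs X" for a
  proof -
    obtain p where p: "p \<in> arcs P" "a = cls p" using \<open>a \<in> arcs X\<close> unfolding X_sets by blast
    then show ?thesis using X_dag[OF p(1)] X_dag[OF P_dag_arcs[OF p(1)]] P_dag_dag[OF p(1)] by simp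
  qed
  show inv: "inj_on (on_verts s) (verts X)"
  proof (rule inj_onI)
    fix c c' assume "c \<in> verts X" "c' \<in> verts X" and eq: "on_verts s c = on_verts s c'"
    then obtain d d' where d: "d \<in> verts P" "c = {d}" "d' \<in> verts P" "c' = {d'}" unfolding X_sets by blast
    then have "d = d'" using vval_inj[of d d'] eq s_verts by simp
    then show "c = c'" using d by simp
  qed
  show "etale X G' s"
  proof (rule etaleI[OF X_diagram s_hom inv])
    show "inj_on (on_darts s) (darts X)"
    proof (rule inj_onI)
      fix c c' assume "c \<in> darts X" "c' \<in> darts X" and eq: "on_darts s c = on_darts s c'"
      then obtain d d' where d: "d \<in> darts P" "c = {d}" "d' \<in> darts P" "c' = {d'}" unfolding X_sets by blast
      then have "d = d'" using dval_inj[of d d'] eq s_darts by simp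
      then show "c = c'" using d by simp
    qed
    fix e assume e: "e \<in> darts G'" "att G' e \<in> on_verts s ` verts X"
    then obtain u where u: "u \<in> verts P" "att G' e = vval u" unfolding X_sets using s_verts by auto
    have v: "fst u \<in> verts G" "snd u \<in> verts (K (fst u))" using u(1) by (auto simp: P_verts)
    have "e \<in> on_darts (k (fst u)) ` darts (K (fst u))"
      unfolding presentation.darts_image[OF kD(3)[OF v(1)]] using e(1) u(2) v(2) by (simp add: vval_def)
    then obtain d where d: "d \<in> darts (K (fst u))" "e = on_darts (k (fst u)) d" by blast
    have p: "(fst u, d) \<in> darts P" using d(1) v(1) by (simp add: P_darts)
    show "e \<in> on_darts s ` darts X"
      by (rule rev_image_eqI[of "{(fst u, d)}"]) (use p s_darts[OF p] d(2) in \<open>simp_all add: X_sets dval_def\<close>)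
  qed
qed

text \<open>
  Every class contains exactly one terminal arc, so the boundary of the substitution corresponds
  to the boundary of \<open>G\<close>.
\<close>

lemma X_loose: "loose X = (\<lambda>x. cls (beta x)) ` {x\<in>darts G. dag G x \<in> bdry G}"
proof (intro equalityI subsetI)
  have "inc X ` darts X = cls ` darts P"
    unfolding X_sets image_image by (intro image_cong refl X_inc)
  then have dc: "loose X = cls ` arcs P - cls ` darts P" unfolding loose_def X_arcs by simp
  {
    fix c assume c: "c \<in> loose X"
    then obtain p where p: "p \<in> arcs P" "c = cls p" and nd: "c \<notin> cls ` darts P"
      unfolding dc by blast
    obtain q where q: "(p, q) \<in> nxt\<^sup>*" "terminal q" using reaches_terminal[OF p(1)] by blast
    have "(p, q) \<in> E"
      using q(1)
    proof (induction rule: rtrancl_induct)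
      case base
      show ?case by (rule E_refl[OF p(1)])
    next
      case (step y z)
      then show ?case using E_trans nxt_E by blast
    qed
    then have "c = cls q" using cls_E p(2) by simp
    then have "q \<notin> darts P" using nd by blast
    then show "c \<in> (\<lambda>x. cls (beta x)) ` {x\<in>darts G. dag G x \<in> bdry G}"
      using q(2) \<open>c = cls q\<close> by (auto simp: terminal_def)
  next
    fix c assume "c \<in> (\<lambda>x. cls (beta x)) ` {x\<in>darts G. dag G x \<in> bdry G}"
    then obtain x where x: "x \<in> darts G" "dag G x \<in> bdry G" "c = cls (beta x)" by blast
    have "c \<notin> cls ` darts P"
    proof
      assume "c \<in> cls ` darts P"
      then obtain d where d: "d \<in> darts P" "cls (beta x) = cls d" using x(3) by blast
      then have "(beta x, d) \<in> E" using cls_eq beta(1)[OF x(1)] P_darts_arcs by simp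
      then have "beta x = d"
        using terminal_unique[of "beta x" d] x(1,2) d(1) by (auto simp: terminal_def)
      then show False using beta(2)[OF x(1)] d(1) by simp
    qed
    then show "c \<in> loose X" using x(3) beta(1)[OF x(1)] unfolding dc by blast
  }
qed

lemma beta_cls_inj:
  assumes "x \<in> darts G" "dag G x \<in> bdry G" "y \<in> darts G" "dag G y \<in> bdry G"
    "cls (beta x) = cls (beta y)"
  shows "x = y"
proof -
  have "(beta x, beta y) \<in> E" using assms(5) cls_eq beta(1) assms(1,3) by simp
  then have "beta x = beta y"
    using terminal_unique[of "beta x" "beta y"] assms(1-4) by (auto simp: terminal_def)
  then show ?thesis by (rule beta_inj[OF assms(1,3)])
qed

lemma s_verts_image: "on_verts s ` verts X = (\<Union>v\<in>verts G. emb_verts (on1 \<phi> v))"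
proof -
  have "on_verts s ` verts X = vval ` verts P"
    unfolding X_sets image_image by (intro image_cong refl s_verts)
  also have "\<dots> = (\<Union>v\<in>verts G. emb_verts (on1 \<phi> v))"
  proof (intro equalityI subsetI)
    fix x assume "x \<in> vval ` verts P"
    then obtain u where u: "u \<in> verts P" "x = vval u" by blast
    then show "x \<in> (\<Union>v\<in>verts G. emb_verts (on1 \<phi> v))"
      by (intro UN_I[of "fst u"]) (simp_all add: P_verts vval_def emb_verts_def)
  next
    fix x assume "x \<in> (\<Union>v\<in>verts G. emb_verts (on1 \<phi> v))"
    then obtain v u where "v \<in> verts G" "u \<in> verts (K v)" "x = on_verts (k v) u"
      unfolding emb_verts_def by blast
    then show "x \<in> vval ` verts P"
      by (intro rev_image_eqI[of "(v, u)"]) (simp_all add: P_verts vval_def)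
  qed
  finally show ?thesis .
qed

lemma gimage_eq: "gimage G G' \<phi> = emb_class G' X s"
proof -
  have "presentation G G (did G)"
    using graph_did_embedding[OF gmD(1,2)] embeddingD(3) by blast
  then have "\<not> isomorphic G exc_edge" using presentation.exc_edge_iff verts_ne by blast
  then show ?thesis by (simp add: gimage_def substitution_map_eq)
qed

text \<open>
  A graphical map factors through its image. The arc \<open>dag G x\<close>, for a dart
  \<open>x\<close>, is sent to the class of \<open>beta x\<close>; this determines the lift,
  because \<open>G\<close> is not an exceptional edge, and the pieces become embeddings into the
  image. On boundaries it is bijective by \<open>X_loose\<close>.
\<close>

lemma lift:
  assumes inf: "infinite (UNIV :: 'a set)"
  shows "\<exists>(H :: ('a, 'v) graph) f l. embedding H G' f \<and> gimage G G' \<phi> = emb_class G' H f \<and>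
    graphical_map G H l \<and> bij_betw (on0 l) (bdry G) (bdry H) \<and>
    (\<forall>a\<in>arcs G. on_arcs f (on0 l a) = on0 \<phi> a) \<and>
    (\<forall>v\<in>verts G. on_verts f ` emb_verts (on1 l v) = emb_verts (on1 \<phi> v)) \<and>
    on_verts f ` verts H = (\<Union>v\<in>verts G. emb_verts (on1 \<phi> v))"
proof -
  obtain H :: "('a, 'v) graph" and f where e: "embedding H G' f"
    and fV: "on_verts f ` verts H = on_verts s ` verts X"
    and fB: "on_arcs f ` bdry H = on_arcs s ` loose X"
    using presentation_transport[OF inf X_presentation] by (elim exE conjE) (rule that)
  note F = embeddingD[OF e]
  have im: "gimage G G' \<phi> = emb_class G' H f"
    unfolding gimage_eq emb_class_eq[OF X_presentation] embedding_class[OF e] fV fB ..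
  have fB': "on_arcs s ` loose X = on_arcs f ` loose H" using fB loose_graph[OF F(1)] by simp
  obtain z where z: "diso X H z" and sz: "s = dcomp X f z"
    using presentation_unique[OF X_presentation F(3) fV[symmetric] fB'] by blast
  note z' = z[unfolded diso_iff_bij[OF X_diagram]]
  have zh: "z \<in> dhom X H" using z' by blast
  have clsX: "cls p \<in> arcs X" if "p \<in> arcs P" for p using that by (simp add: X_sets)
  define za where "za p = on_arcs z (cls p)" for p
  have za: "za p \<in> arcs H" "on_arcs f (za p) = val p" "za (dag P p) = dag H (za p)"
    if p: "p \<in> arcs P" for p
  proof -
    show "za p \<in> arcs H" using dhomD(4)[OF zh clsX[OF p]] by (simp add: za_def)
    show "on_arcs f (za p) = val p"
      using s_arcs[OF p] clsX[OF p] by (simp add: sz za_def)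
    show "za (dag P p) = dag H (za p)"
      using dhomD(7)[OF zh clsX[OF p]] X_dag[OF p] by (simp add: za_def)
  qed
  have za_E: "za p = za q" if "(p, q) \<in> E" for p q using cls_E[OF that] by (simp add: za_def)
  define q :: "'v \<Rightarrow> ('a, 'a, 'v, 'a, 'a, 'v) dmap" where "q v =
    \<lparr>on_arcs = (\<lambda>a\<in>arcs (K v). za (v, a)),
     on_darts = (\<lambda>d\<in>darts (K v). on_darts z {(v, d)}),
     on_verts = (\<lambda>u\<in>verts (K v). on_verts z {(v, u)})\<rparr>" for v
  have qh: "q v \<in> dhom (K v) H" if v: "v \<in> verts G" for v
    unfolding dhom_def mem_Collect_eq
  proof (intro conjI ballI)
    have a: "(v, a) \<in> arcs P" if "a \<in> arcs (K v)" for a using that v by (simp add: P_arcs)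
    have d: "(v, a) \<in> darts P" if "a \<in> darts (K v)" for a using that v by (simp add: P_darts)
    have u: "(v, a) \<in> verts P" if "a \<in> verts (K v)" for a using that v by (simp add: P_verts)
    have dX: "{(v, a)} \<in> darts X" if "a \<in> darts (K v)" for a using d[OF that] by (simp add: X_sets)
    have uX: "{(v, a)} \<in> verts X" if "a \<in> verts (K v)" for a using u[OF that] by (simp add: X_sets)
    show "on_arcs (q v) \<in> arcs (K v) \<rightarrow>\<^sub>E arcs H" using za(1)[OF a] by (auto simp: q_def)
    show "on_darts (q v) \<in> darts (K v) \<rightarrow>\<^sub>E darts H"
      using dhomD(5)[OF zh dX] by (auto simp: q_def)
    show "on_verts (q v) \<in> verts (K v) \<rightarrow>\<^sub>E verts H"
      using dhomD(6)[OF zh uX] by (auto simp: q_def)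
    show "on_arcs (q v) (dag (K v) x) = dag H (on_arcs (q v) x)" if x: "x \<in> arcs (K v)" for x
      using za(3)[OF a[OF x]] P_dag[OF a[OF x]] x KD(2)[OF v x] by (simp add: q_def)
    show "on_arcs (q v) (inc (K v) x) = inc H (on_darts (q v) x)" if x: "x \<in> darts (K v)" for x
      using dhomD(8)[OF zh dX[OF x]] X_inc[OF d[OF x]] KD(5,6)[OF v x] x by (simp add: q_def za_def)
    show "on_verts (q v) (att (K v) x) = att H (on_darts (q v) x)" if x: "x \<in> darts (K v)" for x
      using dhomD(9)[OF zh dX[OF x]] X_att[OF d[OF x]] P_att[OF d[OF x]] KD(7)[OF v x] x
      by (simp add: q_def)
  qed
  have fq: "dcomp (K v) f (q v) = k v" if v: "v \<in> verts G" for v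
  proof (rule dmap_eqI[OF dcomp_hom[OF KD(1)[OF v] qh[OF v] F(4)] kD(4)[OF v]])
    show "on_arcs (dcomp (K v) f (q v)) a = on_arcs (k v) a" if "a \<in> arcs (K v)" for a
      using za(2)[of "(v, a)"] that v by (simp add: q_def P_arcs)
    show "on_darts (dcomp (K v) f (q v)) d = on_darts (k v) d" if d: "d \<in> darts (K v)" for d
    proof -
      have p: "(v, d) \<in> darts P" using d v by (simp add: P_darts)
      have "on_darts (dcomp X f z) {(v, d)} = dval (v, d)" using s_darts[OF p] sz by simp
      then show ?thesis using d p by (simp add: q_def dval_def X_sets)
    qed
    show "on_verts (dcomp (K v) f (q v)) d = on_verts (k v) d" if d: "d \<in> verts (K v)" for d
    proof -
      have p: "(v, d) \<in> verts P" using d v by (simp add: P_verts)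
      have "on_verts (dcomp X f z) {(v, d)} = vval (v, d)" using s_verts[OF p] sz by simp
      then show ?thesis using d p by (simp add: q_def vval_def X_sets)
    qed
  qed
  have qe: "embedding (K v) H (q v)" if v: "v \<in> verts G" for v
    by (rule embedding_cancel[OF e _ qh[OF v]]) (simp add: fq[OF v] gmD(10)[OF v])
  \<comment> \<open>both cases apply to an inner arc of \<open>G\<close>, with the same result, since \<open>nxt\<close> is contained in \<open>E\<close>\<close>
  define l0 where "l0 a = (if a \<in> darts G then za (dag P (beta a)) else za (beta (dag G a)))" for a
  have l0_beta: "l0 (dag G x) = za (beta x)" if x: "x \<in> darts G" for x
  proof (cases "dag G x \<in> darts G")
    case True
    then have "(beta x, dag P (beta (dag G x))) \<in> E" using nxtI[OF x True] nxt_E by blast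
    then show ?thesis using za_E True by (simp add: l0_def)
  next
    case False
    then show ?thesis using GD(3)[OF GD(5)[OF x]] by (simp add: l0_def)
  qed
  have l0_dart: "l0 x = dag H (za (beta x))" if x: "x \<in> darts G" for x
    using x za(3)[OF beta(1)[OF x]] by (simp add: l0_def)
  have arc_cases: "a \<in> darts G \<or> (\<exists>x\<in>darts G. a = dag G x)" if "a \<in> arcs G" for a
    using flip_G[OF that] GD(3)[OF that] by metis
  have l0A: "l0 a \<in> arcs H" if a: "a \<in> arcs G" for a
    using arc_cases[OF a] l0_dart l0_beta za(1)[OF beta(1)] GD(2) graphD(2)[OF F(1)] by auto
  have l0dag: "l0 (dag G a) = dag H (l0 a)" if a: "a \<in> arcs G" for a
    using arc_cases[OF a]
  proof
    assume x: "a \<in> darts G"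
    then show ?thesis using l0_dart[OF x] l0_beta[OF x] graphD(3)[OF F(1) za(1)[OF beta(1)[OF x]]] by simp
  next
    assume "\<exists>x\<in>darts G. a = dag G x"
    then obtain x where x: "x \<in> darts G" "a = dag G x" by blast
    then show ?thesis using l0_dart[OF x(1)] l0_beta[OF x(1)] GD(3)[OF GD(5)[OF x(1)]] by simp
  qed
  have fl0: "on_arcs f (l0 a) = on0 \<phi> a" if a: "a \<in> arcs G" for a
    using arc_cases[OF a]
  proof
    assume x: "a \<in> darts G"
    have "on_arcs f (dag H (za (beta a))) = dag G' (on0 \<phi> (dag G a))"
      using dhomD(7)[OF F(4) za(1)[OF beta(1)[OF x]]] za(2)[OF beta(1)[OF x]] beta(3)[OF x] by simp
    also have "\<dots> = on0 \<phi> a" using gmD(9)[OF GD(2)[OF a]] GD(3)[OF a] by simp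
    finally show ?thesis using l0_dart[OF x] by simp
  next
    assume "\<exists>x\<in>darts G. a = dag G x"
    then obtain x where x: "x \<in> darts G" "a = dag G x" by blast
    then show ?thesis using l0_beta[OF x(1)] za(2)[OF beta(1)[OF x(1)]] beta(3)[OF x(1)] by simp
  qed
  define l where "l = \<lparr>on0 = restrict l0 (arcs G), on1 = (\<lambda>v\<in>verts G. emb_class H (K v) (q v))\<rparr>"
  have l_arcs: "on0 l a = l0 a" if "a \<in> arcs G" for a using that by (simp add: l_def)
  have l1: "on1 l v = emb_class H (K v) (q v)" if "v \<in> verts G" for v using that by (simp add: l_def)
  have lv: "emb_verts (on1 l v) = on_verts (q v) ` verts (K v)"
    "emb_bdry (on1 l v) = on_arcs (q v) ` bdry (K v)" if v: "v \<in> verts G" for v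
    using embedding_Emb(2,3)[OF inf qe[OF v]] l1[OF v] by auto
  have flv: "on_verts f ` emb_verts (on1 l v) = emb_verts (on1 \<phi> v)" if v: "v \<in> verts G" for v
  proof -
    have "on_verts (k v) ` verts (K v) = on_verts (dcomp (K v) f (q v)) ` verts (K v)"
      using fq[OF v] by simp
    also have "\<dots> = on_verts f ` on_verts (q v) ` verts (K v)"
      unfolding image_image by (intro image_cong refl) simp
    finally show ?thesis using lv(1)[OF v] by (simp add: emb_verts_def)
  qed
  have nbA: "a \<in> darts G" "att G a = v" "dag G a \<in> arcs G" if "a \<in> nb G v" for a v
    using that GD(2,5) by (auto simp: nb_def)
  have lg: "graphical_map G H l"
  proof (rule graphical_mapI[OF gmD(1,2) F(1,5)])
    show "on0 l \<in> arcs G \<rightarrow>\<^sub>E arcs H" using l0A by (auto simp: l_def)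
    show "on1 l \<in> verts G \<rightarrow>\<^sub>E Emb H" using embedding_Emb(1)[OF inf qe] by (auto simp: l_def)
    show "on0 l (dag G a) = dag H (on0 l a)" if "a \<in> arcs G" for a
      using l_arcs[OF that] l_arcs[OF GD(2)[OF that]] l0dag[OF that] by simp
    show "v = w" if vw: "v \<in> verts G" "w \<in> verts G" "x \<in> emb_verts (on1 l v)" "x \<in> emb_verts (on1 l w)"
      for v w x
    proof (rule gmD(11)[OF vw(1,2)])
      show "on_verts f x \<in> emb_verts (on1 \<phi> v)" using imageI[OF vw(3)] flv[OF vw(1)] by metis
      show "on_verts f x \<in> emb_verts (on1 \<phi> w)" using imageI[OF vw(4)] flv[OF vw(2)] by metis
    qed
    show "bij_betw (\<lambda>a. on0 l (dag G a)) (nb G v) (emb_bdry (on1 l v))" if v: "v \<in> verts G" for v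
      unfolding bij_betw_def
    proof
      show "inj_on (\<lambda>a. on0 l (dag G a)) (nb G v)"
      proof (rule inj_onI)
        fix a b assume ab: "a \<in> nb G v" "b \<in> nb G v" "on0 l (dag G a) = on0 l (dag G b)"
        then have "on0 \<phi> (dag G a) = on0 \<phi> (dag G b)"
          using l_arcs[OF nbA(3)[OF ab(1)]] l_arcs[OF nbA(3)[OF ab(2)]]
            fl0[OF nbA(3)[OF ab(1)]] fl0[OF nbA(3)[OF ab(2)]] by simp
        then show "a = b" using gmD(12)[OF v] ab(1,2) by (simp add: bij_betw_def inj_on_def)
      qed
      show "(\<lambda>a. on0 l (dag G a)) ` nb G v = emb_bdry (on1 l v)"
        unfolding lv(2)[OF v]
      proof (intro equalityI subsetI)
        fix y assume "y \<in> (\<lambda>a. on0 l (dag G a)) ` nb G v"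
        then obtain a where a: "a \<in> nb G v" "y = on0 l (dag G a)" by blast
        note b = beta[OF nbA(1)[OF a(1)]]
        have "y = za (beta a)" using a(2) l_arcs[OF nbA(3)[OF a(1)]] l0_beta[OF nbA(1)[OF a(1)]] by simp
        moreover have "beta a = (v, snd (beta a))" using b(4) nbA(2)[OF a(1)] by (simp add: prod_eq_iff)
        moreover have "snd (beta a) \<in> bdry (K v)"
          using b(1,2,4) nbA(2)[OF a(1)] by (auto simp: P_arcs P_darts bdry_def)
        ultimately have "y = on_arcs (q v) (snd (beta a))" by (simp add: q_def bdry_def)
        then show "y \<in> on_arcs (q v) ` bdry (K v)" using \<open>snd (beta a) \<in> bdry (K v)\<close> by blast
      next
        fix y assume "y \<in> on_arcs (q v) ` bdry (K v)"
        then obtain b where b: "b \<in> bdry (K v)" "y = on_arcs (q v) b" by blast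
        then have y: "y = za (v, b)" by (simp add: q_def bdry_def)
        have "(v, b) \<in> arcs P" "(v, b) \<notin> darts P"
          using b(1) v by (auto simp: P_arcs P_darts bdry_def)
        then obtain x where x: "x \<in> darts G" "(v, b) = beta x" using beta_surj by blast
        have "x \<in> nb G v" using x beta(4)[OF x(1)] by (auto simp: nb_def dest: sym)
        moreover have "y = on0 l (dag G x)"
          using y x l_arcs[OF GD(2)[OF GD(5)[OF x(1)]]] l0_beta[OF x(1)] by simp
        ultimately show "y \<in> (\<lambda>a. on0 l (dag G a)) ` nb G v" by blast
      qed
    qed
    show "\<exists>v\<in>verts G. emb_verts (on1 l v) \<noteq> {}" if "bdry G = {}"
      using gmD(13)[OF that] flv by blast
  qed
  have lb: "on0 l b = za (beta (dag G b))" "dag G b \<in> darts G" "dag G (dag G b) = b"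
    if b: "b \<in> bdry G" for b
  proof -
    have bA: "b \<in> arcs G" "b \<notin> darts G" using b by (auto simp: bdry_def)
    show d: "dag G b \<in> darts G" by (rule flip_G[OF bA])
    show "dag G (dag G b) = b" by (rule GD(3)[OF bA(1)])
    then show "on0 l b = za (beta (dag G b))" using l0_beta[OF d] l_arcs[OF bA(1)] by simp
  qed
  have "bij_betw (on0 l) (bdry G) (bdry H)"
    unfolding bij_betw_def
  proof
    show "inj_on (on0 l) (bdry G)"
    proof (rule inj_onI)
      fix b c assume bc: "b \<in> bdry G" "c \<in> bdry G" "on0 l b = on0 l c"
      then have "on_arcs z (cls (beta (dag G b))) = on_arcs z (cls (beta (dag G c)))"
        using lb(1)[OF bc(1)] lb(1)[OF bc(2)] by (simp add: za_def)
      moreover have "inj_on (on_arcs z) (arcs X)" using z' by (simp add: bij_betw_def)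
      ultimately have "cls (beta (dag G b)) = cls (beta (dag G c))"
        using clsX[OF beta(1)[OF lb(2)[OF bc(1)]]] clsX[OF beta(1)[OF lb(2)[OF bc(2)]]]
        by (simp add: inj_on_def)
      moreover have "dag G (dag G b) \<in> bdry G" "dag G (dag G c) \<in> bdry G"
        using lb(3)[OF bc(1)] lb(3)[OF bc(2)] bc(1,2) by simp_all
      ultimately have "dag G b = dag G c"
        using beta_cls_inj[OF lb(2)[OF bc(1)] _ lb(2)[OF bc(2)]] by blast
      then show "b = c" using lb(3)[OF bc(1)] lb(3)[OF bc(2)] by metis
    qed
    have "bdry H = on_arcs z ` loose X"
      using diso_loose(1)[OF X_diagram graphD(1)[OF F(1)] z] loose_graph[OF F(1)] by simp
    also have "\<dots> = (\<lambda>x. za (beta x)) ` {x\<in>darts G. dag G x \<in> bdry G}"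
      unfolding X_loose image_image za_def ..
    also have "\<dots> = on0 l ` bdry G"
    proof (intro equalityI subsetI)
      fix y assume "y \<in> (\<lambda>x. za (beta x)) ` {x\<in>darts G. dag G x \<in> bdry G}"
      then obtain x where x: "x \<in> darts G" "dag G x \<in> bdry G" "y = za (beta x)" by blast
      have "y = on0 l (dag G x)" using lb(1)[OF x(2)] x(3) GD(3)[OF GD(5)[OF x(1)]] by simp
      then show "y \<in> on0 l ` bdry G" using x(2) by blast
    next
      fix y assume "y \<in> on0 l ` bdry G"
      then obtain b where b: "b \<in> bdry G" "y = on0 l b" by blast
      then show "y \<in> (\<lambda>x. za (beta x)) ` {x\<in>darts G. dag G x \<in> bdry G}"
        using lb[OF b(1)] by (intro rev_image_eqI[of "dag G b"]) simp_all
    qed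
    finally show "on0 l ` bdry G = bdry H" ..
  qed
  moreover have "\<forall>a\<in>arcs G. on_arcs f (on0 l a) = on0 \<phi> a" using l_arcs fl0 by simp
  moreover have "\<forall>v\<in>verts G. on_verts f ` emb_verts (on1 l v) = emb_verts (on1 \<phi> v)" using flv by blast
  ultimately show ?thesis
    using e im lg fV s_verts_image by (intro exI[of _ H] exI[of _ f] exI[of _ l] conjI) simp_all
qed

end

lemma gimage_factorization:
  fixes G G' :: "('a, 'v) graph"
  assumes inf: "infinite (UNIV :: 'a set)" and gm: "graphical_map G G' \<phi>"
  shows "\<exists>(H :: ('a, 'v) graph) f l. embedding H G' f \<and> gimage G G' \<phi> = emb_class G' H f \<and>
    graphical_map G H l \<and> bij_betw (on0 l) (bdry G) (bdry H) \<and>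
    (\<forall>a\<in>arcs G. on_arcs f (on0 l a) = on0 \<phi> a) \<and>
    (\<forall>v\<in>verts G. on_verts f ` emb_verts (on1 l v) = emb_verts (on1 \<phi> v)) \<and>
    on_verts f ` verts H = (\<Union>v\<in>verts G. emb_verts (on1 \<phi> v))"
proof (cases "verts G = {}")
  case False
  then interpret gluing G G' \<phi> using gm by unfold_locales
  show ?thesis by (rule lift[OF inf])
next
  case True
  note D = graphical_mapD[OF gm]
  note ide = graph_did_embedding[OF D(1,2)]
  note idg = gmap_of_emb[OF inf ide]
  note pr = embeddingD(3)[OF ide]
  have nd: "darts G = {}" by (rule presentation.no_verts(1)[OF pr True])
  define f :: "('a, 'a, 'v, 'a, 'a, 'v) dmap" where
    "f = \<lparr>on_arcs = on0 \<phi>, on_darts = (\<lambda>_. undefined), on_verts = (\<lambda>_. undefined)\<rparr>"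
  have fh: "f \<in> dhom G G'" using D(5,9) by (simp add: dhom_def f_def nd True)
  have "etale G G' f"
    by (rule etaleI[OF graphD(1)[OF D(1)] fh]) (simp_all add: True nd)
  then have fe: "embedding G G' f"
    unfolding embedding_def using D(1-4) by (simp add: True graph_linked)
  have "isomorphic G exc_edge" using presentation.exc_edge_iff[OF pr] True by simp
  then have im: "gimage G G' \<phi> = emb_class G' G f" by (simp add: gimage_def f_def)
  have id: "on0 (gmap_of_emb G G (did G)) a = a" if "a \<in> arcs G" for a
    using that idg(2) by simp
  have "bij_betw (on0 (gmap_of_emb G G (did G))) (bdry G) (bdry G)"
    by (rule iffD1[OF bij_betw_cong bij_betw_id]) (simp add: id bdry_def)
  then show ?thesis
    using fe im idg(1) id True
    by (intro exI[of _ G] exI[of _ f] exI[of _ "gmap_of_emb G G (did G)"] conjI)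
      (simp_all add: f_def)
qed

lemma gimage:
  fixes G G' :: "('a, 'v) graph"
  assumes inf: "infinite (UNIV :: 'a set)" and gm: "graphical_map G G' \<phi>"
  shows "gimage G G' \<phi> \<in> Emb G'"
    "emb_verts (gimage G G' \<phi>) = (\<Union>v\<in>verts G. emb_verts (on1 \<phi> v))"
    "emb_bdry (gimage G G' \<phi>) = on0 \<phi> ` bdry G" "inj_on (on0 \<phi>) (bdry G)"
proof -
  obtain H :: "('a, 'v) graph" and f l where e: "embedding H G' f"
    and im: "gimage G G' \<phi> = emb_class G' H f"
    and l: "graphical_map G H l" "bij_betw (on0 l) (bdry G) (bdry H)"
    and fl: "\<forall>a\<in>arcs G. on_arcs f (on0 l a) = on0 \<phi> a"
    and V: "on_verts f ` verts H = (\<Union>v\<in>verts G. emb_verts (on1 \<phi> v))"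
    using gimage_factorization[OF inf gm] by (elim exE conjE) (rule that)
  have fl': "on_arcs f (on0 l a) = on0 \<phi> a" if "a \<in> bdry G" for a
    using fl that by (simp add: bdry_def)
  show "gimage G G' \<phi> \<in> Emb G'"
    "emb_verts (gimage G G' \<phi>) = (\<Union>v\<in>verts G. emb_verts (on1 \<phi> v))"
    using embedding_Emb(1,2)[OF inf e] im V by simp_all
  have "on_arcs f ` bdry H = on_arcs f ` on0 l ` bdry G" using l(2) by (simp add: bij_betw_def)
  also have "\<dots> = on0 \<phi> ` bdry G" unfolding image_image by (intro image_cong refl fl')
  finally show "emb_bdry (gimage G G' \<phi>) = on0 \<phi> ` bdry G" using embedding_Emb(3)[OF inf e] im by simp
  show "inj_on (on0 \<phi>) (bdry G)"
  proof (rule inj_onI)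
    fix a b assume ab: "a \<in> bdry G" "b \<in> bdry G" "on0 \<phi> a = on0 \<phi> b"
    then have "on_arcs f (on0 l a) = on_arcs f (on0 l b)" using fl' by simp
    then have "on0 l a = on0 l b"
      by (rule inj_onD[OF embeddingD(9)[OF e]]) (use ab l(2) in \<open>auto simp: bij_betw_def\<close>)
    then show "a = b" using l(2) ab(1,2) by (simp add: bij_betw_def inj_on_def)
  qed
qed

section \<open>Composition of graphical maps\<close>

lemma emb_verts_sub: "c \<in> Emb G \<Longrightarrow> emb_verts c \<subseteq> verts G"
  using dhomD(6)[OF embeddingD(4)[OF Emb_rep(1)]] by (auto simp: emb_verts_def)

text \<open>
  The vertex set of a value of a composite is the union of the corresponding vertex sets of the
  second map; together with the action on arcs this describes the composite completely, by
  \<open>graphical_map_eqI\<close>.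
\<close>

lemma gcomp_graphical:
  fixes G H L :: "('a, 'v) graph"
  assumes inf: "infinite (UNIV :: 'a set)"
    and p: "graphical_map G H \<phi>" and q: "graphical_map H L \<psi>"
  shows "graphical_map G L (gcomp G L \<psi> \<phi>)"
    "\<And>a. a \<in> arcs G \<Longrightarrow> on0 (gcomp G L \<psi> \<phi>) a = on0 \<psi> (on0 \<phi> a)"
    "\<And>v. v \<in> verts G \<Longrightarrow> emb_verts (on1 (gcomp G L \<psi> \<phi>) v) =
      (\<Union>u\<in>emb_verts (on1 \<phi> v). emb_verts (on1 \<psi> u))"
proof -
  note D = graphical_mapD[OF p] note Q = graphical_mapD[OF q]
  let ?c = "gcomp G L \<psi> \<phi>"
  show o0: "on0 ?c a = on0 \<psi> (on0 \<phi> a)" if "a \<in> arcs G" for a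
    using that by (simp add: gcomp_def compose_def)
  let ?K = "\<lambda>v. emb_dom (on1 \<phi> v)" and ?k = "\<lambda>v. emb_map (on1 \<phi> v)"
  let ?r = "\<lambda>v. gmap_restrict (?K v) \<psi> (?k v)"
  have o1: "on1 ?c v = gimage (?K v) L (?r v)" if "v \<in> verts G" for v
    using that by (simp add: gcomp_def)
  have im: "on1 ?c v \<in> Emb L"
    "emb_verts (on1 ?c v) = (\<Union>u\<in>emb_verts (on1 \<phi> v). emb_verts (on1 \<psi> u))"
    "emb_bdry (on1 ?c v) = on0 \<psi> ` emb_bdry (on1 \<phi> v)"
    "inj_on (on0 \<psi>) (emb_bdry (on1 \<phi> v))" if v: "v \<in> verts G" for v
  proof -
    have gr: "graphical_map (?K v) L (?r v)" by (rule gmap_restrict_graphical[OF q D(10)[OF v]])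
    note I = gimage[OF inf gr]
    show "on1 ?c v \<in> Emb L" using I(1) o1[OF v] by simp
    show "emb_verts (on1 ?c v) = (\<Union>u\<in>emb_verts (on1 \<phi> v). emb_verts (on1 \<psi> u))"
      using I(2) o1[OF v] by (simp add: emb_verts_def)
    have r0: "on0 (?r v) a = on0 \<psi> (on_arcs (?k v) a)" if "a \<in> bdry (?K v)" for a
      using that by (simp add: bdry_def)
    have "on0 (?r v) ` bdry (?K v) = on0 \<psi> ` emb_bdry (on1 \<phi> v)"
      unfolding emb_bdry_def image_image by (intro image_cong refl r0)
    then show "emb_bdry (on1 ?c v) = on0 \<psi> ` emb_bdry (on1 \<phi> v)" using I(3) o1[OF v] by simp
    show "inj_on (on0 \<psi>) (emb_bdry (on1 \<phi> v))"
    proof (rule inj_onI)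
      fix x y assume "x \<in> emb_bdry (on1 \<phi> v)" "y \<in> emb_bdry (on1 \<phi> v)" and eq: "on0 \<psi> x = on0 \<psi> y"
      then obtain a b where ab: "a \<in> bdry (?K v)" "x = on_arcs (?k v) a"
        "b \<in> bdry (?K v)" "y = on_arcs (?k v) b" unfolding emb_bdry_def by blast
      have "on0 (?r v) a = on0 (?r v) b" using r0[OF ab(1)] r0[OF ab(3)] eq ab by simp
      then have "a = b" by (rule inj_onD[OF I(4) _ ab(1,3)])
      then show "x = y" using ab by simp
    qed
  qed
  show "emb_verts (on1 ?c v) = (\<Union>u\<in>emb_verts (on1 \<phi> v). emb_verts (on1 \<psi> u))"
    if "v \<in> verts G" for v by (rule im(2)[OF that])
  show "graphical_map G L ?c"
  proof (rule graphical_mapI[OF D(1,2) Q(3,4)])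
    show "on0 ?c \<in> arcs G \<rightarrow>\<^sub>E arcs L" using D(7) Q(7) by (auto simp: gcomp_def compose_def)
    show "on1 ?c \<in> verts G \<rightarrow>\<^sub>E Emb L"
    proof (rule PiE_I)
      show "on1 ?c v \<in> Emb L" if "v \<in> verts G" for v by (rule im(1)[OF that])
      show "on1 ?c v = undefined" if "v \<notin> verts G" for v using that by (simp add: gcomp_def)
    qed
    show "on0 ?c (dag G a) = dag L (on0 ?c a)" if a: "a \<in> arcs G" for a
      using o0[OF a] o0[OF graphD(2)[OF D(1) a]] D(9)[OF a] Q(9)[OF D(7)[OF a]] by simp
    show "v = w" if vw: "v \<in> verts G" "w \<in> verts G" "x \<in> emb_verts (on1 ?c v)" "x \<in> emb_verts (on1 ?c w)"
      for v w x
    proof -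
      obtain u where u: "u \<in> emb_verts (on1 \<phi> v)" "x \<in> emb_verts (on1 \<psi> u)"
        using vw(3) im(2)[OF vw(1)] by blast
      obtain t where t: "t \<in> emb_verts (on1 \<phi> w)" "x \<in> emb_verts (on1 \<psi> t)"
        using vw(4) im(2)[OF vw(2)] by blast
      have "u \<in> verts H" "t \<in> verts H"
        using u(1) t(1) emb_verts_sub[OF D(8)[OF vw(1)]] emb_verts_sub[OF D(8)[OF vw(2)]] by auto
      then have "u = t" by (rule Q(11)[OF _ _ u(2) t(2)])
      then show ?thesis using D(11)[OF vw(1,2) u(1)] t(1) by simp
    qed
    show "bij_betw (\<lambda>a. on0 ?c (dag G a)) (nb G v) (emb_bdry (on1 ?c v))" if v: "v \<in> verts G" for v
    proof -
      have "bij_betw (on0 \<psi>) (emb_bdry (on1 \<phi> v)) (emb_bdry (on1 ?c v))"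
        using im(3,4)[OF v] by (simp add: bij_betw_def)
      from bij_betw_trans[OF D(12)[OF v] this]
      show ?thesis
      proof (rule iffD1[OF bij_betw_cong, rotated])
        show "(on0 \<psi> \<circ> (\<lambda>a. on0 \<phi> (dag G a))) a = on0 ?c (dag G a)" if "a \<in> nb G v" for a
          using that o0 graphD(2,5)[OF D(1)] by (simp add: nb_def)
      qed
    qed
    show "\<exists>v\<in>verts G. emb_verts (on1 ?c v) \<noteq> {}" if b: "bdry G = {}"
    proof -
      note I = gimage[OF inf p]
      let ?i = "gimage G H \<phi>"
      have e: "embedding (emb_dom ?i) H (emb_map ?i)" by (rule Emb_rep(1)[OF I(1)])
      have eb: "on_arcs (emb_map ?i) ` bdry (emb_dom ?i) = {}" using I(3) b by (simp add: emb_bdry_def)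
      have "on_arcs (emb_map ?i) ` bdry (emb_dom ?i) \<subseteq> bdry H" using eb by simp
      note on = embedding_onto[OF e this]
      have "bdry H = {}" by (rule on(3)) (use eb in simp)
      then obtain u where u: "u \<in> verts H" "emb_verts (on1 \<psi> u) \<noteq> {}" using Q(13) by blast
      have "u \<in> emb_verts ?i" using u(1) on(1) by (simp add: emb_verts_def)
      then obtain v where v: "v \<in> verts G" "u \<in> emb_verts (on1 \<phi> v)" unfolding I(2) by blast
      then show ?thesis using im(2)[OF v(1)] u(2) by (intro bexI[of _ v]) auto
    qed
  qed
qed

lemma gcomp_emb_left:
  fixes G H L :: "('a, 'v) graph"
  assumes inf: "infinite (UNIV :: 'a set)"
    and p: "graphical_map G H \<phi>" and f: "embedding H L f"
  shows "graphical_map G L (gcomp G L (gmap_of_emb H L f) \<phi>)"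
    "\<And>a. a \<in> arcs G \<Longrightarrow> on0 (gcomp G L (gmap_of_emb H L f) \<phi>) a = on_arcs f (on0 \<phi> a)"
    "\<And>v. v \<in> verts G \<Longrightarrow> emb_verts (on1 (gcomp G L (gmap_of_emb H L f) \<phi>) v) =
      on_verts f ` emb_verts (on1 \<phi> v)"
proof -
  note g = gmap_of_emb[OF inf f]
  note c = gcomp_graphical[OF inf p g(1)]
  show "graphical_map G L (gcomp G L (gmap_of_emb H L f) \<phi>)" by (rule c(1))
  show "on0 (gcomp G L (gmap_of_emb H L f) \<phi>) a = on_arcs f (on0 \<phi> a)" if "a \<in> arcs G" for a
    using c(2)[OF that] g(2) by simp
  show "emb_verts (on1 (gcomp G L (gmap_of_emb H L f) \<phi>) v) = on_verts f ` emb_verts (on1 \<phi> v)"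
    if v: "v \<in> verts G" for v
  proof -
    have "emb_verts (on1 \<phi> v) \<subseteq> verts H" by (rule emb_verts_sub[OF graphical_mapD(8)[OF p v]])
    then have "(\<Union>u\<in>emb_verts (on1 \<phi> v). emb_verts (on1 (gmap_of_emb H L f) u)) =
        (\<Union>u\<in>emb_verts (on1 \<phi> v). {on_verts f u})"
      by (intro SUP_cong refl g(3)) blast
    then show ?thesis using c(3)[OF v] by auto
  qed
qed

lemma gcomp_gmap_of_emb:
  fixes G H L :: "('a, 'v) graph"
  assumes inf: "infinite (UNIV :: 'a set)" and g: "embedding G H g" and f: "embedding H L f"
  shows "gcomp G L (gmap_of_emb H L f) (gmap_of_emb G H g) = gmap_of_emb G L (dcomp G f g)"
proof (rule graphical_map_eqI)
  note G = gmap_of_emb[OF inf g]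
  note c = gcomp_emb_left[OF inf G(1) f]
  note d = gmap_of_emb[OF inf embedding_dcomp[OF f g]]
  show "graphical_map G L (gcomp G L (gmap_of_emb H L f) (gmap_of_emb G H g))" by (rule c(1))
  show "graphical_map G L (gmap_of_emb G L (dcomp G f g))" by (rule d(1))
  show "on0 (gcomp G L (gmap_of_emb H L f) (gmap_of_emb G H g)) a = on0 (gmap_of_emb G L (dcomp G f g)) a"
    if "a \<in> arcs G" for a using that c(2) d(2) G(2) by simp
  show "emb_verts (on1 (gcomp G L (gmap_of_emb H L f) (gmap_of_emb G H g)) v) =
    emb_verts (on1 (gmap_of_emb G L (dcomp G f g)) v)" if "v \<in> verts G" for v
    using that c(3) d(3) G(3) by simp
qed

section \<open>Isomorphisms and lifts\<close>

text \<open>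
  A dart at a vertex whose value is not an edge is sent to a dart; a vertex whose value is an edge
  is bivalent (\<open>on0_edge\<close>).
\<close>

lemma on0_dart:
  assumes p: "graphical_map G G' \<phi>" and d: "d \<in> darts G"
    and ne: "emb_verts (on1 \<phi> (att G d)) \<noteq> {}"
  shows "on0 \<phi> d \<in> darts G'" "att G' (on0 \<phi> d) \<in> emb_verts (on1 \<phi> (att G d))"
proof -
  note D = graphical_mapD[OF p] note GD = graphD[OF D(1)]
  let ?v = "att G d"
  have v: "?v \<in> verts G" by (rule GD(7)[OF d])
  note e = D(10)[OF v]
  let ?K = "emb_dom (on1 \<phi> ?v)" and ?k = "emb_map (on1 \<phi> ?v)"
  note E = embeddingD[OF e]
  have "d \<in> nb G ?v" using d by (simp add: nb_def)
  then have "on0 \<phi> (dag G d) \<in> emb_bdry (on1 \<phi> ?v)" unfolding graphical_map_bdry[OF p v] by blast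
  then obtain b where b: "b \<in> bdry ?K" "on0 \<phi> (dag G d) = on_arcs ?k b" unfolding emb_bdry_def by blast
  have bA: "b \<in> arcs ?K" "b \<notin> inc ?K ` darts ?K" using b(1) graphD(8)[OF E(1)] by (auto simp: bdry_def)
  have "verts ?K \<noteq> {}" using ne by (simp add: emb_verts_def)
  then have db: "dag ?K b \<in> darts ?K"
    using presentation.flip_dart[OF E(3) _ bA] graphD(8)[OF E(1)] by simp
  have "on0 \<phi> d = dag G' (on_arcs ?k b)"
    using b(2) D(9)[OF GD(2)[OF GD(5)[OF d]]] GD(3)[OF GD(5)[OF d]] by simp
  then have eq: "on0 \<phi> d = on_arcs ?k (dag ?K b)" using dhomD(7)[OF E(4) bA(1)] by simp
  then have "on0 \<phi> d \<in> on_arcs ?k ` darts ?K" using db by blast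
  then show "on0 \<phi> d \<in> darts G'" "att G' (on0 \<phi> d) \<in> emb_verts (on1 \<phi> ?v)"
    unfolding E(11) by (simp_all add: emb_verts_def)
qed

lemma on0_edge:
  assumes p: "graphical_map G G' \<phi>" and d: "d \<in> darts G"
    and em: "emb_verts (on1 \<phi> (att G d)) = {}"
  shows "\<exists>d'. nb G (att G d) = {d, d'} \<and> d' \<noteq> d \<and> on0 \<phi> d' = dag G' (on0 \<phi> d)"
proof -
  note D = graphical_mapD[OF p] note GD = graphD[OF D(1)] note G'D = graphD[OF D(3)]
  let ?v = "att G d"
  have v: "?v \<in> verts G" by (rule GD(7)[OF d])
  let ?K = "emb_dom (on1 \<phi> ?v)" and ?k = "emb_map (on1 \<phi> ?v)"
  note E = embeddingD[OF D(10)[OF v]]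
  have V: "verts ?K = {}" using em by (simp add: emb_verts_def)
  obtain b where b: "b \<in> arcs ?K" "arcs ?K = {b, dag ?K b}"
    using presentation.no_verts(2)[OF E(3) V] by blast
  have "bdry ?K = {b, dag ?K b}"
    using b(2) presentation.no_verts(1)[OF E(3) V] by (simp add: bdry_def)
  then have eb: "emb_bdry (on1 \<phi> ?v) = {on_arcs ?k b, dag G' (on_arcs ?k b)}"
    using dhomD(7)[OF E(4) b(1)] by (simp add: emb_bdry_def)
  have kb: "on_arcs ?k b \<in> arcs G'" by (rule dhomD(4)[OF E(4) b(1)])
  have nbA: "a \<in> darts G" "a \<in> arcs G" "on0 \<phi> (dag G a) = dag G' (on0 \<phi> a)" if "a \<in> nb G ?v" for a
    using that GD(5) D(9) by (auto simp: nb_def)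
  have dn: "d \<in> nb G ?v" using d by (simp add: nb_def)
  have im: "(\<lambda>a. on0 \<phi> (dag G a)) ` nb G ?v = {on_arcs ?k b, dag G' (on_arcs ?k b)}"
    using graphical_map_bdry[OF p v] eb by simp
  then have "on0 \<phi> (dag G d) \<in> {on_arcs ?k b, dag G' (on_arcs ?k b)}" using dn by blast
  then have im': "(\<lambda>a. on0 \<phi> (dag G a)) ` nb G ?v = {on0 \<phi> (dag G d), dag G' (on0 \<phi> (dag G d))}"
    unfolding im using G'D(3)[OF kb] by auto
  have d0: "dag G' (on0 \<phi> (dag G d)) = on0 \<phi> d"
    using nbA(3)[OF dn] G'D(3)[OF D(7)[OF nbA(2)[OF dn]]] by simp
  then have "on0 \<phi> d \<in> (\<lambda>a. on0 \<phi> (dag G a)) ` nb G ?v" unfolding im' by simp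
  then obtain d' where d': "d' \<in> nb G ?v" "on0 \<phi> d = on0 \<phi> (dag G d')" by blast
  have "on0 \<phi> (dag G d) \<noteq> on0 \<phi> d"
    using nbA(3)[OF dn] G'D(4)[OF D(7)[OF nbA(2)[OF dn]]] by simp
  then have ne: "d' \<noteq> d" using d'(2) by auto
  have inj: "inj_on (\<lambda>a. on0 \<phi> (dag G a)) (nb G ?v)" using D(12)[OF v] by (simp add: bij_betw_def)
  have "a = d \<or> a = d'" if a: "a \<in> nb G ?v" for a
  proof -
    have "on0 \<phi> (dag G a) \<in> {on0 \<phi> (dag G d), on0 \<phi> (dag G d')}"
      using imageI[OF a, of "\<lambda>a. on0 \<phi> (dag G a)"] unfolding im' d0 d'(2) .
    then show ?thesis using inj_onD[OF inj _ a dn] inj_onD[OF inj _ a d'(1)] by blast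
  qed
  then have "nb G ?v = {d, d'}" using dn d'(1) by blast
  moreover have "on0 \<phi> d' = dag G' (on0 \<phi> d)"
    using d'(2) nbA(3)[OF d'(1)] G'D(3)[OF D(7)[OF nbA(2)[OF d'(1)]]] by simp
  ultimately show ?thesis using ne by blast
qed

text \<open>
  Embeddings are not injective on arcs: an edge of \<open>Y\<close> both of whose ends lie in the
  image of \<open>\<rho>\<close> can be cut in \<open>Z\<close>. Lifts along \<open>\<rho>\<close>
  that send boundary arcs to boundary arcs, and have the same vertex sets, are nevertheless equal.
  An arc on which two lifts differ cannot be a boundary arc, nor be incident to a vertex whose
  value is not an edge. At a vertex whose value is an edge, the lifts then also differ on the
  second dart. By connectedness two different lifts differ on every arc, so \<open>X\<close> has
  no boundary and every value is an edge, which is excluded.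
\<close>

lemma lift_unique:
  assumes \<rho>: "embedding Z Y \<rho>"
    and l: "graphical_map X Z l" "on0 l ` bdry X \<subseteq> bdry Z"
    and m: "graphical_map X Z m" "on0 m ` bdry X \<subseteq> bdry Z"
    and eq: "\<And>a. a \<in> arcs X \<Longrightarrow> on_arcs \<rho> (on0 l a) = on_arcs \<rho> (on0 m a)"
    and eqV: "\<And>v. v \<in> verts X \<Longrightarrow> emb_verts (on1 l v) = emb_verts (on1 m v)"
  shows "l = m"
proof (rule graphical_map_eqI[OF l(1) m(1) _ eqV])
  note L = graphical_mapD[OF l(1)] note M = graphical_mapD[OF m(1)]
  note XD = graphD[OF L(1)] note ZD = graphD[OF L(3)] note R = embeddingD[OF \<rho>]
  let ?B = "\<lambda>a. on0 l a \<noteq> on0 m a"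
  \<comment> \<open>the compatible pair to which connectedness of \<open>X\<close> is applied\<close>
  let ?Q = "\<lambda>v. emb_verts (on1 l v) = {} \<and> (\<forall>d\<in>nb X v. ?B d)"
  have bd: "\<not> ?B a" if a: "a \<in> bdry X" for a
  proof -
    have "on0 l a \<in> bdry Z" "on0 m a \<in> bdry Z" using l(2) m(2) a by auto
    moreover have "on_arcs \<rho> (on0 l a) = on_arcs \<rho> (on0 m a)" using eq a by (simp add: bdry_def)
    ultimately show ?thesis using inj_onD[OF R(9)] by blast
  qed
  have dagB: "?B (dag X a) = ?B a" if a: "a \<in> arcs X" for a
    using L(9)[OF a] M(9)[OF a] ZD(3)[OF L(7)[OF a]] ZD(3)[OF M(7)[OF a]] by metis
  have step: "?Q (att X d)" if d: "d \<in> darts X" and B: "?B d" for d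
  proof -
    have v: "att X d \<in> verts X" by (rule XD(7)[OF d])
    have em: "emb_verts (on1 l (att X d)) = {}"
    proof (rule ccontr)
      assume ne: "emb_verts (on1 l (att X d)) \<noteq> {}"
      then have ne': "emb_verts (on1 m (att X d)) \<noteq> {}" using eqV[OF v] by simp
      have "on0 l d = on0 m d"
        by (rule inj_onD[OF R(8) eq[OF XD(5)[OF d]] on0_dart(1)[OF l(1) d ne] on0_dart(1)[OF m(1) d ne']])
      then show False using B by simp
    qed
    then have em': "emb_verts (on1 m (att X d)) = {}" using eqV[OF v] by simp
    obtain d1 where d1: "nb X (att X d) = {d, d1}" "d1 \<noteq> d" "on0 l d1 = dag Z (on0 l d)"
      using on0_edge[OF l(1) d em] by blast
    obtain d2 where d2: "nb X (att X d) = {d, d2}" "d2 \<noteq> d" "on0 m d2 = dag Z (on0 m d)"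
      using on0_edge[OF m(1) d em'] by blast
    have d12: "d2 = d1" using d1(1,2) d2(1,2) by auto
    have "?B d1"
    proof
      assume "on0 l d1 = on0 m d1"
      then have "dag Z (on0 l d) = dag Z (on0 m d)" using d1(3) d2(3) d12 by simp
      then show False using B ZD(3)[OF L(7)[OF XD(5)[OF d]]] ZD(3)[OF M(7)[OF XD(5)[OF d]]] by metis
    qed
    then show ?thesis using em B d1(1) by simp
  qed
  have "?Q (att X d) = ?B (inc X d)" if d: "d \<in> darts X" for d
  proof
    assume "?Q (att X d)"
    then show "?B (inc X d)" using d XD(6)[OF d] by (simp add: nb_def)
  next
    assume "?B (inc X d)"
    then show "?Q (att X d)" using step[OF d] XD(6)[OF d] by simp
  qed
  with dagB have "\<exists>b. (\<forall>a\<in>arcs X. ?B a = b) \<and> (\<forall>v\<in>verts X. ?Q v = b)"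
    by (rule linkedD[OF L(2)])
  then obtain b where b: "\<forall>a\<in>arcs X. ?B a = b" "\<forall>v\<in>verts X. ?Q v = b" by blast
  fix a assume a: "a \<in> arcs X"
  show "on0 l a = on0 m a"
  proof (rule ccontr)
    assume "?B a"
    then have b using b(1) a by blast
    then have "bdry X = {}" using b(1) bd by (auto simp: bdry_def)
    then obtain v where "v \<in> verts X" "emb_verts (on1 l v) \<noteq> {}" using L(13) by blast
    then show False using b(2) \<open>b\<close> by blast
  qed
qed

text \<open>
  The image of an active map has the same boundary as the whole target, so
  \<open>embedding_onto\<close> applies.
\<close>

lemma active_cover:
  fixes X Z :: "('a, 'v) graph"
  assumes inf: "infinite (UNIV :: 'a set)"
    and l: "graphical_map X Z l" "on0 l ` bdry X = bdry Z"
  shows "(\<Union>v\<in>verts X. emb_verts (on1 l v)) = verts Z"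
proof -
  note I = gimage[OF inf l(1)]
  have e: "embedding (emb_dom (gimage X Z l)) Z (emb_map (gimage X Z l))" by (rule Emb_rep(1)[OF I(1)])
  have "on_arcs (emb_map (gimage X Z l)) ` bdry (emb_dom (gimage X Z l)) \<subseteq> bdry Z"
    using I(3) l(2) by (simp add: emb_bdry_def)
  then show ?thesis using embedding_onto(1)[OF e] I(2) by (simp add: emb_verts_def)
qed

lemma diso_embedding:
  assumes X: "is_graph X" "linked X" and Y: "is_graph Y" "linked Y" and z: "diso X Y z"
  shows "embedding X Y z" "on_arcs z ` bdry X = bdry Y"
proof -
  note b = z[unfolded diso_iff_bij[OF graphD(1)[OF X(1)]]]
  have h: "z \<in> dhom X Y" and v: "inj_on (on_verts z) (verts X)" using b by (auto simp: bij_betw_def)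
  have "etale X Y z"
    by (rule etaleI[OF graphD(1)[OF X(1)] h v]) (use b in \<open>auto simp: bij_betw_def\<close>)
  then show "embedding X Y z" unfolding embedding_def using X Y v by (simp add: graph_linked)
  show "on_arcs z ` bdry X = bdry Y"
    using diso_loose(1)[OF graphD(1)[OF X(1)] graphD(1)[OF Y(1)] z] loose_graph[OF X(1)] loose_graph[OF Y(1)]
    by simp
qed

text \<open>
  If the values of \<open>\<psi>\<close> over the vertex set of a value of \<open>\<phi>\<close>
  have union \<open>{v}\<close>, and conversely, then disjointness of the values of
  \<open>\<psi>\<close> leaves room for only one vertex.
\<close>

lemma inverse_singletons:
  fixes X Y :: "('a, 'v) graph"
  assumes p: "graphical_map X Y \<phi>" and q: "graphical_map Y X \<psi>"
    and pq: "\<And>v. v \<in> verts X \<Longrightarrow> (\<Union>u\<in>emb_verts (on1 \<phi> v). emb_verts (on1 \<psi> u)) = {v}"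
    and qp: "\<And>u. u \<in> verts Y \<Longrightarrow> (\<Union>v\<in>emb_verts (on1 \<psi> u). emb_verts (on1 \<phi> v)) = {u}"
    and v: "v \<in> verts X"
  shows "\<exists>u\<in>verts Y. emb_verts (on1 \<phi> v) = {u}"
proof -
  note D = graphical_mapD[OF p] note Q = graphical_mapD[OF q]
  have sub: "emb_verts (on1 \<phi> v) \<subseteq> verts Y" by (rule emb_verts_sub[OF D(8)[OF v]])
  obtain u where u: "u \<in> emb_verts (on1 \<phi> v)" using pq[OF v] by blast
  have mem: "v \<in> emb_verts (on1 \<psi> t)" if t: "t \<in> emb_verts (on1 \<phi> v)" for t
  proof -
    have "t \<in> verts Y" using sub t by blast
    then have "emb_verts (on1 \<psi> t) \<noteq> {}" using qp[of t] by auto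
    moreover have "emb_verts (on1 \<psi> t) \<subseteq> {v}" using pq[OF v] t by blast
    ultimately show ?thesis by blast
  qed
  have "t = u" if t: "t \<in> emb_verts (on1 \<phi> v)" for t
    using Q(11)[of t u v] mem[OF t] mem[OF u] sub t u by blast
  then show ?thesis using u sub by blast
qed

text \<open>
  An isomorphism of the graphical category comes from an embedding of graphs and is bijective on
  boundaries: all its values have a single vertex, and darts at \<open>v\<close> go to darts at
  that vertex, for the map and for its inverse. In particular no loop is glued in the values.
\<close>

lemma iso_is_embedding:
  fixes X Y :: "('a, 'v) graph"
  assumes inf: "infinite (UNIV :: 'a set)"
    and p: "graphical_map X Y \<phi>" and q: "graphical_map Y X \<psi>"
    and qp: "gcomp X X \<psi> \<phi> = gmap_of_emb X X (did X)"
    and pq: "gcomp Y Y \<phi> \<psi> = gmap_of_emb Y Y (did Y)"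
  shows "\<exists>z. embedding X Y z \<and> \<phi> = gmap_of_emb X Y z" "bij_betw (on0 \<phi>) (bdry X) (bdry Y)"
proof -
  note D = graphical_mapD[OF p] note Q = graphical_mapD[OF q]
  note XD = graphD[OF D(1)] note YD = graphD[OF D(3)]
  note iX = gmap_of_emb[OF inf graph_did_embedding[OF D(1,2)]]
  note iY = gmap_of_emb[OF inf graph_did_embedding[OF D(3,4)]]
  note cX = gcomp_graphical[OF inf p q] note cY = gcomp_graphical[OF inf q p]
  have a1: "on0 \<psi> (on0 \<phi> a) = a" if "a \<in> arcs X" for a
    using cX(2)[OF that] iX(2) that by (simp add: qp)
  have a2: "on0 \<phi> (on0 \<psi> a) = a" if "a \<in> arcs Y" for a
    using cY(2)[OF that] iY(2) that by (simp add: pq)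
  have v1: "(\<Union>u\<in>emb_verts (on1 \<phi> v). emb_verts (on1 \<psi> u)) = {v}" if "v \<in> verts X" for v
    using cX(3)[OF that] iX(3)[OF that] that by (simp add: qp)
  have v2: "(\<Union>u\<in>emb_verts (on1 \<psi> v). emb_verts (on1 \<phi> u)) = {v}" if "v \<in> verts Y" for v
    using cY(3)[OF that] iY(3)[OF that] that by (simp add: pq)
  have s1: "\<exists>u\<in>verts Y. emb_verts (on1 \<phi> v) = {u}" if "v \<in> verts X" for v
    by (rule inverse_singletons[OF p q v1 v2 that])
  have s2: "\<exists>u\<in>verts X. emb_verts (on1 \<psi> v) = {u}" if "v \<in> verts Y" for v
    by (rule inverse_singletons[OF q p v2 v1 that])
  define \<sigma> where "\<sigma> v = the_elem (emb_verts (on1 \<phi> v))" for v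
  have \<sigma>: "emb_verts (on1 \<phi> v) = {\<sigma> v}" "\<sigma> v \<in> verts Y" if v: "v \<in> verts X" for v
  proof -
    obtain u where u: "u \<in> verts Y" "emb_verts (on1 \<phi> v) = {u}" using s1[OF v] by blast
    then show "emb_verts (on1 \<phi> v) = {\<sigma> v}" "\<sigma> v \<in> verts Y" by (simp_all add: \<sigma>_def)
  qed
  have d1: "on0 \<phi> d \<in> darts Y" "att Y (on0 \<phi> d) = \<sigma> (att X d)" if d: "d \<in> darts X" for d
    using on0_dart[OF p d] \<sigma>(1)[OF XD(7)[OF d]] by simp_all
  have d2: "on0 \<psi> d \<in> darts X" if d: "d \<in> darts Y" for d
  proof -
    have "emb_verts (on1 \<psi> (att Y d)) \<noteq> {}" using s2[OF YD(7)[OF d]] by auto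
    then show ?thesis by (rule on0_dart(1)[OF q d])
  qed
  show "bij_betw (on0 \<phi>) (bdry X) (bdry Y)"
  proof (rule bij_betw_byWitness[where f' = "on0 \<psi>"])
    show "\<forall>a\<in>bdry X. on0 \<psi> (on0 \<phi> a) = a" "\<forall>a\<in>bdry Y. on0 \<phi> (on0 \<psi> a) = a"
      using a1 a2 by (auto simp: bdry_def)
    show "on0 \<phi> ` bdry X \<subseteq> bdry Y"
    proof
      fix y assume "y \<in> on0 \<phi> ` bdry X"
      then obtain a where a: "a \<in> arcs X" "a \<notin> darts X" "y = on0 \<phi> a" by (auto simp: bdry_def)
      then have "y \<notin> darts Y" using d2[of y] a1[OF a(1)] by auto
      then show "y \<in> bdry Y" using D(7)[OF a(1)] a(3) by (simp add: bdry_def)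
    qed
    show "on0 \<psi> ` bdry Y \<subseteq> bdry X"
    proof
      fix y assume "y \<in> on0 \<psi> ` bdry Y"
      then obtain a where a: "a \<in> arcs Y" "a \<notin> darts Y" "y = on0 \<psi> a" by (auto simp: bdry_def)
      then have "y \<notin> darts X" using d1(1)[of y] a2[OF a(1)] by auto
      then show "y \<in> bdry X" using Q(7)[OF a(1)] a(3) by (simp add: bdry_def)
    qed
  qed
  define z :: "('a, 'a, 'v, 'a, 'a, 'v) dmap" where
    "z = \<lparr>on_arcs = on0 \<phi>, on_darts = restrict (on0 \<phi>) (darts X), on_verts = restrict \<sigma> (verts X)\<rparr>"
  have zh: "z \<in> dhom X Y"
    unfolding dhom_def mem_Collect_eq
  proof (intro conjI ballI)
    show "on_arcs z \<in> arcs X \<rightarrow>\<^sub>E arcs Y" using D(5) by (simp add: z_def)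
    show "on_darts z \<in> darts X \<rightarrow>\<^sub>E darts Y" using d1(1) by (simp add: z_def)
    show "on_verts z \<in> verts X \<rightarrow>\<^sub>E verts Y" using \<sigma>(2) by (simp add: z_def)
    show "on_arcs z (dag X a) = dag Y (on_arcs z a)" if "a \<in> arcs X" for a
      using D(9)[OF that] by (simp add: z_def)
    show "on_arcs z (inc X d) = inc Y (on_darts z d)" if d: "d \<in> darts X" for d
      using XD(6)[OF d] YD(6)[OF d1(1)[OF d]] d by (simp add: z_def)
    show "on_verts z (att X d) = att Y (on_darts z d)" if d: "d \<in> darts X" for d
      using XD(7)[OF d] d1(2)[OF d] d by (simp add: z_def)
  qed
  have zv: "inj_on (on_verts z) (verts X)"
  proof (rule inj_onI)
    fix v w assume vw: "v \<in> verts X" "w \<in> verts X" "on_verts z v = on_verts z w"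
    then have "\<sigma> v = \<sigma> w" by (simp add: z_def)
    then show "v = w" using D(11)[OF vw(1,2), of "\<sigma> v"] \<sigma>(1)[OF vw(1)] \<sigma>(1)[OF vw(2)] by simp
  qed
  have "etale X Y z"
  proof (rule etaleI[OF XD(1) zh zv])
    show "inj_on (on_darts z) (darts X)"
    proof (rule inj_onI)
      fix d e assume de: "d \<in> darts X" "e \<in> darts X" "on_darts z d = on_darts z e"
      then have "on0 \<phi> d = on0 \<phi> e" by (simp add: z_def)
      then show "d = e" using a1[OF XD(5)[OF de(1)]] a1[OF XD(5)[OF de(2)]] by metis
    qed
    fix e assume e: "e \<in> darts Y"
    show "e \<in> on_darts z ` darts X"
      by (rule rev_image_eqI[OF d2[OF e]]) (simp add: z_def d2[OF e] a2[OF YD(5)[OF e]])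
  qed
  then have ze: "embedding X Y z"
    unfolding embedding_def using D(1-4) zv by (simp add: graph_linked)
  note g = gmap_of_emb[OF inf ze]
  have zv': "on_verts z v = \<sigma> v" if "v \<in> verts X" for v
    using that by (simp_all add: z_def)
  have "\<phi> = gmap_of_emb X Y z"
    by (rule graphical_map_eqI[OF p g(1)]) (simp_all add: g(2,3) \<sigma>(1) zv', simp add: z_def)
  then show "\<exists>z. embedding X Y z \<and> \<phi> = gmap_of_emb X Y z" using ze by blast
qed

section \<open>The factorization system\<close>

lemma graphical_category_simps:
  "obj graphical_category = {G. is_graph G \<and> dconnected G}"
  "hom graphical_category G G' = {\<phi>. graphical_map G G' \<phi>}"
  "ident graphical_category G = gmap_of_emb G G (did G)"
  "cmp graphical_category G H L = gcomp G L"
  by (simp_all add: graphical_category_def)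

lemma isos_iff:
  "\<phi> \<in> isos graphical_category X Y \<longleftrightarrow> graphical_map X Y \<phi> \<and> (\<exists>\<psi>. graphical_map Y X \<psi> \<and>
    gcomp X X \<psi> \<phi> = gmap_of_emb X X (did X) \<and> gcomp Y Y \<phi> \<psi> = gmap_of_emb Y Y (did Y))"
  unfolding isos_def graphical_category_simps by blast

lemma isosE:
  fixes X Y :: "('a, 'v) graph"
  assumes inf: "infinite (UNIV :: 'a set)" and i: "\<phi> \<in> isos graphical_category X Y"
  obtains z where "graphical_map X Y \<phi>" "embedding X Y z" "\<phi> = gmap_of_emb X Y z"
    "bij_betw (on0 \<phi>) (bdry X) (bdry Y)"
proof -
  obtain \<psi> where p: "graphical_map X Y \<phi>" and q: "graphical_map Y X \<psi>"
    and qp: "gcomp X X \<psi> \<phi> = gmap_of_emb X X (did X)"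
    and pq: "gcomp Y Y \<phi> \<psi> = gmap_of_emb Y Y (did Y)"
    using i unfolding isos_iff by blast
  note r = iso_is_embedding[OF inf p q qp pq]
  obtain z where "embedding X Y z" "\<phi> = gmap_of_emb X Y z" using r(1) by blast
  then show ?thesis using that p r(2) by blast
qed

lemma factorization_exists:
  fixes X Y :: "('a, 'v) graph"
  assumes inf: "infinite (UNIV :: 'a set)" and f: "graphical_map X Y f"
  shows "\<exists>Z\<in>{G. is_graph G \<and> dconnected G}. \<exists>l\<in>active_maps X Z. \<exists>r\<in>embedding_maps Z Y.
    gcomp X Y r l = f"
proof -
  obtain Z :: "('a, 'v) graph" and \<rho> l where e: "embedding Z Y \<rho>"
    and l: "graphical_map X Z l" "bij_betw (on0 l) (bdry X) (bdry Z)"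
    and a: "\<forall>a\<in>arcs X. on_arcs \<rho> (on0 l a) = on0 f a"
    and v: "\<forall>v\<in>verts X. on_verts \<rho> ` emb_verts (on1 l v) = emb_verts (on1 f v)"
    using gimage_factorization[OF inf f] by (elim exE conjE) (rule that)
  note c = gcomp_emb_left[OF inf l(1) e]
  have "gcomp X Y (gmap_of_emb Z Y \<rho>) l = f"
    by (rule graphical_map_eqI[OF c(1) f]) (simp_all add: c(2,3) a v)
  moreover have "l \<in> active_maps X Z" using l by (simp add: active_maps_def)
  moreover have "gmap_of_emb Z Y \<rho> \<in> embedding_maps Z Y" using e by (auto simp: embedding_maps_def)
  moreover have "Z \<in> {G. is_graph G \<and> dconnected G}" using e by (simp add: embedding_def)
  ultimately show ?thesis by blast
qed

text \<open>
  In any factorization into an active map followed by an embedding, the embedding represents the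
  image of the composite.
\<close>

lemma factorization_image:
  fixes X Z Y :: "('a, 'v) graph"
  assumes inf: "infinite (UNIV :: 'a set)"
    and l: "graphical_map X Z l" "bij_betw (on0 l) (bdry X) (bdry Z)"
    and e: "embedding Z Y \<rho>" and c: "gcomp X Y (gmap_of_emb Z Y \<rho>) l = f"
  shows "on_verts \<rho> ` verts Z = (\<Union>v\<in>verts X. emb_verts (on1 f v))"
    "on_arcs \<rho> ` bdry Z = on0 f ` bdry X"
    "\<And>a. a \<in> arcs X \<Longrightarrow> on_arcs \<rho> (on0 l a) = on0 f a"
    "\<And>v. v \<in> verts X \<Longrightarrow> on_verts \<rho> ` emb_verts (on1 l v) = emb_verts (on1 f v)"
proof -
  note C = gcomp_emb_left[OF inf l(1) e, unfolded c]
  have lb: "on0 l ` bdry X = bdry Z" using l(2) by (simp add: bij_betw_def)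
  show A: "on_arcs \<rho> (on0 l a) = on0 f a" if "a \<in> arcs X" for a using C(2)[OF that] by simp
  show V: "on_verts \<rho> ` emb_verts (on1 l v) = emb_verts (on1 f v)" if "v \<in> verts X" for v
    using C(3)[OF that] by simp
  have "on_verts \<rho> ` verts Z = (\<Union>v\<in>verts X. on_verts \<rho> ` emb_verts (on1 l v))"
    unfolding active_cover[OF inf l(1) lb, symmetric] by (rule image_UN)
  also have "\<dots> = (\<Union>v\<in>verts X. emb_verts (on1 f v))" by (intro SUP_cong refl V)
  finally show "on_verts \<rho> ` verts Z = (\<Union>v\<in>verts X. emb_verts (on1 f v))" .
  show "on_arcs \<rho> ` bdry Z = on0 f ` bdry X"
    unfolding lb[symmetric] image_image by (intro image_cong refl A) (simp add: bdry_def)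
qed

lemma factorization_unique:
  fixes X Z Z' Y :: "('a, 'v) graph"
  assumes inf: "infinite (UNIV :: 'a set)"
    and l: "l \<in> active_maps X Z" and r: "r \<in> embedding_maps Z Y"
    and l': "l' \<in> active_maps X Z'" and r': "r' \<in> embedding_maps Z' Y"
    and c: "gcomp X Y r l = f" and c': "gcomp X Y r' l' = f"
  shows "\<exists>!h. h \<in> isos graphical_category Z Z' \<and> gcomp X Z' h l = l' \<and> gcomp Z Y r' h = r"
proof -
  obtain \<rho> where e: "embedding Z Y \<rho>" and r_eq: "r = gmap_of_emb Z Y \<rho>"
    using r unfolding embedding_maps_def by blast
  obtain \<rho>' where e': "embedding Z' Y \<rho>'" and r'_eq: "r' = gmap_of_emb Z' Y \<rho>'"
    using r' unfolding embedding_maps_def by blast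
  have lg: "graphical_map X Z l" "bij_betw (on0 l) (bdry X) (bdry Z)"
    and lg': "graphical_map X Z' l'" "bij_betw (on0 l') (bdry X) (bdry Z')"
    using l l' by (auto simp: active_maps_def)
  note E = embeddingD[OF e] note E' = embeddingD[OF e']
  note I = factorization_image[OF inf lg e c[unfolded r_eq]]
  note I' = factorization_image[OF inf lg' e' c'[unfolded r'_eq]]
  have V: "on_verts \<rho> ` verts Z = on_verts \<rho>' ` verts Z'" using I(1) I'(1) by simp
  have B: "on_arcs \<rho> ` loose Z = on_arcs \<rho>' ` loose Z'"
    using I(2) I'(2) loose_graph[OF E(1)] loose_graph[OF E'(1)] by simp
  obtain z where z: "diso Z Z' z" and zr: "\<rho> = dcomp Z \<rho>' z"
    using presentation_unique[OF E(3) E'(3) V B] by blast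
  note ze = diso_embedding[OF E(1,5) E'(1,5) z]
  obtain w where w: "diso Z' Z w" "dcomp Z w z = did Z" "dcomp Z' z w = did Z'"
    using z unfolding diso_def by blast
  note we = diso_embedding[OF E'(1,5) E(1,5) w(1)]
  let ?h = "gmap_of_emb Z Z' z"
  note H = gmap_of_emb[OF inf ze(1)]
  have hb: "on0 ?h ` bdry Z \<subseteq> bdry Z'" using H(2) ze(2) by simp
  have rh: "gcomp Z Y r' ?h = r"
    unfolding r'_eq r_eq gcomp_gmap_of_emb[OF inf ze(1) e'] zr[symmetric] ..
  have h_iso: "?h \<in> isos graphical_category Z Z'"
    unfolding isos_iff
  proof (intro conjI exI[of _ "gmap_of_emb Z' Z w"])
    show "graphical_map Z Z' ?h" by (rule H(1))
    show "graphical_map Z' Z (gmap_of_emb Z' Z w)" by (rule gmap_of_emb(1)[OF inf we(1)])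
    show "gcomp Z Z (gmap_of_emb Z' Z w) ?h = gmap_of_emb Z Z (did Z)"
      unfolding gcomp_gmap_of_emb[OF inf ze(1) we(1)] w(2) ..
    show "gcomp Z' Z' ?h (gmap_of_emb Z' Z w) = gmap_of_emb Z' Z' (did Z')"
      unfolding gcomp_gmap_of_emb[OF inf we(1) ze(1)] w(3) ..
  qed
  have hl: "gcomp X Z' ?h l = l'"
  proof -
    note C = gcomp_emb_left[OF inf lg(1) ze(1)]
    have lb: "on0 l ` bdry X = bdry Z" using lg(2) by (simp add: bij_betw_def)
    have "on0 (gcomp X Z' ?h l) ` bdry X = on_arcs z ` on0 l ` bdry X"
      unfolding image_image by (intro image_cong refl C(2)) (simp add: bdry_def)
    then have 1: "on0 (gcomp X Z' ?h l) ` bdry X \<subseteq> bdry Z'" using lb ze(2) by simp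
    have 2: "on0 l' ` bdry X \<subseteq> bdry Z'" using lg'(2) by (simp add: bij_betw_def)
    show ?thesis
    proof (rule lift_unique[OF e' C(1) 1 lg'(1) 2])
      show "on_arcs \<rho>' (on0 (gcomp X Z' ?h l) a) = on_arcs \<rho>' (on0 l' a)" if a: "a \<in> arcs X" for a
      proof -
        have "on0 l a \<in> arcs Z" by (rule graphical_mapD(7)[OF lg(1) a])
        then have "on_arcs \<rho>' (on_arcs z (on0 l a)) = on_arcs \<rho> (on0 l a)" by (simp add: zr)
        then show ?thesis using C(2)[OF a] I(3)[OF a] I'(3)[OF a] by simp
      qed
      show "emb_verts (on1 (gcomp X Z' ?h l) v) = emb_verts (on1 l' v)" if v: "v \<in> verts X" for v
      proof (rule iffD1[OF inj_on_image_eq_iff[OF E'(7)]])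
        have s: "emb_verts (on1 l v) \<subseteq> verts Z"
          by (rule emb_verts_sub[OF graphical_mapD(8)[OF lg(1) v]])
        show "emb_verts (on1 l' v) \<subseteq> verts Z'"
          by (rule emb_verts_sub[OF graphical_mapD(8)[OF lg'(1) v]])
        show "emb_verts (on1 (gcomp X Z' ?h l) v) \<subseteq> verts Z'"
          by (rule emb_verts_sub[OF graphical_mapD(8)[OF C(1) v]])
        have "on_verts \<rho>' ` on_verts z ` emb_verts (on1 l v) = on_verts \<rho> ` emb_verts (on1 l v)"
          unfolding image_image by (intro image_cong refl) (use s in \<open>auto simp: zr\<close>)
        then show "on_verts \<rho>' ` emb_verts (on1 (gcomp X Z' ?h l) v) = on_verts \<rho>' ` emb_verts (on1 l' v)"
          using C(3)[OF v] I(4)[OF v] I'(4)[OF v] by simp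
      qed
    qed
  qed
  have uniq: "h = ?h" if h: "h \<in> isos graphical_category Z Z'" and hr: "gcomp Z Y r' h = r" for h
  proof -
    obtain w where hg: "graphical_map Z Z' h" and w: "embedding Z Z' w" "h = gmap_of_emb Z Z' w"
      and hb': "bij_betw (on0 h) (bdry Z) (bdry Z')"
      by (rule isosE[OF inf h])
    note W = gmap_of_emb[OF inf w(1)] and WD = embeddingD(4)[OF w(1)]
    have eq: "gmap_of_emb Z Y (dcomp Z \<rho>' w) = gmap_of_emb Z Y \<rho>"
      using hr unfolding w(2) r'_eq r_eq gcomp_gmap_of_emb[OF inf w(1) e'] .
    note U = gmap_of_emb[OF inf embedding_dcomp[OF e' w(1)], unfolded eq]
      and T = gmap_of_emb[OF inf e]
    show ?thesis
    proof (rule lift_unique[OF e' hg _ H(1) hb])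
      show "on0 h ` bdry Z \<subseteq> bdry Z'" using hb' by (simp add: bij_betw_def)
      show "on_arcs \<rho>' (on0 h a) = on_arcs \<rho>' (on0 ?h a)" if a: "a \<in> arcs Z" for a
      proof -
        have "on_arcs (dcomp Z \<rho>' w) a = on_arcs (dcomp Z \<rho>' z) a"
          using U(2) T(2) zr by simp
        then show ?thesis using a W(2) H(2) w(2) by simp
      qed
      show "emb_verts (on1 h v) = emb_verts (on1 ?h v)" if v: "v \<in> verts Z" for v
      proof -
        have "on_verts (dcomp Z \<rho>' w) v = on_verts \<rho> v" using U(3)[OF v] T(3)[OF v] by simp
        then have "on_verts \<rho>' (on_verts w v) = on_verts \<rho>' (on_verts z v)"
          using v zr by (metis dcomp_simps(3))
        then have "on_verts w v = on_verts z v"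
          by (rule inj_onD[OF E'(7) _ dhomD(6)[OF WD v] dhomD(6)[OF embeddingD(4)[OF ze(1)] v]])
        then show ?thesis using W(3)[OF v] H(3)[OF v] w(2) by simp
      qed
    qed
  qed
  show ?thesis
  proof (rule ex1I[of _ ?h])
    show "?h \<in> isos graphical_category Z Z' \<and> gcomp X Z' ?h l = l' \<and> gcomp Z Y r' ?h = r"
      using h_iso hl rh by blast
    show "h = ?h" if "h \<in> isos graphical_category Z Z' \<and> gcomp X Z' h l = l' \<and> gcomp Z Y r' h = r" for h
      using uniq that by blast
  qed
qed

theorem theorem2p15:
  assumes "infinite (UNIV :: 'a set)" and "infinite (UNIV :: 'v set)"
  shows "orthogonal_factorization_system
           (graphical_category :: (('a, 'v) graph, ('a, 'v) gmap) cat) active_maps embedding_maps"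
  unfolding orthogonal_factorization_system_def
proof (intro conjI ballI)
  note inf = assms(1)
  let ?U = "graphical_category :: (('a, 'v) graph, ('a, 'v) gmap) cat"
  fix X Y :: "('a, 'v) graph"
  assume X: "X \<in> obj ?U" and Y: "Y \<in> obj ?U"
  show "active_maps X Y \<subseteq> hom ?U X Y" by (auto simp: active_maps_def graphical_category_simps)
  show "embedding_maps X Y \<subseteq> hom ?U X Y"
    using gmap_of_emb(1)[OF inf] by (auto simp: embedding_maps_def graphical_category_simps)
  show "isos ?U X Y \<subseteq> active_maps X Y"
  proof
    fix \<phi> assume "\<phi> \<in> isos ?U X Y"
    then obtain z where "graphical_map X Y \<phi>" "bij_betw (on0 \<phi>) (bdry X) (bdry Y)"
      by (rule isosE[OF inf])
    then show "\<phi> \<in> active_maps X Y" by (simp add: active_maps_def)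
  qed
  show "isos ?U X Y \<subseteq> embedding_maps X Y"
  proof
    fix \<phi> assume "\<phi> \<in> isos ?U X Y"
    then obtain z where "embedding X Y z" "\<phi> = gmap_of_emb X Y z" by (rule isosE[OF inf])
    then show "\<phi> \<in> embedding_maps X Y" unfolding embedding_maps_def by blast
  qed
  show "cmp ?U X Y Z g f \<in> active_maps X Z" if "f \<in> active_maps X Y" "g \<in> active_maps Y Z" for Z f g
  proof -
    have f: "graphical_map X Y f" "bij_betw (on0 f) (bdry X) (bdry Y)"
      and g: "graphical_map Y Z g" "bij_betw (on0 g) (bdry Y) (bdry Z)"
      using that by (auto simp: active_maps_def)
    note c = gcomp_graphical[OF inf f(1) g(1)]
    have "bij_betw (on0 (gcomp X Z g f)) (bdry X) (bdry Z)"
    proof (rule iffD1[OF bij_betw_cong bij_betw_trans[OF f(2) g(2)]])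
      show "(on0 g \<circ> on0 f) a = on0 (gcomp X Z g f) a" if "a \<in> bdry X" for a
        using that c(2) by (simp add: bdry_def)
    qed
    then show ?thesis using c(1) by (simp add: active_maps_def graphical_category_simps)
  qed
  show "cmp ?U X Y Z g f \<in> embedding_maps X Z" if fg: "f \<in> embedding_maps X Y" "g \<in> embedding_maps Y Z"
    for Z f g
  proof -
    obtain p where p: "embedding X Y p" "f = gmap_of_emb X Y p" using fg(1) by (auto simp: embedding_maps_def)
    obtain q where q: "embedding Y Z q" "g = gmap_of_emb Y Z q" using fg(2) by (auto simp: embedding_maps_def)
    show ?thesis
      using embedding_dcomp[OF q(1) p(1)]
      unfolding graphical_category_simps p(2) q(2) gcomp_gmap_of_emb[OF inf p(1) q(1)]
      by (auto simp: embedding_maps_def)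
  qed
  fix f assume "f \<in> hom ?U X Y"
  then have f: "graphical_map X Y f" by (simp add: graphical_category_simps)
  show "\<exists>Z\<in>obj ?U. \<exists>l\<in>active_maps X Z. \<exists>r\<in>embedding_maps Z Y. cmp ?U X Z Y r l = f"
    unfolding graphical_category_simps by (rule factorization_exists[OF inf f])
  show "cmp ?U X Z Y r l = f \<and> cmp ?U X Z' Y r' l' = f \<longrightarrow>
      (\<exists>!h. h \<in> isos ?U Z Z' \<and> cmp ?U X Z Z' h l = l' \<and> cmp ?U Z Z' Y r' h = r)"
    if "l \<in> active_maps X Z" "r \<in> embedding_maps Z Y" "l' \<in> active_maps X Z'" "r' \<in> embedding_maps Z' Y"
    for Z Z' l r l' r'
    unfolding graphical_category_simps using factorization_unique[OF inf that] by blast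
qed

end
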